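(* The category $\mathbf{RUS}$ of $\mathscr R$-unipotent semigroups is equivalent to the category $\mathbf{SC}$ of supported categories.
   Context: Conventions. Mappings, morphisms and functors are composed from left to right ($fg$ means first $f$, then $g$). For a category $\mathcal C$, $v\mathcal C$ denotes its class of objects and $\mathcal C(c,c')$ the set of morphisms from $c$ to $c'$. A monomorphism is a right cancellable morphism and an epimorphism is a left cancellable morphism. Semigroups. A semigroup $S$ is regular if for every $a\in S$ there is $x\in S$ with $axa=a$. A regular semigroup is $\mathscr R$-unipotent if each $\mathscr R$-class (Green's relation) contains a unique idempotent. $\mathbf{RUS}$ is the category of $\mathscr R$-unipotent semigroups with all semigroup homomorphisms as morphisms. Normal categories. A strict preorder is a category with at most one morphism between any two (possibly equal) objects in which the only isomorphisms are identities. A category with subobjects is a small category $\mathcal C$ with a subcategory $\mathcal P$ such that: $\mathcal P$ is a strict preorder with $v\mathcal P=v\mathcal C$; every $f\in\mathcal P$ is a monomorphism in $\mathcal C$; if $f,g\in\mathcal P$ and $f=hg$ with $h\in\mathcal C$, then $h\in\mathcal P$. Morphisms of $\mathcal P$ are called inclusions; $c\preceq c'$ means $\mathcal P(c,c')\neq\emptyset$, and $j(c,c')$ is then the unique inclusion. An inclusion $j\colon c\to c'$ splits if there is $q\colon c'\to c$ in $\mathcal C$ with $jq=1_c$; such a $q$ is called a retraction. A normal factorisation of a morphism $f$ is $f=quj$ with $q$ a retraction, $u$ an isomorphism, $j$ an inclusion. A cone with vertex $z\in v\mathcal C$ is a map $\gamma$ assigning to each $c\in v\mathcal C$ a morphism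 $\gamma(c)\in\mathcal C(c,z)$ such that $j(a,b)\gamma(b)=\gamma(a)$ whenever $a\preceq b$, and $\gamma(c)$ is an isomorphism for at least one $c$; the vertex is denoted $z_\gamma$. $\mathcal C$ is a normal category if it is a category with subobjects in which every inclusion splits, every morphism has a normal factorisation, and for each $c\in v\mathcal C$ there is a cone $\mu$ with vertex $c$ and $\mu(c)=1_c$. In a normal category, for a normal factorisation $f=quj$ the epimorphism $f^\circ:=qu$ does not depend on the factorisation. Semigroup of cones. For a cone $\gamma$ and an epimorphism $f$ with domain $z_\gamma$, $\gamma\ast f$ is the cone $c\mapsto\gamma(c)f$. The set $\widehat{\mathcal C}$ of all cones in a normal category $\mathcal C$ is a regular semigroup under $\gamma\cdot\delta=\gamma\ast(\delta(z_\gamma))^\circ$. Let $\mathscr R$ be Green's relation on $\widehat{\mathcal C}$, $R_\gamma$ the $\mathscr R$-class of $\gamma$; $\widehat{\mathcal C}/\mathscr R$ is partially ordered by $R_\gamma\sqsubseteq R_\delta$ iff the principal right ideal generated by $\gamma$ is contained in that generated by $\delta$. Connected and supported categories. Let $\mathcal C$ be a normal category and $\mathfrak D$ a down-set of $(\widehat{\mathcal C}/\mathscr R,\sqsubseteq)$. An object $c$ is connected by (or to) $\mathfrak d\in\mathfrak D$ if $\mathfrak d$ contains an idempotent cone with vertex $c$; this idempotent cone is then unique and is denoted $\epsilon(c,\mathfrak d)$. $\mathcal C$ is connected by $\mathfrak D$ if every $c\in v\mathcal C$ is connected by some $\mathfrak d\in\mathfrak D$; then the pair is denoted $\mathcal C_{\mathfrak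 D}$ and called a connected category. A connected category is supported if each $c\in v\mathcal C$ is connected by a unique $\mathfrak d\in\mathfrak D$. A CC-morphism from $\mathcal C_{\mathfrak D}$ to $\mathcal C'_{\mathfrak D'}$ is a pair $(F,G)$ where $F\colon\mathcal C\to\mathcal C'$ is an inclusion preserving functor and $G\colon\mathfrak D\to\mathfrak D'$ is an order preserving map such that whenever $c$ is connected to $\mathfrak d$, $F(c)$ is connected to $G(\mathfrak d)$ and $F(\epsilon(c,\mathfrak d)(c'))=\epsilon(F(c),G(\mathfrak d))(F(c'))$ for every $c'\in v\mathcal C$. $\mathbf{CC}$ is the category of connected categories with CC-morphisms, and $\mathbf{SC}$ is its full subcategory of supported categories. *)

theory Defs
  imports "HOL-Library.FuncSet"
begin

section \<open>Categories\<close>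

text \<open>
  Categories are given by carrier sets of objects and arrows. Composition is written from left to
  right: \<open>Comp C f g\<close> is "first \<open>f\<close>, then \<open>g\<close>" and is meaningful when \<open>Cod C f = Dom C g\<close>.
\<close>

record ('o, 'm) precategory =
  Obj :: "'o set"
  Arr :: "'m set"
  Dom :: "'m \<Rightarrow> 'o"
  Cod :: "'m \<Rightarrow> 'o"
  Ide :: "'o \<Rightarrow> 'm"
  Comp :: "'m \<Rightarrow> 'm \<Rightarrow> 'm"

locale category =
  fixes C :: "('o, 'm, 'z) precategory_scheme"
  assumes Dom_closed: "f \<in> Arr C \<Longrightarrow> Dom C f \<in> Obj C"
    and Cod_closed: "f \<in> Arr C \<Longrightarrow> Cod C f \<in> Obj C"
    and Ide_closed: "a \<in> Obj C \<Longrightarrow> Ide C a \<in> Arr C"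
    and Dom_Ide: "a \<in> Obj C \<Longrightarrow> Dom C (Ide C a) = a"
    and Cod_Ide: "a \<in> Obj C \<Longrightarrow> Cod C (Ide C a) = a"
    and Comp_closed: "\<lbrakk>f \<in> Arr C; g \<in> Arr C; Cod C f = Dom C g\<rbrakk> \<Longrightarrow> Comp C f g \<in> Arr C"
    and Dom_Comp: "\<lbrakk>f \<in> Arr C; g \<in> Arr C; Cod C f = Dom C g\<rbrakk> \<Longrightarrow> Dom C (Comp C f g) = Dom C f"
    and Cod_Comp: "\<lbrakk>f \<in> Arr C; g \<in> Arr C; Cod C f = Dom C g\<rbrakk> \<Longrightarrow> Cod C (Comp C f g) = Cod C g"
    and Ide_Comp: "f \<in> Arr C \<Longrightarrow> Comp C (Ide C (Dom C f)) f = f"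
    and Comp_Ide: "f \<in> Arr C \<Longrightarrow> Comp C f (Ide C (Cod C f)) = f"
    and Comp_assoc: "\<lbrakk>f \<in> Arr C; g \<in> Arr C; h \<in> Arr C; Cod C f = Dom C g; Cod C g = Dom C h\<rbrakk>
      \<Longrightarrow> Comp C (Comp C f g) h = Comp C f (Comp C g h)"

text \<open>
  The operations of a record are total functions. The following normalises their values outside the
  carriers, so that two records are equal exactly if they present the same category.
\<close>

definition extensional_category :: "('o, 'm, 'z) precategory_scheme \<Rightarrow> bool" where
  "extensional_category C \<longleftrightarrow>
     Dom C \<in> extensional (Arr C) \<and> Cod C \<in> extensional (Arr C) \<and> Ide C \<in> extensional (Obj C) \<and>
     case_prod (Comp C) \<in> extensional {(f, g). f \<in> Arr C \<and> g \<in> Arr C \<and> Cod C f = Dom C g}"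

definition Hom :: "('o, 'm, 'z) precategory_scheme \<Rightarrow> 'o \<Rightarrow> 'o \<Rightarrow> 'm set" where
  "Hom C a b = {f \<in> Arr C. Dom C f = a \<and> Cod C f = b}"

definition monomorphism :: "('o, 'm, 'z) precategory_scheme \<Rightarrow> 'm \<Rightarrow> bool" where
  "monomorphism C f \<longleftrightarrow> f \<in> Arr C \<and>
     (\<forall>g\<in>Arr C. \<forall>h\<in>Arr C. Cod C g = Dom C f \<and> Cod C h = Dom C f \<and> Comp C g f = Comp C h f
        \<longrightarrow> g = h)"

definition isomorphism :: "('o, 'm, 'z) precategory_scheme \<Rightarrow> 'm \<Rightarrow> bool" where
  "isomorphism C f \<longleftrightarrow> f \<in> Arr C \<and>
     (\<exists>g\<in>Hom C (Cod C f) (Dom C f). Comp C f g = Ide C (Dom C f) \<and> Comp C g f = Ide C (Cod C f))"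

locale cat_functor = source: category C + target: category D
  for C :: "('o, 'm, 'z) precategory_scheme" and D :: "('p, 'n, 'y) precategory_scheme" +
  fixes Fo :: "'o \<Rightarrow> 'p" and Fa :: "'m \<Rightarrow> 'n"
  assumes maps_Obj: "a \<in> Obj C \<Longrightarrow> Fo a \<in> Obj D"
    and maps_Arr: "f \<in> Arr C \<Longrightarrow> Fa f \<in> Hom D (Fo (Dom C f)) (Fo (Cod C f))"
    and maps_Ide: "a \<in> Obj C \<Longrightarrow> Fa (Ide C a) = Ide D (Fo a)"
    and maps_Comp: "\<lbrakk>f \<in> Arr C; g \<in> Arr C; Cod C f = Dom C g\<rbrakk>
      \<Longrightarrow> Fa (Comp C f g) = Comp D (Fa f) (Fa g)"

definition natural_isomorphism ::
  "('o, 'm, 'z) precategory_scheme \<Rightarrow> ('p, 'n, 'y) precategory_scheme \<Rightarrow>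
   ('o \<Rightarrow> 'p) \<Rightarrow> ('m \<Rightarrow> 'n) \<Rightarrow> ('o \<Rightarrow> 'p) \<Rightarrow> ('m \<Rightarrow> 'n) \<Rightarrow> ('o \<Rightarrow> 'n) \<Rightarrow> bool" where
  "natural_isomorphism C D Fo Fa Go Ga \<eta> \<longleftrightarrow>
     cat_functor C D Fo Fa \<and> cat_functor C D Go Ga \<and>
     (\<forall>a\<in>Obj C. \<eta> a \<in> Hom D (Fo a) (Go a) \<and> isomorphism D (\<eta> a)) \<and>
     (\<forall>f\<in>Arr C. Comp D (Fa f) (\<eta> (Cod C f)) = Comp D (\<eta> (Dom C f)) (Ga f))"

definition equivalent_categories ::
  "('o, 'm, 'z) precategory_scheme \<Rightarrow> ('p, 'n, 'y) precategory_scheme \<Rightarrow> bool" where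
  "equivalent_categories C D \<longleftrightarrow>
     (\<exists>Fo Fa Go Ga. cat_functor C D Fo Fa \<and> cat_functor D C Go Ga \<and>
        (\<exists>\<eta>. natural_isomorphism C C (\<lambda>a. a) (\<lambda>f. f) (\<lambda>a. Go (Fo a)) (\<lambda>f. Ga (Fa f)) \<eta>) \<and>
        (\<exists>\<theta>. natural_isomorphism D D (\<lambda>b. Fo (Go b)) (\<lambda>g. Fa (Ga g)) (\<lambda>b. b) (\<lambda>g. g) \<theta>))"

definition full_subcategory :: "('o, 'm) precategory \<Rightarrow> 'o set \<Rightarrow> ('o, 'm) precategory" where
  "full_subcategory C X =
     C\<lparr>Obj := Obj C \<inter> X, Arr := {f \<in> Arr C. Dom C f \<in> X \<and> Cod C f \<in> X}\<rparr>"

text \<open>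
  Arrows of categories of structures carry their source and target, so that one underlying map
  gives different arrows for different targets.
\<close>

datatype ('x, 'h) arrow = Arrow (Source: 'x) (Map: 'h) (Target: 'x)


section \<open>Semigroups\<close>

record 'a sgrp =
  Carrier :: "'a set"
  Mult :: "'a \<Rightarrow> 'a \<Rightarrow> 'a"

definition is_semigroup :: "'a sgrp \<Rightarrow> bool" where
  "is_semigroup S \<longleftrightarrow>
     (\<forall>a\<in>Carrier S. \<forall>b\<in>Carrier S. Mult S a b \<in> Carrier S) \<and>
     (\<forall>a\<in>Carrier S. \<forall>b\<in>Carrier S. \<forall>c\<in>Carrier S.
        Mult S (Mult S a b) c = Mult S a (Mult S b c))"

definition regular_semigroup :: "'a sgrp \<Rightarrow> bool" where
  "regular_semigroup S \<longleftrightarrow> is_semigroup S \<and>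
     (\<forall>a\<in>Carrier S. \<exists>x\<in>Carrier S. Mult S (Mult S a x) a = a)"

definition idempotents :: "'a sgrp \<Rightarrow> 'a set" where
  "idempotents S = {e \<in> Carrier S. Mult S e e = e}"

definition principal_right_ideal :: "'a sgrp \<Rightarrow> 'a \<Rightarrow> 'a set" where
  "principal_right_ideal S a = insert a {Mult S a s |s. s \<in> Carrier S}"

definition green_R :: "'a sgrp \<Rightarrow> ('a \<times> 'a) set" where
  "green_R S = {(a, b). a \<in> Carrier S \<and> b \<in> Carrier S \<and>
     principal_right_ideal S a = principal_right_ideal S b}"

text \<open>The order on the quotient \<open>Carrier S // green_R S\<close>; the choice of representatives is immaterial.\<close>

definition R_below :: "'a sgrp \<Rightarrow> 'a set \<Rightarrow> 'a set \<Rightarrow> bool" where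
  "R_below S A B \<longleftrightarrow>
     (\<exists>a\<in>A. \<exists>b\<in>B. principal_right_ideal S a \<subseteq> principal_right_ideal S b)"

definition R_unipotent :: "'a sgrp \<Rightarrow> bool" where
  "R_unipotent S \<longleftrightarrow> regular_semigroup S \<and>
     (\<forall>R \<in> Carrier S // green_R S. \<exists>!e. e \<in> R \<and> e \<in> idempotents S)"

definition extensional_sgrp :: "'a sgrp \<Rightarrow> bool" where
  "extensional_sgrp S \<longleftrightarrow> case_prod (Mult S) \<in> extensional (Carrier S \<times> Carrier S)"

definition semigroup_homs :: "'a sgrp \<Rightarrow> 'b sgrp \<Rightarrow> ('a \<Rightarrow> 'b) set" where
  "semigroup_homs S T = {h \<in> Carrier S \<rightarrow>\<^sub>E Carrier T.
     \<forall>a\<in>Carrier S. \<forall>b\<in>Carrier S. h (Mult S a b) = Mult T (h a) (h b)}"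

text \<open>The type \<open>'u\<close> plays the role of the universe from which carriers are taken.\<close>

definition RUS :: "('u sgrp, ('u sgrp, 'u \<Rightarrow> 'u) arrow) precategory" where
  "RUS =
     \<lparr>Obj = {S. R_unipotent S \<and> extensional_sgrp S},
      Arr = {Arrow S h T |S h T. R_unipotent S \<and> extensional_sgrp S \<and>
               R_unipotent T \<and> extensional_sgrp T \<and> h \<in> semigroup_homs S T},
      Dom = Source,
      Cod = Target,
      Ide = (\<lambda>S. Arrow S (\<lambda>x\<in>Carrier S. x) S),
      Comp = (\<lambda>f g. Arrow (Source f) (compose (Carrier (Source f)) (Map g) (Map f)) (Target g))\<rparr>"


section \<open>Normal categories\<close>

record ('o, 'm) subobject_category = "('o, 'm) precategory" +
  Incl :: "'m set"

definition strict_preorder :: "('o, 'm, 'z) precategory_scheme \<Rightarrow> bool" where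
  "strict_preorder P \<longleftrightarrow> category P \<and>
     (\<forall>a\<in>Obj P. \<forall>b\<in>Obj P. \<forall>f\<in>Hom P a b. \<forall>g\<in>Hom P a b. f = g) \<and>
     (\<forall>f. isomorphism P f \<longrightarrow> (\<exists>a\<in>Obj P. f = Ide P a))"

text \<open>
  The distinguished subcategory has all objects, so it is determined by its set \<open>Incl C\<close> of arrows.
\<close>

definition inclusion_category :: "('o, 'm) subobject_category \<Rightarrow> ('o, 'm) subobject_category" where
  "inclusion_category C = C\<lparr>Arr := Incl C\<rparr>"

definition category_with_subobjects :: "('o, 'm) subobject_category \<Rightarrow> bool" where
  "category_with_subobjects C \<longleftrightarrow> category C \<and> Incl C \<subseteq> Arr C \<and>
     strict_preorder (inclusion_category C) \<and>
     (\<forall>f\<in>Incl C. monomorphism C f) \<and>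
     (\<forall>f\<in>Incl C. \<forall>g\<in>Incl C. \<forall>h\<in>Arr C. Cod C h = Dom C g \<and> f = Comp C h g \<longrightarrow> h \<in> Incl C)"

definition inclusions :: "('o, 'm) subobject_category \<Rightarrow> 'o \<Rightarrow> 'o \<Rightarrow> 'm set" where
  "inclusions C a b = Hom C a b \<inter> Incl C"

definition subobject :: "('o, 'm) subobject_category \<Rightarrow> 'o \<Rightarrow> 'o \<Rightarrow> bool" where
  "subobject C a b \<longleftrightarrow> inclusions C a b \<noteq> {}"

definition the_inclusion :: "('o, 'm) subobject_category \<Rightarrow> 'o \<Rightarrow> 'o \<Rightarrow> 'm" where
  "the_inclusion C a b = (THE j. j \<in> inclusions C a b)"

definition splits_by :: "('o, 'm) subobject_category \<Rightarrow> 'm \<Rightarrow> 'm \<Rightarrow> bool" where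
  "splits_by C j q \<longleftrightarrow> j \<in> Incl C \<and> q \<in> Hom C (Cod C j) (Dom C j) \<and>
     Comp C j q = Ide C (Dom C j)"

definition retraction :: "('o, 'm) subobject_category \<Rightarrow> 'm \<Rightarrow> bool" where
  "retraction C q \<longleftrightarrow> (\<exists>j. splits_by C j q)"

definition normal_factorisation ::
  "('o, 'm) subobject_category \<Rightarrow> 'm \<Rightarrow> 'm \<Rightarrow> 'm \<Rightarrow> 'm \<Rightarrow> bool" where
  "normal_factorisation C f q u j \<longleftrightarrow> retraction C q \<and> isomorphism C u \<and> j \<in> Incl C \<and>
     Cod C q = Dom C u \<and> Cod C u = Dom C j \<and> f = Comp C (Comp C q u) j"

definition is_cone :: "('o, 'm) subobject_category \<Rightarrow> 'o \<Rightarrow> ('o \<Rightarrow> 'm) \<Rightarrow> bool" where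
  "is_cone C z \<gamma> \<longleftrightarrow> z \<in> Obj C \<and> \<gamma> \<in> (\<Pi>\<^sub>E c\<in>Obj C. Hom C c z) \<and>
     (\<forall>a\<in>Obj C. \<forall>b\<in>Obj C. subobject C a b \<longrightarrow> Comp C (the_inclusion C a b) (\<gamma> b) = \<gamma> a) \<and>
     (\<exists>c\<in>Obj C. isomorphism C (\<gamma> c))"

definition normal_category :: "('o, 'm) subobject_category \<Rightarrow> bool" where
  "normal_category C \<longleftrightarrow> category_with_subobjects C \<and>
     (\<forall>j\<in>Incl C. \<exists>q. splits_by C j q) \<and>
     (\<forall>f\<in>Arr C. \<exists>q u j. normal_factorisation C f q u j) \<and>
     (\<forall>c\<in>Obj C. \<exists>\<mu>. is_cone C c \<mu> \<and> \<mu> c = Ide C c)"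

text \<open>In a normal category, the following does not depend on the normal factorisation.\<close>

definition epi_component :: "('o, 'm) subobject_category \<Rightarrow> 'm \<Rightarrow> 'm" where
  "epi_component C f = (THE e. \<exists>q u j. normal_factorisation C f q u j \<and> e = Comp C q u)"


section \<open>The semigroup of cones\<close>

text \<open>A cone determines its vertex, as it has a component, and all components end at the vertex.\<close>

definition vertex :: "('o, 'm) subobject_category \<Rightarrow> ('o \<Rightarrow> 'm) \<Rightarrow> 'o" where
  "vertex C \<gamma> = (THE z. is_cone C z \<gamma>)"

definition cone_star :: "('o, 'm) subobject_category \<Rightarrow> ('o \<Rightarrow> 'm) \<Rightarrow> 'm \<Rightarrow> 'o \<Rightarrow> 'm" where
  "cone_star C \<gamma> f = (\<lambda>c\<in>Obj C. Comp C (\<gamma> c) f)"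

definition cone_semigroup :: "('o, 'm) subobject_category \<Rightarrow> ('o \<Rightarrow> 'm) sgrp" where
  "cone_semigroup C =
     \<lparr>Carrier = {\<gamma>. \<exists>z. is_cone C z \<gamma>},
      Mult = (\<lambda>\<gamma> \<delta>. cone_star C \<gamma> (epi_component C (\<delta> (vertex C \<gamma>))))\<rparr>"

definition cone_classes :: "('o, 'm) subobject_category \<Rightarrow> ('o \<Rightarrow> 'm) set set" where
  "cone_classes C = Carrier (cone_semigroup C) // green_R (cone_semigroup C)"

abbreviation class_below ::
  "('o, 'm) subobject_category \<Rightarrow> ('o \<Rightarrow> 'm) set \<Rightarrow> ('o \<Rightarrow> 'm) set \<Rightarrow> bool" where
  "class_below C \<equiv> R_below (cone_semigroup C)"

definition class_down_set :: "('o, 'm) subobject_category \<Rightarrow> ('o \<Rightarrow> 'm) set set \<Rightarrow> bool" where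
  "class_down_set C \<DD> \<longleftrightarrow> \<DD> \<subseteq> cone_classes C \<and>
     (\<forall>d\<in>\<DD>. \<forall>e\<in>cone_classes C. class_below C e d \<longrightarrow> e \<in> \<DD>)"


section \<open>Connected and supported categories\<close>

definition connected_by :: "('o, 'm) subobject_category \<Rightarrow> 'o \<Rightarrow> ('o \<Rightarrow> 'm) set \<Rightarrow> bool" where
  "connected_by C c d \<longleftrightarrow>
     (\<exists>\<gamma>\<in>d. \<gamma> \<in> idempotents (cone_semigroup C) \<and> is_cone C c \<gamma>)"

definition idem_cone :: "('o, 'm) subobject_category \<Rightarrow> 'o \<Rightarrow> ('o \<Rightarrow> 'm) set \<Rightarrow> 'o \<Rightarrow> 'm" where
  "idem_cone C c d =
     (THE \<gamma>. \<gamma> \<in> d \<and> \<gamma> \<in> idempotents (cone_semigroup C) \<and> is_cone C c \<gamma>)"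

record ('o, 'm) ccat =
  Cat :: "('o, 'm) subobject_category"
  Classes :: "('o \<Rightarrow> 'm) set set"

definition connected_category :: "('o, 'm) ccat \<Rightarrow> bool" where
  "connected_category X \<longleftrightarrow>
     normal_category (Cat X) \<and> class_down_set (Cat X) (Classes X) \<and>
     (\<forall>c\<in>Obj (Cat X). \<exists>d\<in>Classes X. connected_by (Cat X) c d)"

definition supported_category :: "('o, 'm) ccat \<Rightarrow> bool" where
  "supported_category X \<longleftrightarrow> connected_category X \<and>
     (\<forall>c\<in>Obj (Cat X). \<exists>!d. d \<in> Classes X \<and> connected_by (Cat X) c d)"

record ('o, 'm, 'p, 'n) cc_map =
  ObjMap :: "'o \<Rightarrow> 'p"
  ArrMap :: "'m \<Rightarrow> 'n"
  ClassMap :: "('o \<Rightarrow> 'm) set \<Rightarrow> ('p \<Rightarrow> 'n) set"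

definition cc_morphism ::
  "('o, 'm) ccat \<Rightarrow> ('p, 'n) ccat \<Rightarrow> ('o, 'm, 'p, 'n) cc_map \<Rightarrow> bool" where
  "cc_morphism X Y \<phi> \<longleftrightarrow>
     cat_functor (Cat X) (Cat Y) (ObjMap \<phi>) (ArrMap \<phi>) \<and>
     (\<forall>j\<in>Incl (Cat X). ArrMap \<phi> j \<in> Incl (Cat Y)) \<and>
     ClassMap \<phi> ` Classes X \<subseteq> Classes Y \<and>
     (\<forall>d\<in>Classes X. \<forall>e\<in>Classes X. class_below (Cat X) d e \<longrightarrow>
        class_below (Cat Y) (ClassMap \<phi> d) (ClassMap \<phi> e)) \<and>
     (\<forall>c\<in>Obj (Cat X). \<forall>d\<in>Classes X. connected_by (Cat X) c d \<longrightarrow>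
        connected_by (Cat Y) (ObjMap \<phi> c) (ClassMap \<phi> d) \<and>
        (\<forall>c'\<in>Obj (Cat X). ArrMap \<phi> (idem_cone (Cat X) c d c') =
           idem_cone (Cat Y) (ObjMap \<phi> c) (ClassMap \<phi> d) (ObjMap \<phi> c')))"

definition extensional_cc_map :: "('o, 'm) ccat \<Rightarrow> ('o, 'm, 'p, 'n) cc_map \<Rightarrow> bool" where
  "extensional_cc_map X \<phi> \<longleftrightarrow>
     ObjMap \<phi> \<in> extensional (Obj (Cat X)) \<and> ArrMap \<phi> \<in> extensional (Arr (Cat X)) \<and>
     ClassMap \<phi> \<in> extensional (Classes X)"

definition CC ::
  "(('o, 'm) ccat, (('o, 'm) ccat, ('o, 'm, 'o, 'm) cc_map) arrow) precategory" where
  "CC =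
     \<lparr>Obj = {X. connected_category X \<and> extensional_category (Cat X)},
      Arr = {Arrow X \<phi> Y |X \<phi> Y. connected_category X \<and> extensional_category (Cat X) \<and>
               connected_category Y \<and> extensional_category (Cat Y) \<and>
               cc_morphism X Y \<phi> \<and> extensional_cc_map X \<phi>},
      Dom = Source,
      Cod = Target,
      Ide = (\<lambda>X. Arrow X
               \<lparr>ObjMap = (\<lambda>c\<in>Obj (Cat X). c),
                ArrMap = (\<lambda>f\<in>Arr (Cat X). f),
                ClassMap = (\<lambda>d\<in>Classes X. d)\<rparr> X),
      Comp = (\<lambda>f g. Arrow (Source f)
               \<lparr>ObjMap = compose (Obj (Cat (Source f))) (ObjMap (Map g)) (ObjMap (Map f)),
                ArrMap = compose (Arr (Cat (Source f))) (ArrMap (Map g)) (ArrMap (Map f)),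
                ClassMap = compose (Classes (Source f)) (ClassMap (Map g)) (ClassMap (Map f))\<rparr>
               (Target g))\<rparr>"

definition SC ::
  "(('o, 'm) ccat, (('o, 'm) ccat, ('o, 'm, 'o, 'm) cc_map) arrow) precategory" where
  "SC = full_subcategory CC {X. supported_category X}"

end

theory Submission
  imports Defs
begin

text \<open>
  An \<open>R\<close>-unipotent semigroup, with reversed multiplication, has exactly one idempotent in each
  \<open>L\<close>-class. Its category of principal left ideals therefore has the idempotents as objects and the
  right translations \<open>(e, u, f)\<close>, with \<open>eu = u = uf\<close>, as arrows. Each element \<open>a\<close> gives the cone
  \<open>c \<mapsto> (c, ca, _)\<close>; by unipotency this regular representation is faithful, its image is a right
  ideal of the semigroup of cones, and the \<open>R\<close>-classes meeting the image form the down-set that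
  makes the category supported.

  This is fully faithful: a CC-morphism maps \<open>(e, u, f)\<close> to a triple whose middle entry \<open>h u\<close> does not
  depend on \<open>e\<close> and \<open>f\<close>, by preservation of inclusions and of the order of classes, and
  \<open>h (ab) = h a h b\<close> because \<open>ab\<close> factors as the composite of \<open>a\<close>, a component of an idempotent
  cone, and \<open>b\<close>. It is essentially surjective: the cones in the classes of a supported category
  form a regular semigroup whose idempotents are the cones \<open>\<epsilon>(c, d)\<close>, one for each object \<open>c\<close>, and
  an arrow \<open>u\<close> from \<open>c\<close> corresponds to the cone \<open>\<epsilon>(c, d) * u\<degree>\<close>. Infinity of the universe is used
  to encode triples; cones are encoded by a single component.
\<close>

section \<open>Categories\<close>

text \<open>The reversal is dictated by the cones. For the idempotent cones selected by a supported
  category, \<open>eps a \<odot> eps b = eps a\<close> holds exactly when the component of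
  \<open>eps b\<close> at \<open>a\<close> is an inclusion. Two \<open>L\<close>-related ones
  therefore have mutually included, hence equal, vertices: the cones yield uniqueness in
  \<open>L\<close>-classes. Reversal exchanges \<open>L\<close> with \<open>R\<close> and changes no
  homomorphism, so nothing is lost. No inverse functor is written down. The semigroup recovered from
  a supported category depends on a chosen injection of its cones into the universe, so it is
  canonical only up to isomorphism. Idempotents can serve as objects directly, but an arrow needs a
  code for the whole triple, since \<open>u\<close> does not determine its domain and codomain. Both
  directions rest on one principle: an arrow is a split epimorphism followed by an inclusion;
  products of cones see only the epimorphism, and the inclusion is determined by its domain and
  codomain.\<close>

lemma HomD:
  assumes "f \<in> Hom C a b"
  shows "f \<in> Arr C" "Dom C f = a" "Cod C f = b"
  using assms by (simp_all add: Hom_def)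

context category
begin

lemma Hom_Obj:
  assumes "f \<in> Hom C a b"
  shows "a \<in> Obj C" "b \<in> Obj C"
  using assms Dom_closed Cod_closed by (auto simp: Hom_def)

lemma Ide_in_Hom: "a \<in> Obj C \<Longrightarrow> Ide C a \<in> Hom C a a"
  by (simp add: Hom_def Ide_closed Dom_Ide Cod_Ide)

lemma Comp_in_Hom: "\<lbrakk>f \<in> Hom C a b; g \<in> Hom C b c\<rbrakk> \<Longrightarrow> Comp C f g \<in> Hom C a c"
  by (simp add: Hom_def Comp_closed Dom_Comp Cod_Comp)

lemma Hom_assoc: "\<lbrakk>f \<in> Hom C a b; g \<in> Hom C b c; h \<in> Hom C c d\<rbrakk>
    \<Longrightarrow> Comp C (Comp C f g) h = Comp C f (Comp C g h)"
  by (simp add: Hom_def Comp_assoc)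

lemma Hom_Ide_left: "f \<in> Hom C a b \<Longrightarrow> Comp C (Ide C a) f = f"
  using Ide_Comp by (auto simp: Hom_def)

lemma Hom_Ide_right: "f \<in> Hom C a b \<Longrightarrow> Comp C f (Ide C b) = f"
  using Comp_Ide by (auto simp: Hom_def)

lemma isomorphismI:
  assumes "f \<in> Hom C a b" "g \<in> Hom C b a" "Comp C f g = Ide C a" "Comp C g f = Ide C b"
  shows "isomorphism C f"
  using assms by (auto simp: isomorphism_def Hom_def)

lemma isomorphismE:
  assumes "isomorphism C f" "f \<in> Hom C a b"
  obtains g where "g \<in> Hom C b a" "Comp C f g = Ide C a" "Comp C g f = Ide C b"
  using assms by (auto simp: isomorphism_def Hom_def)

lemma isomorphism_Ide: "a \<in> Obj C \<Longrightarrow> isomorphism C (Ide C a)"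
  using isomorphismI[OF Ide_in_Hom Ide_in_Hom] Hom_Ide_left[OF Ide_in_Hom] by blast

text \<open>The two one-sided inverses coincide. Needed where they arise from unrelated
  constructions.\<close>

lemma isomorphism_if_left_right_inverse:
  assumes f: "f \<in> Hom C a b" and g: "g \<in> Hom C b a" and h: "h \<in> Hom C b a"
    and gf: "Comp C g f = Ide C b" and fh: "Comp C f h = Ide C a"
  shows "isomorphism C f"
proof -
  have "g = Comp C g (Comp C f h)"
    using Hom_Ide_right[OF g] fh by simp
  also have "\<dots> = h"
    using Hom_assoc[OF g f h] gf Hom_Ide_left[OF h] by simp
  finally show ?thesis
    using isomorphismI[OF f g] gf fh by simp
qed

lemma cat_functor_identity: "cat_functor C C (\<lambda>a. a) (\<lambda>f. f)"
  by unfold_locales (auto simp: Hom_def)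

end

context cat_functor
begin

lemma maps_Hom: "f \<in> Hom C a b \<Longrightarrow> Fa f \<in> Hom D (Fo a) (Fo b)"
  using maps_Arr by (auto simp: Hom_def)

lemma maps_Comp_Hom:
  "\<lbrakk>f \<in> Hom C a b; g \<in> Hom C b c\<rbrakk> \<Longrightarrow> Fa (Comp C f g) = Comp D (Fa f) (Fa g)"
  using maps_Comp by (auto simp: Hom_def)

end

lemma cat_functor_compose:
  assumes "cat_functor C D Fo Fa" "cat_functor D E Go Ga"
  shows "cat_functor C E (\<lambda>a. Go (Fo a)) (\<lambda>f. Ga (Fa f))"
proof -
  interpret F: cat_functor C D Fo Fa by fact
  interpret G: cat_functor D E Go Ga by fact
  show ?thesis
  proof unfold_locales
    fix f g assume fg: "f \<in> Arr C" "g \<in> Arr C" "Cod C f = Dom C g"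
    then have "f \<in> Hom C (Dom C f) (Cod C f)" "g \<in> Hom C (Cod C f) (Cod C g)"
      by (simp_all add: Hom_def)
    then show "Ga (Fa (Comp C f g)) = Comp E (Ga (Fa f)) (Ga (Fa g))"
      using F.maps_Comp_Hom G.maps_Comp_Hom F.maps_Hom by metis
  qed (use F.maps_Obj G.maps_Obj F.maps_Arr G.maps_Hom F.maps_Ide G.maps_Ide in auto)
qed

text \<open>Choose a preimage \<open>Go b\<close> and an isomorphism \<open>\<theta> b\<close> for
  each \<open>b\<close>. Conjugating by these isomorphisms and lifting along \<open>Fa\<close> gives
  the inverse functor; \<open>\<theta>\<close> becomes the counit, and the unit is the lift of its
  inverse.\<close>

lemma equivalent_if_fully_faithful_essentially_surjective:
  assumes F: "cat_functor C D Fo Fa"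
    and full: "\<And>a b g. \<lbrakk>a \<in> Obj C; b \<in> Obj C; g \<in> Hom D (Fo a) (Fo b)\<rbrakk>
      \<Longrightarrow> \<exists>f\<in>Hom C a b. Fa f = g"
    and faithful: "\<And>a b f g. \<lbrakk>f \<in> Hom C a b; g \<in> Hom C a b; Fa f = Fa g\<rbrakk> \<Longrightarrow> f = g"
    and surj: "\<And>b. b \<in> Obj D \<Longrightarrow> \<exists>a\<in>Obj C. \<exists>t\<in>Hom D (Fo a) b. isomorphism D t"
  shows "equivalent_categories C D"
proof -
  interpret F: cat_functor C D Fo Fa by fact
  note compD = F.target.Comp_in_Hom and assocD = F.target.Hom_assoc
  have "\<forall>b\<in>Obj D. \<exists>a t t'. a \<in> Obj C \<and> t \<in> Hom D (Fo a) b \<and> t' \<in> Hom D b (Fo a) \<and>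
      Comp D t t' = Ide D (Fo a) \<and> Comp D t' t = Ide D b"
    using surj F.target.isomorphismE by metis
  then obtain Go \<theta> \<theta>' where Go: "\<And>b. b \<in> Obj D \<Longrightarrow> Go b \<in> Obj C"
    and \<theta>: "\<And>b. b \<in> Obj D \<Longrightarrow> \<theta> b \<in> Hom D (Fo (Go b)) b"
    and \<theta>': "\<And>b. b \<in> Obj D \<Longrightarrow> \<theta>' b \<in> Hom D b (Fo (Go b))"
    and \<theta>\<theta>': "\<And>b. b \<in> Obj D \<Longrightarrow> Comp D (\<theta> b) (\<theta>' b) = Ide D (Fo (Go b))"
    and \<theta>'\<theta>: "\<And>b. b \<in> Obj D \<Longrightarrow> Comp D (\<theta>' b) (\<theta> b) = Ide D b"
    by metis
  \<comment> \<open>The conjugate of \<open>g\<close> by the chosen isomorphisms runs between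
    objects in the image of \<open>Fo\<close>, so fullness can lift it.\<close>
  define cj where "cj g = Comp D (\<theta> (Dom D g)) (Comp D g (\<theta>' (Cod D g)))" for g
  have cj: "cj g \<in> Hom D (Fo (Go a)) (Fo (Go b))"
      "cj g = Comp D (\<theta> a) (Comp D g (\<theta>' b))" if "g \<in> Hom D a b" for g a b
    using that compD[OF \<theta> compD[OF that \<theta>']] F.target.Hom_Obj[OF that]
    by (auto simp: cj_def Hom_def)
  have "\<forall>g\<in>Arr D. \<exists>f\<in>Hom C (Go (Dom D g)) (Go (Cod D g)). Fa f = cj g"
    using full cj(1) Go F.target.Dom_closed F.target.Cod_closed by (auto simp: Hom_def)
  then obtain Ga where Ga0: "\<And>g. g \<in> Arr D \<Longrightarrow> Ga g \<in> Hom C (Go (Dom D g)) (Go (Cod D g))"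
    and FGa: "\<And>g. g \<in> Arr D \<Longrightarrow> Fa (Ga g) = cj g"
    by metis
  have Ga: "Ga g \<in> Hom C (Go a) (Go b)" if "g \<in> Hom D a b" for g a b
    using Ga0 that by (auto simp: Hom_def)
  have \<theta>_nat: "Comp D (cj g) (\<theta> b) = Comp D (\<theta> a) g"
    and \<theta>'_nat: "Comp D (\<theta>' a) (cj g) = Comp D g (\<theta>' b)" if g: "g \<in> Hom D a b" for g a b
  proof -
    note ab = F.target.Hom_Obj[OF g]
    note t = \<theta>[OF ab(1)] \<theta>'[OF ab(1)] \<theta>[OF ab(2)] \<theta>'[OF ab(2)]
    show "Comp D (cj g) (\<theta> b) = Comp D (\<theta> a) g"
      using assocD[OF t(1) compD[OF g t(4)] t(3)] assocD[OF g t(4) t(3)]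
        \<theta>'\<theta>[OF ab(2)] F.target.Hom_Ide_right[OF g] cj(2)[OF g] by simp
    show "Comp D (\<theta>' a) (cj g) = Comp D g (\<theta>' b)"
      using assocD[OF t(2) t(1) compD[OF g t(4)]]
        \<theta>'\<theta>[OF ab(1)] F.target.Hom_Ide_left[OF compD[OF g t(4)]] cj(2)[OF g] by simp
  qed
  have G: "cat_functor D C Go Ga"
  proof unfold_locales
    fix b assume b: "b \<in> Obj D"
    have "Fa (Ga (Ide D b)) = Fa (Ide C (Go b))"
      using FGa[OF F.target.Ide_closed[OF b]] cj(2)[OF F.target.Ide_in_Hom[OF b]]
        F.target.Hom_Ide_left[OF \<theta>'[OF b]] \<theta>\<theta>'[OF b] F.maps_Ide[OF Go[OF b]] by simp
    then show "Ga (Ide D b) = Ide C (Go b)"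
      using faithful[OF Ga[OF F.target.Ide_in_Hom[OF b]] F.source.Ide_in_Hom[OF Go[OF b]]] by simp
  next
    fix f g assume fg: "f \<in> Arr D" "g \<in> Arr D" "Cod D f = Dom D g"
    define a b c where "a = Dom D f" and "b = Cod D f" and "c = Cod D g"
    have f: "f \<in> Hom D a b" and g: "g \<in> Hom D b c"
      using fg by (simp_all add: Hom_def a_def b_def c_def)
    note abc = F.target.Hom_Obj[OF f] F.target.Hom_Obj[OF g]
    have "Fa (Comp C (Ga f) (Ga g)) = Comp D (cj f) (cj g)"
      using F.maps_Comp_Hom[OF Ga[OF f] Ga[OF g]] FGa fg by simp
    also have "\<dots> = Comp D (\<theta> a) (Comp D (Comp D f (\<theta>' b)) (cj g))"
      using assocD[OF \<theta> compD[OF f \<theta>'] cj(1)[OF g]] abc cj(2)[OF f] by simp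
    also have "\<dots> = Comp D (\<theta> a) (Comp D f (Comp D g (\<theta>' c)))"
      using assocD[OF f \<theta>' cj(1)[OF g]] abc \<theta>'_nat[OF g] by simp
    also have "\<dots> = cj (Comp D f g)"
      using assocD[OF f g \<theta>'] abc cj(2)[OF compD[OF f g]] by simp
    also have "\<dots> = Fa (Ga (Comp D f g))"
      using FGa F.target.Comp_closed fg by simp
    finally show "Ga (Comp D f g) = Comp C (Ga f) (Ga g)"
      using faithful[OF Ga[OF compD[OF f g]] F.source.Comp_in_Hom[OF Ga[OF f] Ga[OF g]]] by simp
  qed (use Go Ga0 in auto)
  \<comment> \<open>The unit lifts the inverse of the counit at \<open>Fo a\<close>. Its
    invertibility and naturality are checked after applying \<open>Fa\<close>, which suffices by
    faithfulness.\<close>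
  have "\<forall>a\<in>Obj C. \<exists>h h'. h \<in> Hom C a (Go (Fo a)) \<and> h' \<in> Hom C (Go (Fo a)) a \<and>
      Fa h = \<theta>' (Fo a) \<and> Fa h' = \<theta> (Fo a)"
    using full F.maps_Obj Go \<theta> \<theta>' by metis
  then obtain \<eta> \<eta>' where \<eta>: "\<And>a. a \<in> Obj C \<Longrightarrow> \<eta> a \<in> Hom C a (Go (Fo a))"
    and \<eta>': "\<And>a. a \<in> Obj C \<Longrightarrow> \<eta>' a \<in> Hom C (Go (Fo a)) a"
    and F\<eta>: "\<And>a. a \<in> Obj C \<Longrightarrow> Fa (\<eta> a) = \<theta>' (Fo a)"
    and F\<eta>': "\<And>a. a \<in> Obj C \<Longrightarrow> Fa (\<eta>' a) = \<theta> (Fo a)"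
    by metis
  have iso_\<eta>: "isomorphism C (\<eta> a)" if a: "a \<in> Obj C" for a
  proof (rule F.source.isomorphismI[OF \<eta>[OF a] \<eta>'[OF a]])
    note Fa_obj = F.maps_Obj[OF a] and GFa = Go[OF F.maps_Obj[OF a]]
    show "Comp C (\<eta> a) (\<eta>' a) = Ide C a"
      by (rule faithful[OF F.source.Comp_in_Hom[OF \<eta>[OF a] \<eta>'[OF a]] F.source.Ide_in_Hom[OF a]])
        (simp add: F.maps_Comp_Hom[OF \<eta>[OF a] \<eta>'[OF a]] F\<eta> F\<eta>' a \<theta>'\<theta> Fa_obj F.maps_Ide)
    show "Comp C (\<eta>' a) (\<eta> a) = Ide C (Go (Fo a))"
      by (rule faithful[OF F.source.Comp_in_Hom[OF \<eta>'[OF a] \<eta>[OF a]] F.source.Ide_in_Hom[OF GFa]])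
        (simp add: F.maps_Comp_Hom[OF \<eta>'[OF a] \<eta>[OF a]] F\<eta> F\<eta>' a \<theta>\<theta>' Fa_obj F.maps_Ide GFa)
  qed
  have "natural_isomorphism C C (\<lambda>a. a) (\<lambda>f. f) (\<lambda>a. Go (Fo a)) (\<lambda>f. Ga (Fa f)) \<eta>"
    unfolding natural_isomorphism_def
  proof (intro conjI ballI)
    fix f assume f0: "f \<in> Arr C"
    define a b where "a = Dom C f" and "b = Cod C f"
    have f: "f \<in> Hom C a b"
      using f0 by (simp add: Hom_def a_def b_def)
    note ab = F.source.Hom_Obj[OF f]
    note Ff = F.maps_Hom[OF f]
    have "Fa (Comp C f (\<eta> b)) = Fa (Comp C (\<eta> a) (Ga (Fa f)))"
      using F.maps_Comp_Hom[OF f \<eta>[OF ab(2)]] F.maps_Comp_Hom[OF \<eta>[OF ab(1)] Ga[OF Ff]]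
        FGa[OF HomD(1)[OF Ff]] \<theta>'_nat[OF Ff] F\<eta> ab by simp
    then show "Comp C f (\<eta> (Cod C f)) = Comp C (\<eta> (Dom C f)) (Ga (Fa f))"
      using faithful[OF F.source.Comp_in_Hom[OF f \<eta>[OF ab(2)]]
          F.source.Comp_in_Hom[OF \<eta>[OF ab(1)] Ga[OF Ff]]] a_def b_def by simp
  qed (use F.source.cat_functor_identity cat_functor_compose[OF F G] \<eta> iso_\<eta> in auto)
  moreover have "natural_isomorphism D D (\<lambda>b. Fo (Go b)) (\<lambda>g. Fa (Ga g)) (\<lambda>b. b) (\<lambda>g. g) \<theta>"
    unfolding natural_isomorphism_def
  proof (intro conjI ballI)
    fix b assume b: "b \<in> Obj D"
    show "isomorphism D (\<theta> b)"
      using F.target.isomorphismI[OF \<theta>[OF b] \<theta>'[OF b] \<theta>\<theta>'[OF b] \<theta>'\<theta>[OF b]] .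
  next
    fix g assume "g \<in> Arr D"
    then show "Comp D (Fa (Ga g)) (\<theta> (Cod D g)) = Comp D (\<theta> (Dom D g)) g"
      using \<theta>_nat FGa by (simp add: Hom_def)
  qed (use F.target.cat_functor_identity cat_functor_compose[OF G F] \<theta> in auto)
  ultimately show ?thesis
    using F G unfolding equivalent_categories_def by blast
qed


section \<open>Green's relation\<close>

lemma right_ideal_subset_iff:
  assumes "is_semigroup S" "a \<in> Carrier S" "b \<in> Carrier S"
  shows "principal_right_ideal S a \<subseteq> principal_right_ideal S b
    \<longleftrightarrow> a \<in> principal_right_ideal S b"
proof
  assume "a \<in> principal_right_ideal S b"
  then consider "a = b" | s where "s \<in> Carrier S" "a = Mult S b s"
    by (auto simp: principal_right_ideal_def)
  then show "principal_right_ideal S a \<subseteq> principal_right_ideal S b"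
  proof cases
    case 2
    then have "Mult S a t = Mult S b (Mult S s t)" "Mult S s t \<in> Carrier S"
      if "t \<in> Carrier S" for t
      using assms(1,3) that by (auto simp: is_semigroup_def)
    then show ?thesis
      using 2 by (auto simp: principal_right_ideal_def)
  qed simp
qed (auto simp: principal_right_ideal_def)

lemma mem_right_ideal_idempotent_iff:
  assumes "is_semigroup S" "a \<in> Carrier S" "e \<in> idempotents S"
  shows "a \<in> principal_right_ideal S e \<longleftrightarrow> Mult S e a = a"
proof
  assume "a \<in> principal_right_ideal S e"
  then consider "a = e" | s where "s \<in> Carrier S" "a = Mult S e s"
    by (auto simp: principal_right_ideal_def)
  then show "Mult S e a = a"
    using assms(1,3) unfolding idempotents_def is_semigroup_def
    by cases (simp, metis (mono_tags, lifting) mem_Collect_eq)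
next
  assume "Mult S e a = a"
  then show "a \<in> principal_right_ideal S e"
    using assms(2) by (force simp: principal_right_ideal_def)
qed

lemma equiv_green_R: "equiv (Carrier S) (green_R S)"
  by (rule equivI) (auto simp: green_R_def refl_on_def sym_def trans_def)

lemma green_R_iff:
  assumes "is_semigroup S" "a \<in> Carrier S" "b \<in> Carrier S"
  shows "(a, b) \<in> green_R S
    \<longleftrightarrow> a \<in> principal_right_ideal S b \<and> b \<in> principal_right_ideal S a"
  using assms right_ideal_subset_iff[of S] by (auto simp: green_R_def)

text \<open>All members of an \<open>R\<close>-class generate the same right ideal, so the
  existential witnesses in \<open>R_below\<close> may be exchanged for the given
  representatives.\<close>

lemma R_below_classes_iff:
  assumes "is_semigroup S" "a \<in> Carrier S" "b \<in> Carrier S"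
  shows "R_below S (green_R S `` {a}) (green_R S `` {b}) \<longleftrightarrow> a \<in> principal_right_ideal S b"
proof -
  have eq: "principal_right_ideal S x = principal_right_ideal S c"
    if "x \<in> green_R S `` {c}" for x c
    using that by (simp add: green_R_def)
  have "a \<in> green_R S `` {a}" "b \<in> green_R S `` {b}"
    using assms by (simp_all add: green_R_def)
  then have "R_below S (green_R S `` {a}) (green_R S `` {b})
      \<longleftrightarrow> principal_right_ideal S a \<subseteq> principal_right_ideal S b"
    unfolding R_below_def using eq by metis
  then show ?thesis
    using right_ideal_subset_iff[OF assms] by simp
qed

text \<open>Regularity already provides an idempotent \<open>ax\<close> in the
  \<open>R\<close>-class of \<open>a\<close>, so only uniqueness remains. Idempotents
  \<open>e\<close> and \<open>f\<close> are \<open>R\<close>-related exactly when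
  \<open>ef = f\<close> and \<open>fe = e\<close>.\<close>

lemma R_unipotent_iff:
  "R_unipotent S \<longleftrightarrow> regular_semigroup S \<and>
    (\<forall>e\<in>idempotents S. \<forall>f\<in>idempotents S. Mult S e f = f \<longrightarrow> Mult S f e = e \<longrightarrow> e = f)"
proof (cases "regular_semigroup S")
  case True
  then have S: "is_semigroup S"
    by (simp add: regular_semigroup_def)
  have R: "(e, f) \<in> green_R S \<longleftrightarrow> Mult S e f = f \<and> Mult S f e = e"
    if "e \<in> idempotents S" "f \<in> idempotents S" for e f
    using that green_R_iff[OF S] mem_right_ideal_idempotent_iff[OF S]
    by (auto simp: idempotents_def)
  have ex: "\<exists>e. e \<in> A \<and> e \<in> idempotents S" if A: "A \<in> Carrier S // green_R S" for A
  proof -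
    obtain a where a: "a \<in> Carrier S" "A = green_R S `` {a}"
      using A by (auto elim: quotientE)
    obtain x where x: "x \<in> Carrier S" "Mult S (Mult S a x) a = a"
      using True a by (auto simp: regular_semigroup_def)
    define e where "e = Mult S a x"
    have e: "e \<in> Carrier S" "Mult S e a = a"
      using S a x by (auto simp: is_semigroup_def e_def)
    have ee: "Mult S e e = e"
      using S a(1) x(1) e unfolding is_semigroup_def by (metis e_def)
    then have "(a, e) \<in> green_R S"
      unfolding green_R_iff[OF S a(1) e(1)] using x a e_def
      by (force simp: principal_right_ideal_def)
    then show ?thesis
      using e ee a by (auto simp: idempotents_def)
  qed
  show ?thesis
  proof
    assume "R_unipotent S"
    then have "e = f" if "e \<in> idempotents S" "f \<in> idempotents S" "(e, f) \<in> green_R S" for e f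
    proof -
      have "e \<in> Carrier S"
        using that by (simp add: idempotents_def)
      then have "green_R S `` {e} \<in> Carrier S // green_R S"
        by (rule quotientI)
      moreover have "e \<in> green_R S `` {e}"
        using \<open>e \<in> Carrier S\<close> by (simp add: green_R_def)
      ultimately show ?thesis
        using \<open>R_unipotent S\<close> that unfolding R_unipotent_def by (metis Image_singleton_iff)
    qed
    then show "regular_semigroup S \<and> (\<forall>e\<in>idempotents S. \<forall>f\<in>idempotents S.
        Mult S e f = f \<longrightarrow> Mult S f e = e \<longrightarrow> e = f)"
      using True R by blast
  next
    assume *: "regular_semigroup S \<and> (\<forall>e\<in>idempotents S. \<forall>f\<in>idempotents S.
        Mult S e f = f \<longrightarrow> Mult S f e = e \<longrightarrow> e = f)"
    show "R_unipotent S"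
      unfolding R_unipotent_def
    proof (intro conjI ballI)
      fix A assume A: "A \<in> Carrier S // green_R S"
      then obtain e where e: "e \<in> A" "e \<in> idempotents S"
        using ex by blast
      show "\<exists>!e. e \<in> A \<and> e \<in> idempotents S"
      proof (rule ex1I[of _ e])
        fix f assume f: "f \<in> A \<and> f \<in> idempotents S"
        then have "(f, e) \<in> green_R S"
          using quotient_eq_iff[OF equiv_green_R A A] e by blast
        then show "f = e"
          using R e f * by blast
      qed (use e in blast)
    qed (use True in blast)
  qed
qed (simp add: R_unipotent_def)


section \<open>Normal categories\<close>

locale normal_cat =
  fixes C :: "('o, 'm) subobject_category"
  assumes normal: "normal_category C"
begin

abbreviation comp (infixl "\<cdot>" 70) where "f \<cdot> g \<equiv> Comp C f g"
abbreviation epi ("_\<degree>" [1000] 1000) where "f\<degree> \<equiv> epi_component C f"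

lemma with_subobjects: "category_with_subobjects C"
  using normal by (simp add: normal_category_def)

sublocale category C
  using with_subobjects by (simp add: category_with_subobjects_def)

lemma Incl_Arr: "j \<in> Incl C \<Longrightarrow> j \<in> Arr C"
  using with_subobjects by (auto simp: category_with_subobjects_def)

lemma Incl_category: "category (inclusion_category C)"
  using with_subobjects by (simp add: category_with_subobjects_def strict_preorder_def)

lemma Ide_Incl: "a \<in> Obj C \<Longrightarrow> Ide C a \<in> Incl C"
  using category.Ide_closed[OF Incl_category] by (simp add: inclusion_category_def)

lemma Comp_Incl:
  assumes "i \<in> Incl C" "j \<in> Incl C" "i \<in> Hom C a b" "j \<in> Hom C b c"
  shows "i \<cdot> j \<in> Incl C"
  using category.Comp_closed[OF Incl_category, of i j] assms
  by (simp add: inclusion_category_def Hom_def)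

lemma Incl_unique:
  assumes "i \<in> Incl C" "j \<in> Incl C" "i \<in> Hom C a b" "j \<in> Hom C a b"
  shows "i = j"
proof -
  have "\<forall>a\<in>Obj C. \<forall>b\<in>Obj C. \<forall>f\<in>Hom (inclusion_category C) a b.
      \<forall>g\<in>Hom (inclusion_category C) a b. f = g"
    using with_subobjects
    by (simp add: category_with_subobjects_def strict_preorder_def inclusion_category_def)
  moreover have "i \<in> Hom (inclusion_category C) a b" "j \<in> Hom (inclusion_category C) a b"
    using assms by (simp_all add: inclusion_category_def Hom_def)
  ultimately show ?thesis
    using Hom_Obj[OF assms(3)] by blast
qed

text \<open>Both composites are inclusions parallel to identities, hence identities. So
  \<open>i\<close> is an isomorphism inside the preorder of inclusions, and strictness makes it an
  identity.\<close>

lemma Incl_antisym: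
  assumes "i \<in> Incl C" "j \<in> Incl C" and i: "i \<in> Hom C a b" and j: "j \<in> Hom C b a"
  shows "a = b" "i = Ide C a"
proof -
  note ab = Hom_Obj[OF i]
  have "i \<cdot> j = Ide C a" "j \<cdot> i = Ide C b"
    using Incl_unique[OF Comp_Incl[OF assms(1,2) i j] Ide_Incl[OF ab(1)]
        Comp_in_Hom[OF i j] Ide_in_Hom[OF ab(1)]]
      Incl_unique[OF Comp_Incl[OF assms(2,1) j i] Ide_Incl[OF ab(2)]
        Comp_in_Hom[OF j i] Ide_in_Hom[OF ab(2)]] by simp_all
  then have "isomorphism (inclusion_category C) i"
    using assms by (auto simp: isomorphism_def inclusion_category_def Hom_def)
  then obtain c where "c \<in> Obj C" "i = Ide C c"
    using with_subobjects
    by (auto simp: category_with_subobjects_def strict_preorder_def inclusion_category_def)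
  then show "a = b" "i = Ide C a"
    using i Dom_Ide Cod_Ide by (auto simp: Hom_def)
qed

lemma Incl_cancel:
  assumes "j \<in> Incl C" "j \<in> Hom C b c" "f \<in> Hom C a b" "g \<in> Hom C a b" "f \<cdot> j = g \<cdot> j"
  shows "f = g"
proof -
  have "monomorphism C j"
    using with_subobjects assms(1) unfolding category_with_subobjects_def by (elim conjE) (rule bspec)
  then show ?thesis
    using assms by (auto simp: monomorphism_def Hom_def)
qed

lemma Incl_left_factor:
  assumes "j \<in> Incl C" "h \<cdot> j \<in> Incl C" "h \<in> Hom C a b" "j \<in> Hom C b c"
  shows "h \<in> Incl C"
proof -
  have "\<forall>f\<in>Incl C. \<forall>g\<in>Incl C. \<forall>h\<in>Arr C. Cod C h = Dom C g \<and> f = h \<cdot> g \<longrightarrow> h \<in> Incl C"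
    using with_subobjects unfolding category_with_subobjects_def by (elim conjE)
  then show ?thesis
    using assms by (metis HomD)
qed

section \<open>Split epimorphisms, images and epimorphic components\<close>

text \<open>The part \<open>qu\<close> of a normal factorisation always has a section. Working with
  split epimorphisms turns each cancellation into a computation with that section.\<close>

definition split_epi :: "'m \<Rightarrow> bool" where
  "split_epi e \<longleftrightarrow> e \<in> Arr C \<and> (\<exists>s\<in>Hom C (Cod C e) (Dom C e). s \<cdot> e = Ide C (Cod C e))"

lemma split_epiI: "\<lbrakk>e \<in> Hom C a b; s \<in> Hom C b a; s \<cdot> e = Ide C b\<rbrakk> \<Longrightarrow> split_epi e"
  by (auto simp: split_epi_def Hom_def)

lemma split_epiE:
  assumes "split_epi e" "e \<in> Hom C a b"
  obtains s where "s \<in> Hom C b a" "s \<cdot> e = Ide C b"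
  using assms by (auto simp: split_epi_def Hom_def)

lemma split_epi_isomorphism: "isomorphism C e \<Longrightarrow> split_epi e"
  by (auto simp: isomorphism_def split_epi_def)

lemma split_epi_Comp:
  assumes "split_epi e" "split_epi f" and e: "e \<in> Hom C a b" and f: "f \<in> Hom C b c"
  shows "split_epi (e \<cdot> f)"
proof -
  obtain s where s: "s \<in> Hom C b a" "s \<cdot> e = Ide C b" 
    using split_epiE[OF assms(1) e] .
  obtain t where t: "t \<in> Hom C c b" "t \<cdot> f = Ide C c"
    using split_epiE[OF assms(2) f] .
  have "(t \<cdot> s) \<cdot> (e \<cdot> f) = t \<cdot> ((s \<cdot> e) \<cdot> f)"
    using Hom_assoc[OF t(1) s(1) Comp_in_Hom[OF e f]] Hom_assoc[OF s(1) e f] by simp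
  then show ?thesis
    using split_epiI[OF Comp_in_Hom[OF e f] Comp_in_Hom[OF t(1) s(1)]] s t Hom_Ide_left[OF f] by simp
qed

text \<open>A section \<open>s\<close> of one epimorphism gives
  \<open>i = (s \<cdot> f') \<cdot> i'\<close>. An arrow that becomes an inclusion after composition
  with an inclusion is itself one, so \<open>d\<close> is included in \<open>d'\<close>. By symmetry
  and antisymmetry the images coincide.\<close>

lemma image_unique:
  assumes e: "split_epi e" "e \<in> Hom C a c" and j: "j \<in> Incl C" "j \<in> Hom C c b"
    and e': "split_epi e'" "e' \<in> Hom C a c'" and j': "j' \<in> Incl C" "j' \<in> Hom C c' b"
    and eq: "e \<cdot> j = e' \<cdot> j'"
  shows "c = c'" "e = e'" "j = j'"
proof -
  have factor: "\<exists>h\<in>Incl C. h \<in> Hom C d d'"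
    if f: "split_epi f" "f \<in> Hom C a d" and i: "i \<in> Incl C" "i \<in> Hom C d b"
      and f': "f' \<in> Hom C a d'" and i': "i' \<in> Incl C" "i' \<in> Hom C d' b" and "f \<cdot> i = f' \<cdot> i'"
    for d d' f f' i i'
  proof -
    obtain s where s: "s \<in> Hom C d a" "s \<cdot> f = Ide C d"
      using split_epiE[OF f] by blast
    have "i = s \<cdot> (f \<cdot> i)"
      using Hom_assoc[OF s(1) f(2) i(2)] s(2) Hom_Ide_left[OF i(2)] by simp
    also have "\<dots> = (s \<cdot> f') \<cdot> i'"
      using Hom_assoc[OF s(1) f' i'(2)] that by simp
    finally show ?thesis
      using Incl_left_factor[OF i'(1) _ Comp_in_Hom[OF s(1) f'] i'(2)] i(1)
        Comp_in_Hom[OF s(1) f'] by auto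
  qed
  obtain h h' where h: "h \<in> Incl C" "h \<in> Hom C c c'" "h' \<in> Incl C" "h' \<in> Hom C c' c"
    using factor[OF e j e'(2) j' eq] factor[OF e' j' e(2) j eq[symmetric]] by blast
  show c: "c = c'"
    using Incl_antisym(1)[OF h(1,3,2,4)] .
  show j_eq: "j = j'"
    using Incl_unique[OF j(1) j'(1) j(2)] j'(2) c by simp
  show "e = e'"
    using Incl_cancel[OF j e(2)] e'(2) eq j_eq c by simp
qed

lemma image_exists:
  assumes f: "f \<in> Hom C a b"
  obtains q u j c where "normal_factorisation C f q u j" "q \<cdot> u \<in> Hom C a c"
    "split_epi (q \<cdot> u)" "j \<in> Incl C" "j \<in> Hom C c b" "f = (q \<cdot> u) \<cdot> j"
proof -
  obtain q u j where n: "normal_factorisation C f q u j"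
    using normal HomD(1)[OF f] unfolding normal_category_def
    by (elim conjE) (drule (1) bspec, blast)
  then obtain i where i: "splits_by C i q"
    by (auto simp: normal_factorisation_def retraction_def)
  define d c where "d = Dom C i" and "c = Cod C u"
  have q: "q \<in> Hom C (Cod C i) d" and iq: "i \<cdot> q = Ide C d" and i': "i \<in> Hom C d (Cod C i)"
    using i Incl_Arr by (auto simp: splits_by_def d_def Hom_def)
  have u: "u \<in> Hom C d c" "isomorphism C u"
    using n q by (auto simp: normal_factorisation_def isomorphism_def Hom_def c_def)
  have j: "j \<in> Incl C" "j \<in> Hom C c (Cod C j)" and f_eq: "f = (q \<cdot> u) \<cdot> j"
    using n Incl_Arr by (auto simp: normal_factorisation_def Hom_def c_def)
  have "f \<in> Hom C (Cod C i) (Cod C j)"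
    using Comp_in_Hom[OF Comp_in_Hom[OF q u(1)] j(2)] f_eq by simp
  then have "Cod C i = a" "Cod C j = b"
    using f by (auto simp: Hom_def)
  moreover have "split_epi (q \<cdot> u)"
    using split_epi_Comp[OF split_epiI[OF q i' iq] split_epi_isomorphism[OF u(2)] q u(1)] .
  ultimately show ?thesis
    using that n j f_eq Comp_in_Hom[OF q u(1)] by simp
qed

text \<open>The working description of \<open>f\<degree>\<close>: by uniqueness of images, any
  factorisation into a split epimorphism and an inclusion computes it, without exhibiting a
  retraction and an isomorphism. It also shows that the \<open>THE\<close> in the definition is
  meaningful.\<close>

lemma epi_component_eq:
  assumes e: "split_epi e" "e \<in> Hom C a c" and j: "j \<in> Incl C" "j \<in> Hom C c b"
  shows "(e \<cdot> j)\<degree> = e"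
proof -
  have "(THE x. \<exists>q u i. normal_factorisation C (e \<cdot> j) q u i \<and> x = q \<cdot> u) = e"
  proof (rule the_equality)
    obtain q u i d where n: "normal_factorisation C (e \<cdot> j) q u i" "q \<cdot> u \<in> Hom C a d"
        "split_epi (q \<cdot> u)" "i \<in> Incl C" "i \<in> Hom C d b" "e \<cdot> j = (q \<cdot> u) \<cdot> i"
      using image_exists[OF Comp_in_Hom[OF e(2) j(2)]] by metis
    then show "\<exists>q u i. normal_factorisation C (e \<cdot> j) q u i \<and> e = q \<cdot> u"
      using image_unique(2)[OF e j n(3,2,4,5,6)] by blast
  next
    fix x assume "\<exists>q u i. normal_factorisation C (e \<cdot> j) q u i \<and> x = q \<cdot> u"
    then obtain q u i where n: "normal_factorisation C (e \<cdot> j) q u i" and x: "x = q \<cdot> u"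
      by blast
    obtain h where h: "splits_by C h q"
      using n by (auto simp: normal_factorisation_def retraction_def)
    have q: "q \<in> Hom C (Cod C h) (Dom C h)" "h \<in> Hom C (Dom C h) (Cod C h)"
        "h \<cdot> q = Ide C (Dom C h)"
      using h Incl_Arr by (auto simp: splits_by_def Hom_def)
    have u: "u \<in> Hom C (Dom C h) (Cod C u)" "isomorphism C u"
      using n q by (auto simp: normal_factorisation_def isomorphism_def Hom_def)
    have i: "i \<in> Incl C" "i \<in> Hom C (Cod C u) (Cod C i)" and eq: "e \<cdot> j = (q \<cdot> u) \<cdot> i"
      using n Incl_Arr by (auto simp: normal_factorisation_def Hom_def)
    have qu: "split_epi (q \<cdot> u)" "q \<cdot> u \<in> Hom C (Cod C h) (Cod C u)"
      using split_epi_Comp[OF split_epiI[OF q] split_epi_isomorphism[OF u(2)] q(1) u(1)]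
        Comp_in_Hom[OF q(1) u(1)] by auto
    have "e \<cdot> j \<in> Hom C (Cod C h) (Cod C i)"
      using Comp_in_Hom[OF qu(2) i(2)] eq by simp
    then have "Cod C h = a" "Cod C i = b"
      using Comp_in_Hom[OF e(2) j(2)] by (auto simp: Hom_def)
    then show "x = e"
      using image_unique(2)[OF e j qu(1) _ i(1)] qu i eq x by auto
  qed
  then show ?thesis
    by (simp add: epi_component_def)
qed

lemma epi_componentE:
  assumes "f \<in> Hom C a b"
  obtains c j where "f\<degree> \<in> Hom C a c" "split_epi f\<degree>" "j \<in> Incl C" "j \<in> Hom C c b" "f = f\<degree> \<cdot> j"
  using image_exists[OF assms] epi_component_eq by metis

lemma epi_component_in_Hom:
  assumes "f \<in> Hom C a b"
  shows "f\<degree> \<in> Hom C a (Cod C f\<degree>)" "split_epi f\<degree>"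
  using epi_componentE[OF assms] by (metis HomD(3))+

lemma epi_component_split_epi: "split_epi e \<Longrightarrow> e\<degree> = e"
proof -
  assume e: "split_epi e"
  then have "e \<in> Hom C (Dom C e) (Cod C e)"
    by (simp add: split_epi_def Hom_def)
  then show ?thesis
    using epi_component_eq[OF e _ Ide_Incl Ide_in_Hom] Hom_Obj(2) Hom_Ide_right by fastforce
qed

lemma epi_component_Incl: "j \<in> Incl C \<Longrightarrow> j\<degree> = Ide C (Dom C j)"
proof -
  assume j: "j \<in> Incl C"
  have a: "Dom C j \<in> Obj C" and j': "j \<in> Hom C (Dom C j) (Cod C j)"
    using Incl_Arr[OF j] Dom_closed by (simp_all add: Hom_def)
  show ?thesis
    using epi_component_eq[OF split_epi_isomorphism[OF isomorphism_Ide[OF a]] Ide_in_Hom[OF a] j j']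
      Hom_Ide_left[OF j'] by simp
qed

lemma epi_component_Comp_Incl:
  assumes f: "f \<in> Hom C a b" and j: "j \<in> Incl C" "j \<in> Hom C b c"
  shows "(f \<cdot> j)\<degree> = f\<degree>"
proof -
  obtain d i where fo: "f\<degree> \<in> Hom C a d" "split_epi f\<degree>"
    and i: "i \<in> Incl C" "i \<in> Hom C d b" and "f = f\<degree> \<cdot> i"
    using epi_componentE[OF f] .
  then have "f \<cdot> j = f\<degree> \<cdot> (i \<cdot> j)"
    using Hom_assoc[OF fo(1) i(2) j(2)] by simp
  then show ?thesis
    using epi_component_eq[OF fo(2,1) Comp_Incl[OF i(1) j(1) i(2) j(2)] Comp_in_Hom[OF i(2) j(2)]]
    by simp
qed

lemma epi_component_split_epi_Comp:
  assumes e: "split_epi e" "e \<in> Hom C a b" and f: "f \<in> Hom C b c"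
  shows "(e \<cdot> f)\<degree> = e \<cdot> f\<degree>"
proof -
  obtain d i where fo: "f\<degree> \<in> Hom C b d" "split_epi f\<degree>" and i: "i \<in> Incl C" "i \<in> Hom C d c"
    and "f = f\<degree> \<cdot> i"
    using epi_componentE[OF f] .
  then have "e \<cdot> f = (e \<cdot> f\<degree>) \<cdot> i"
    using Hom_assoc[OF e(2) fo(1) i(2)] by simp
  then show ?thesis
    using epi_component_eq[OF split_epi_Comp[OF e(1) fo(2) e(2) fo(1)] Comp_in_Hom[OF e(2) fo(1)] i]
    by simp
qed

text \<open>Passing from \<open>g\<close> to \<open>g\<degree>\<close> only removes a final
  inclusion, which the epimorphic component ignores.\<close>

lemma epi_component_Comp_epi_component:
  assumes f: "f \<in> Hom C a b" and g: "g \<in> Hom C b c"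
  shows "(f \<cdot> g\<degree>)\<degree> = (f \<cdot> g)\<degree>"
proof -
  obtain d i where go: "g\<degree> \<in> Hom C b d" and i: "i \<in> Incl C" "i \<in> Hom C d c" and "g = g\<degree> \<cdot> i"
    using epi_componentE[OF g] .
  then have "f \<cdot> g = (f \<cdot> g\<degree>) \<cdot> i"
    using Hom_assoc[OF f go i(2)] by simp
  then show ?thesis
    using epi_component_Comp_Incl[OF Comp_in_Hom[OF f go] i] by simp
qed

lemma Incl_if_epi_component_Ide:
  assumes f: "f \<in> Hom C a b" and "f\<degree> = Ide C a"
  shows "f \<in> Incl C"
proof -
  obtain d i where i: "i \<in> Incl C" "i \<in> Hom C d b" "f = f\<degree> \<cdot> i" and "f\<degree> \<in> Hom C a d"
    using epi_componentE[OF f] by metis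
  then have "d = a"
    using assms(2) Cod_Ide[OF Hom_Obj(1)[OF f]] by (auto simp: Hom_def)
  then show ?thesis
    using i assms(2) Hom_Ide_left[OF i(2)] by simp
qed


subsection \<open>Cones\<close>

abbreviation star (infixl "\<star>" 70) where "\<gamma> \<star> e \<equiv> cone_star C \<gamma> e"
abbreviation mult (infixl "\<odot>" 70) where "\<gamma> \<odot> \<delta> \<equiv> Mult (cone_semigroup C) \<gamma> \<delta>"
abbreviation cones where "cones \<equiv> Carrier (cone_semigroup C)"

lemma cones_iff: "\<gamma> \<in> cones \<longleftrightarrow> (\<exists>z. is_cone C z \<gamma>)"
  by (simp add: cone_semigroup_def)

lemma cone_in_cones: "is_cone C z \<gamma> \<Longrightarrow> \<gamma> \<in> cones"
  by (auto simp: cones_iff)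

lemma cone_Hom: "\<lbrakk>is_cone C z \<gamma>; c \<in> Obj C\<rbrakk> \<Longrightarrow> \<gamma> c \<in> Hom C c z"
  by (auto simp: is_cone_def)

lemma the_inclusion_eq:
  assumes "j \<in> Incl C" "j \<in> Hom C a b"
  shows "the_inclusion C a b = j"
  unfolding the_inclusion_def
proof (rule the_equality)
  show "j \<in> inclusions C a b"
    using assms by (simp add: inclusions_def)
  show "i = j" if "i \<in> inclusions C a b" for i
    using that Incl_unique[of i j a b] assms by (simp add: inclusions_def)
qed

lemma cone_natural:
  assumes "is_cone C z \<gamma>" "j \<in> Incl C" "j \<in> Hom C a b"
  shows "j \<cdot> \<gamma> b = \<gamma> a"
proof -
  have "subobject C a b"
    using assms by (auto simp: subobject_def inclusions_def)
  then have "the_inclusion C a b \<cdot> \<gamma> b = \<gamma> a"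
    using assms(1) Hom_Obj[OF assms(3)] by (simp add: is_cone_def)
  then show ?thesis
    using the_inclusion_eq[OF assms(2,3)] by simp
qed

lemma is_coneI:
  assumes "z \<in> Obj C" "\<gamma> \<in> extensional (Obj C)" "\<And>c. c \<in> Obj C \<Longrightarrow> \<gamma> c \<in> Hom C c z"
    and nat: "\<And>j a b. \<lbrakk>j \<in> Incl C; j \<in> Hom C a b\<rbrakk> \<Longrightarrow> j \<cdot> \<gamma> b = \<gamma> a"
    and "c \<in> Obj C" "isomorphism C (\<gamma> c)"
  shows "is_cone C z \<gamma>"
proof -
  have "the_inclusion C a b \<cdot> \<gamma> b = \<gamma> a" if "subobject C a b" for a b
  proof -
    obtain j where j: "j \<in> Incl C" "j \<in> Hom C a b"
      using \<open>subobject C a b\<close> unfolding subobject_def inclusions_def by blast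
    then show ?thesis
      using nat[OF j] the_inclusion_eq[OF j] by simp
  qed
  then show ?thesis
    using assms by (auto simp: is_cone_def PiE_iff)
qed

lemma cone_extensional: "is_cone C z \<gamma> \<Longrightarrow> \<gamma> \<in> extensional (Obj C)"
  by (auto simp: is_cone_def PiE_iff)

lemma cone_vertex_unique:
  assumes "is_cone C z \<gamma>" "is_cone C z' \<gamma>"
  shows "z = z'"
proof -
  obtain c where "c \<in> Obj C"
    using assms by (auto simp: is_cone_def)
  then show ?thesis
    using assms cone_Hom by (metis HomD(3))
qed

lemma vertex_eq: "is_cone C z \<gamma> \<Longrightarrow> vertex C \<gamma> = z"
  unfolding vertex_def using cone_vertex_unique by blast

lemma cone_isoE:
  assumes "is_cone C z \<gamma>"
  obtains c where "c \<in> Obj C" "\<gamma> c \<in> Hom C c z" "isomorphism C (\<gamma> c)"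
  using assms cone_Hom by (auto simp: is_cone_def)

lemma star_apply: "c \<in> Obj C \<Longrightarrow> (\<gamma> \<star> e) c = \<gamma> c \<cdot> e"
  by (simp add: cone_star_def)

text \<open>The difficulty is an isomorphic component: the object \<open>c\<close> where
  \<open>\<gamma>\<close> has one need not serve \<open>\<gamma> \<star> e\<close>. A section
  \<open>s\<close> of \<open>e\<close> followed by the inverse \<open>w\<close> of
  \<open>\<gamma> c\<close> embeds the new vertex in \<open>c\<close>; the image \<open>c'\<close>
  of \<open>s \<cdot> w\<close> is the required object.\<close>

lemma star_cone:
  assumes \<gamma>: "is_cone C z \<gamma>" and e: "split_epi e" "e \<in> Hom C z z'"
  shows "is_cone C z' (\<gamma> \<star> e)"
proof -
  obtain c where c: "c \<in> Obj C" "\<gamma> c \<in> Hom C c z" "isomorphism C (\<gamma> c)"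
    using cone_isoE[OF \<gamma>] .
  obtain w where w: "w \<in> Hom C z c" "w \<cdot> \<gamma> c = Ide C z"
    using isomorphismE[OF c(3,2)] by metis
  obtain s where s: "s \<in> Hom C z' z" "s \<cdot> e = Ide C z'"
    using split_epiE[OF e] .
  have sw: "s \<cdot> w \<in> Hom C z' c"
    using Comp_in_Hom[OF s(1) w(1)] .
  obtain c' j where a: "(s \<cdot> w)\<degree> \<in> Hom C z' c'" "split_epi (s \<cdot> w)\<degree>"
    and j: "j \<in> Incl C" "j \<in> Hom C c' c" and swj: "s \<cdot> w = (s \<cdot> w)\<degree> \<cdot> j"
    using epi_componentE[OF sw] .
  define a where "a = (s \<cdot> w)\<degree>"
  have c': "c' \<in> Obj C" "\<gamma> c' \<in> Hom C c' z" "\<gamma> c' = j \<cdot> \<gamma> c"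
    using Hom_Obj[OF j(2)] cone_Hom[OF \<gamma>] cone_natural[OF \<gamma> j] by simp_all
  have h: "\<gamma> c' \<cdot> e \<in> Hom C c' z'"
    using Comp_in_Hom[OF c'(2) e(2)] .
  have "a \<cdot> (\<gamma> c' \<cdot> e) = (a \<cdot> (j \<cdot> \<gamma> c)) \<cdot> e"
    using Hom_assoc[OF _ c'(2) e(2)] a(1) c' by (simp add: a_def)
  also have "\<dots> = ((a \<cdot> j) \<cdot> \<gamma> c) \<cdot> e"
    using Hom_assoc[OF _ j(2) c(2)] a(1) by (simp add: a_def)
  also have "\<dots> = Ide C z'"
    using Hom_assoc[OF s(1) w(1) c(2)] swj w(2) s Hom_Ide_right[OF s(1)] by (simp add: a_def)
  finally have ah: "a \<cdot> (\<gamma> c' \<cdot> e) = Ide C z'" .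
  \<comment> \<open>The arrow \<open>a\<close> has \<open>\<gamma> c' \<cdot> e\<close> as an
    inverse on one side and, being a split epimorphism, the section \<open>b\<close> on the other.
    So the two agree and are inverse to \<open>a\<close>.\<close>
  obtain b where b: "b \<in> Hom C c' z'" "b \<cdot> a = Ide C c'"
    using split_epiE[OF a(2,1)] by (metis a_def)
  have a': "a \<in> Hom C z' c'" using a by (simp add: a_def)
  have "b = \<gamma> c' \<cdot> e"
    using Hom_assoc[OF b(1) a' h] ah b Hom_Ide_left[OF h] Hom_Ide_right[OF b(1)] by simp
  then have "isomorphism C ((\<gamma> \<star> e) c')"
    using isomorphismI[OF b(1) a' b(2)] ah star_apply[OF c'(1)] by simp
  moreover have "j \<cdot> (\<gamma> \<star> e) b = (\<gamma> \<star> e) a" if j: "j \<in> Incl C" "j \<in> Hom C a b" for j a b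
    using Hom_assoc[OF j(2) cone_Hom[OF \<gamma>] e(2)] Hom_Obj[OF j(2)] cone_natural[OF \<gamma> j]
    by (simp add: star_apply)
  ultimately show ?thesis
    using Hom_Obj[OF e(2)] Comp_in_Hom[OF cone_Hom[OF \<gamma>] e(2)] star_apply c'(1)
    by (intro is_coneI[where c = c']) (auto simp: cone_star_def)
qed

lemma star_star:
  assumes "is_cone C z \<gamma>" "e \<in> Hom C z z'" "f \<in> Hom C z' z''"
  shows "(\<gamma> \<star> e) \<star> f = \<gamma> \<star> (e \<cdot> f)"
  using Hom_assoc[OF cone_Hom[OF assms(1)] assms(2,3)] by (auto simp: cone_star_def)

lemma star_Ide: "is_cone C z \<gamma> \<Longrightarrow> \<gamma> \<star> Ide C z = \<gamma>"
  using Hom_Ide_right[OF cone_Hom] extensional_arb[OF cone_extensional]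
  by (force simp: cone_star_def fun_eq_iff)

lemma mult_eq: "is_cone C z \<gamma> \<Longrightarrow> \<gamma> \<odot> \<delta> = \<gamma> \<star> (\<delta> z)\<degree>"
  by (simp add: cone_semigroup_def vertex_eq)

lemma mult_cone:
  assumes \<gamma>: "is_cone C z \<gamma>" and \<delta>: "is_cone C w \<delta>"
  shows "is_cone C (Cod C (\<delta> z)\<degree>) (\<gamma> \<odot> \<delta>)"
proof -
  have "\<delta> z \<in> Hom C z w"
    using cone_Hom[OF \<delta>] \<gamma> by (simp add: is_cone_def)
  then show ?thesis
    using star_cone[OF \<gamma> epi_component_in_Hom(2,1)] mult_eq[OF \<gamma>] by metis
qed

text \<open>Both sides equal \<open>\<gamma> \<star> (\<delta> z \<cdot> \<eta> w)\<degree>\<close>.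
  The vertex \<open>y\<close> of \<open>\<gamma> \<odot> \<delta>\<close> is the image of
  \<open>\<delta> z\<close>, and naturality of \<open>\<eta>\<close> along the inclusion of
  \<open>y\<close> in \<open>w\<close> relates \<open>\<eta> y\<close> to
  \<open>\<eta> w\<close>.\<close>

lemma mult_assoc:
  assumes \<gamma>: "is_cone C z \<gamma>" and \<delta>: "is_cone C w \<delta>" and \<eta>: "is_cone C v \<eta>"
  shows "(\<gamma> \<odot> \<delta>) \<odot> \<eta> = \<gamma> \<odot> (\<delta> \<odot> \<eta>)"
proof -
  have z: "z \<in> Obj C" and w: "w \<in> Obj C"
    using \<gamma> \<delta> by (simp_all add: is_cone_def)
  note \<delta>z = cone_Hom[OF \<delta> z] and \<eta>w = cone_Hom[OF \<eta> w]
  obtain y j where d: "(\<delta> z)\<degree> \<in> Hom C z y" "split_epi (\<delta> z)\<degree>"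
    and j: "j \<in> Incl C" "j \<in> Hom C y w" and dj: "\<delta> z = (\<delta> z)\<degree> \<cdot> j"
    using epi_componentE[OF \<delta>z] .
  have \<eta>y: "\<eta> y \<in> Hom C y v" "\<eta> y = j \<cdot> \<eta> w"
    using cone_Hom[OF \<eta>] Hom_Obj[OF j(2)] cone_natural[OF \<eta> j] by simp_all
  have "(\<gamma> \<odot> \<delta>) \<odot> \<eta> = (\<gamma> \<star> (\<delta> z)\<degree>) \<star> (\<eta> y)\<degree>"
    using mult_eq[OF mult_cone[OF \<gamma> \<delta>]] mult_eq[OF \<gamma>] d(1) by (simp add: Hom_def)
  also have "\<dots> = \<gamma> \<star> ((\<delta> z)\<degree> \<cdot> (\<eta> y)\<degree>)"
    using star_star[OF \<gamma> d(1) epi_component_in_Hom(1)[OF \<eta>y(1)]] .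
  also have "(\<delta> z)\<degree> \<cdot> (\<eta> y)\<degree> = ((\<delta> z)\<degree> \<cdot> \<eta> y)\<degree>"
    using epi_component_split_epi_Comp[OF d(2,1) \<eta>y(1)] by simp
  also have "(\<delta> z)\<degree> \<cdot> \<eta> y = \<delta> z \<cdot> \<eta> w"
    using Hom_assoc[OF d(1) j(2) \<eta>w] dj \<eta>y by simp
  also have "(\<delta> z \<cdot> \<eta> w)\<degree> = (\<delta> z \<cdot> (\<eta> w)\<degree>)\<degree>"
    using epi_component_Comp_epi_component[OF \<delta>z \<eta>w] by simp
  also have "\<delta> z \<cdot> (\<eta> w)\<degree> = (\<delta> \<odot> \<eta>) z"
    using mult_eq[OF \<delta>] star_apply[OF z] by simp
  also have "\<gamma> \<star> ((\<delta> \<odot> \<eta>) z)\<degree> = \<gamma> \<odot> (\<delta> \<odot> \<eta>)"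
    using mult_eq[OF \<gamma>] by simp
  finally show ?thesis .
qed

lemma cone_semigroup: "is_semigroup (cone_semigroup C)"
  unfolding is_semigroup_def
proof (intro conjI ballI)
  fix \<gamma> \<delta> \<eta>
  assume "\<gamma> \<in> cones" "\<delta> \<in> cones" "\<eta> \<in> cones"
  then obtain z w v where cones: "is_cone C z \<gamma>" "is_cone C w \<delta>" "is_cone C v \<eta>"
    unfolding cones_iff by auto
  show "\<gamma> \<odot> \<delta> \<in> cones"
    using cone_in_cones[OF mult_cone[OF cones(1,2)]] .
  show "(\<gamma> \<odot> \<delta>) \<odot> \<eta> = \<gamma> \<odot> (\<delta> \<odot> \<eta>)"
    using mult_assoc[OF cones] .
qed

text \<open>Idempotency means that composing with \<open>(\<gamma> c)\<degree>\<close> fixes every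
  component. Cancelling an isomorphic component leaves
  \<open>(\<gamma> c)\<degree> = Ide C c\<close>, so \<open>\<gamma> c\<close> is an inclusion of
  \<open>c\<close> in itself.\<close>

lemma idempotent_cone_iff:
  assumes \<gamma>: "is_cone C c \<gamma>"
  shows "\<gamma> \<in> idempotents (cone_semigroup C) \<longleftrightarrow> \<gamma> c = Ide C c"
proof
  have c: "c \<in> Obj C" using \<gamma> by (simp add: is_cone_def)
  note \<gamma>c = cone_Hom[OF \<gamma> c]
  {
    assume "\<gamma> \<in> idempotents (cone_semigroup C)"
    then have idem: "\<gamma> \<star> (\<gamma> c)\<degree> = \<gamma>"
      using mult_eq[OF \<gamma>] by (simp add: idempotents_def)
    obtain x where x: "x \<in> Obj C" "\<gamma> x \<in> Hom C x c" "isomorphism C (\<gamma> x)"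
      using cone_isoE[OF \<gamma>] .
    obtain g where g: "g \<in> Hom C c x" "g \<cdot> \<gamma> x = Ide C c"
      using isomorphismE[OF x(3,2)] by metis
    have "\<gamma> x \<cdot> (\<gamma> c)\<degree> = \<gamma> x"
      using idem star_apply[OF x(1)] by metis
    then have "(\<gamma> c)\<degree> = Ide C c"
      using Hom_assoc[OF g(1) x(2) epi_component_in_Hom(1)[OF \<gamma>c]] g(2)
        Hom_Ide_left[OF epi_component_in_Hom(1)[OF \<gamma>c]] by simp
    then show "\<gamma> c = Ide C c"
      using Incl_unique[OF Incl_if_epi_component_Ide[OF \<gamma>c] Ide_Incl[OF c] \<gamma>c Ide_in_Hom[OF c]]
      by simp
  }
  assume "\<gamma> c = Ide C c"
  then show "\<gamma> \<in> idempotents (cone_semigroup C)"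
    using mult_eq[OF \<gamma>, of \<gamma>] epi_component_Incl[OF Ide_Incl[OF c]] Dom_Ide[OF c]
      star_Ide[OF \<gamma>] \<gamma> by (auto simp: idempotents_def cones_iff)
qed

text \<open>This turns comparison of \<open>R\<close>-classes into an equation between components, a
  form that functors can transport.\<close>

lemma idempotent_cone_mem_ideal_iff:
  assumes \<epsilon>: "is_cone C c \<epsilon>" "\<epsilon> c = Ide C c" and \<gamma>: "is_cone C z \<gamma>"
  shows "\<gamma> \<in> principal_right_ideal (cone_semigroup C) \<epsilon> \<longleftrightarrow> \<gamma> = \<epsilon> \<star> (\<gamma> c)\<degree>"
  using mem_right_ideal_idempotent_iff[OF cone_semigroup cone_in_cones[OF \<gamma>]]
    idempotent_cone_iff[OF \<epsilon>(1)] \<epsilon>(2) mult_eq[OF \<epsilon>(1)] by metis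

text \<open>Justifies the definite description in \<open>idem_cone\<close>: within an
  \<open>R\<close>-class the vertex determines the idempotent cone.\<close>

lemma idempotent_cone_unique:
  assumes "is_cone C c \<gamma>" "\<gamma> c = Ide C c" "is_cone C c \<delta>" "\<delta> c = Ide C c"
    and "(\<gamma>, \<delta>) \<in> green_R (cone_semigroup C)"
  shows "\<gamma> = \<delta>"
proof -
  have "\<gamma> \<in> principal_right_ideal (cone_semigroup C) \<delta>"
    using green_R_iff[OF cone_semigroup cone_in_cones[OF assms(1)] cone_in_cones[OF assms(3)]]
      assms(5) by simp
  then have "\<gamma> = \<delta> \<star> (\<gamma> c)\<degree>"
    using idempotent_cone_mem_ideal_iff[OF assms(3,4,1)] by simp
  also have "(\<gamma> c)\<degree> = Ide C c"
    using epi_component_Incl[OF Ide_Incl] assms Dom_Ide by (simp add: is_cone_def)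
  finally show ?thesis
    using star_Ide assms by simp
qed

text \<open>Composing \<open>\<gamma>\<close> with the inverse \<open>g\<close> of an isomorphic
  component makes that component an identity.\<close>

lemma R_related_idempotent_cone:
  assumes \<gamma>: "is_cone C z \<gamma>"
  obtains c \<epsilon> where "c \<in> Obj C" "is_cone C c \<epsilon>" "\<epsilon> c = Ide C c"
    "(\<epsilon>, \<gamma>) \<in> green_R (cone_semigroup C)"
proof -
  obtain c where c: "c \<in> Obj C" "\<gamma> c \<in> Hom C c z" "isomorphism C (\<gamma> c)"
    using cone_isoE[OF \<gamma>] .
  obtain g where g: "g \<in> Hom C z c" "\<gamma> c \<cdot> g = Ide C c" "g \<cdot> \<gamma> c = Ide C z"
    using isomorphismE[OF c(3,2)] .
  have split: "split_epi g" "split_epi (\<gamma> c)"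
    using split_epiI[OF g(1) c(2) g(2)] split_epiI[OF c(2) g(1,3)] by simp_all
  define \<epsilon> where "\<epsilon> = \<gamma> \<star> g"
  have \<epsilon>: "is_cone C c \<epsilon>" "\<epsilon> c = Ide C c"
    using star_cone[OF \<gamma> split(1) g(1)] star_apply[OF c(1)] g by (simp_all add: \<epsilon>_def)
  have z: "z \<in> Obj C"
    using \<gamma> by (simp add: is_cone_def)
  \<comment> \<open>To reach \<open>\<gamma> \<star> g\<close> from \<open>\<gamma>\<close> by right
    multiplication, a cone with component \<open>g\<close> at \<open>z\<close> is needed. The axiom
    on identity components supplies \<open>\<mu>\<close>, and \<open>\<mu> \<star> g\<close> is such
    a cone.\<close>
  obtain \<mu> where \<mu>: "is_cone C z \<mu>" "\<mu> z = Ide C z"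
    using normal z by (auto simp: normal_category_def)
  have "\<gamma> = \<epsilon> \<star> (\<gamma> c)\<degree>"
    using star_star[OF \<gamma> g(1) c(2)] g star_Ide[OF \<gamma>] epi_component_split_epi[OF split(2)]
    by (simp add: \<epsilon>_def)
  then have "\<gamma> \<in> principal_right_ideal (cone_semigroup C) \<epsilon>"
    using idempotent_cone_mem_ideal_iff[OF \<epsilon> \<gamma>] by simp
  moreover have "\<epsilon> = \<gamma> \<odot> (\<mu> \<star> g)"
    using mult_eq[OF \<gamma>] star_apply[OF z] \<mu>(2) Hom_Ide_left[OF g(1)]
      epi_component_split_epi[OF split(1)] by (simp add: \<epsilon>_def)
  then have "\<epsilon> \<in> principal_right_ideal (cone_semigroup C) \<gamma>"
    using star_cone[OF \<mu>(1) split(1) g(1)] by (auto simp: principal_right_ideal_def cones_iff)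
  ultimately show ?thesis
    using that[OF c(1) \<epsilon>]
      green_R_iff[OF cone_semigroup cone_in_cones[OF \<epsilon>(1)] cone_in_cones[OF \<gamma>]] by simp
qed

end


section \<open>The category of a semigroup\<close>

text \<open>
  The category consists of the principal left ideals of the opposite semigroup, each represented by
  its unique idempotent generator; the triple \<open>(e, u, f)\<close> stands for right translation by \<open>u\<close>.
  Triples are encoded as elements of the universe.
\<close>

definition translation_triples :: "'u sgrp \<Rightarrow> ('u \<times> 'u \<times> 'u) set" where
  "translation_triples S = {(e, u, f). e \<in> idempotents S \<and> f \<in> idempotents S \<and> u \<in> Carrier S \<and>
     Mult S u e = u \<and> Mult S f u = u}"

text \<open>Inclusion of one left ideal in another is right translation by the generator of the
  smaller one, whence the entries \<open>(e, e, f)\<close>. The factors of \<open>Mult S\<close> are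
  swapped by the reversal, and the default \<open>undefined\<close> makes the record
  extensional.\<close>

definition ideal_category :: "('u \<times> 'u \<times> 'u \<Rightarrow> 'u) \<Rightarrow> 'u sgrp \<Rightarrow> ('u, 'u) subobject_category" where
  "ideal_category enc S =
     \<lparr>Obj = idempotents S,
      Arr = enc ` translation_triples S,
      Dom = (\<lambda>m\<in>enc ` translation_triples S. fst (inv enc m)),
      Cod = (\<lambda>m\<in>enc ` translation_triples S. snd (snd (inv enc m))),
      Ide = (\<lambda>e\<in>idempotents S. enc (e, e, e)),
      Comp = (\<lambda>m n. if m \<in> enc ` translation_triples S \<and> n \<in> enc ` translation_triples S \<and>
          snd (snd (inv enc m)) = fst (inv enc n)
        then enc (fst (inv enc m), Mult S (fst (snd (inv enc n))) (fst (snd (inv enc m))),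
          snd (snd (inv enc n)))
        else undefined),
      Incl = {enc (e, e, f) |e f. (e, e, f) \<in> translation_triples S}\<rparr>"

section \<open>Arithmetic with one idempotent in each \<open>L\<close>-class\<close>

locale r_unipotent =
  fixes enc :: "'u \<times> 'u \<times> 'u \<Rightarrow> 'u" and S :: "'u sgrp"
  assumes inj_enc: "inj enc" and r_unipotent: "R_unipotent S"
begin

abbreviation mul (infixl "\<otimes>" 70) where "x \<otimes> y \<equiv> Mult S y x"
abbreviation "A \<equiv> Carrier S"
abbreviation "E \<equiv> idempotents S"
abbreviation "C \<equiv> ideal_category enc S"
abbreviation "tri e u f \<equiv> (e, u, f) \<in> translation_triples S"

lemma S_semigroup: "is_semigroup S"
  using r_unipotent by (simp add: R_unipotent_def regular_semigroup_def)

lemma closed [simp]: "\<lbrakk>a \<in> A; b \<in> A\<rbrakk> \<Longrightarrow> a \<otimes> b \<in> A"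
  using S_semigroup by (simp add: is_semigroup_def)

lemma assoc: "\<lbrakk>a \<in> A; b \<in> A; c \<in> A\<rbrakk> \<Longrightarrow> (a \<otimes> b) \<otimes> c = a \<otimes> (b \<otimes> c)"
  using S_semigroup by (simp add: is_semigroup_def)

lemma E_A [simp]: "e \<in> E \<Longrightarrow> e \<in> A"
  by (simp add: idempotents_def)

lemma E_idem [simp]: "e \<in> E \<Longrightarrow> e \<otimes> e = e"
  unfolding idempotents_def by blast

lemma E_I: "\<lbrakk>e \<in> A; e \<otimes> e = e\<rbrakk> \<Longrightarrow> e \<in> E"
  unfolding idempotents_def by blast

lemma E_unique: "\<lbrakk>e \<in> E; f \<in> E; e \<otimes> f = e; f \<otimes> e = f\<rbrakk> \<Longrightarrow> e = f"
  using r_unipotent unfolding R_unipotent_iff by blast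

text \<open>Lifts an equation between products to right-nested products, so that it can be used as a
  rewrite rule beside associativity.\<close>

lemma extend: "\<lbrakk>a \<otimes> b = c; a \<in> A; b \<in> A; z \<in> A\<rbrakk> \<Longrightarrow> a \<otimes> (b \<otimes> z) = c \<otimes> z"
  using assoc[of a b z] by simp

lemma inverseE:
  assumes "a \<in> A"
  obtains x where "x \<in> A" "a \<otimes> x \<in> E" "x \<otimes> a \<in> E" "a \<otimes> x \<otimes> a = a" "x \<otimes> a \<otimes> x = x"
proof -
  obtain y where y: "y \<in> A" "a \<otimes> (y \<otimes> a) = a"
    using r_unipotent assms by (auto simp: R_unipotent_def regular_semigroup_def)
  have yz: "a \<otimes> (y \<otimes> (a \<otimes> z)) = a \<otimes> z" if "z \<in> A" for z
    using that y(1) assms extend[OF y(2)] by (simp add: assoc)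
  \<comment> \<open>The standard passage from \<open>aya = a\<close> to an inverse, for which
    \<open>xax = x\<close> holds as well.\<close>
  define x where "x = y \<otimes> a \<otimes> y"
  have x: "x \<in> A" "a \<otimes> x \<otimes> a = a" "x \<otimes> a \<otimes> x = x"
    using y(2) yz y(1) assms by (simp_all add: x_def assoc)
  then have "a \<otimes> x \<in> E" "x \<otimes> a \<in> E"
    using assms extend[of a "a \<otimes> x"] extend[of x "x \<otimes> a"] by (auto intro!: E_I simp: assoc)
  with x that show ?thesis by blast
qed

text \<open>The unique idempotent in the \<open>L\<close>-class of \<open>a\<close>, that is, the
  idempotent generator of the left ideal of \<open>a\<close>. It is the object that serves as vertex
  of the cone of \<open>a\<close>.\<close>

definition lam :: "'u \<Rightarrow> 'u" where
  "lam a = (THE f. f \<in> E \<and> a \<otimes> f = a \<and> (\<exists>x\<in>A. f = x \<otimes> a))"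

lemma lam_eq:
  assumes "a \<in> A" "f \<in> E" "a \<otimes> f = a" "x \<in> A" "f = x \<otimes> a"
  shows "lam a = f"
  unfolding lam_def
proof (rule the_equality)
  fix g assume "g \<in> E \<and> a \<otimes> g = a \<and> (\<exists>x\<in>A. g = x \<otimes> a)"
  then obtain y where g: "g \<in> E" "a \<otimes> g = a" "y \<in> A" "g = y \<otimes> a"
    by blast
  have "g \<otimes> f = g" "f \<otimes> g = f"
    using g assms assoc[of y a f] assoc[of x a g] by simp_all
  then show "g = f"
    using E_unique[OF g(1) assms(2)] by simp
qed (use assms in blast)

lemma lam:
  assumes "a \<in> A"
  shows "lam a \<in> E" "a \<otimes> lam a = a" "\<exists>x\<in>A. lam a = x \<otimes> a"
proof -
  obtain x where x: "x \<in> A" "x \<otimes> a \<in> E" "a \<otimes> x \<otimes> a = a"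
    using inverseE[OF assms] by metis
  have "lam a = x \<otimes> a"
    using lam_eq[OF assms x(2)] x assms by (simp add: assoc)
  then show "lam a \<in> E" "a \<otimes> lam a = a" "\<exists>x\<in>A. lam a = x \<otimes> a"
    using x assms by (auto simp: assoc)
qed

lemma lam_E: "e \<in> E \<Longrightarrow> lam e = e"
  using lam_eq[of e e e] by simp

text \<open>Writing \<open>lam a = x \<otimes> a\<close> gives
  \<open>x \<otimes> (a \<otimes> u) = u\<close>, so \<open>a \<otimes> u\<close> and
  \<open>u\<close> generate the same left ideal.\<close>

lemma lam_mult:
  assumes "a \<in> A" "u \<in> A" "lam a \<otimes> u = u"
  shows "lam (a \<otimes> u) = lam u"
proof -
  obtain x y where x: "x \<in> A" "lam a = x \<otimes> a" and y: "y \<in> A" "lam u = y \<otimes> u"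
    using lam(3) assms by blast
  have "x \<otimes> (a \<otimes> u) = u"
    using assms x assoc[of x a u] by simp
  then have *: "lam u = (y \<otimes> x) \<otimes> (a \<otimes> u)"
    using assms(1,2) x(1) y by (simp add: assoc)
  have "(a \<otimes> u) \<otimes> lam u = a \<otimes> u"
    using assms(1,2) lam(1,2)[OF assms(2)] by (simp add: assoc)
  then show ?thesis
    using lam_eq[OF _ lam(1)[OF assms(2)] _ _ *] assms(1,2) x(1) y(1) by simp
qed

lemma lam_right:
  assumes "a \<in> A" "f \<in> A" "a \<otimes> f = a"
  shows "lam a \<otimes> f = lam a"
proof -
  obtain x where "x \<in> A" "lam a = x \<otimes> a"
    using lam(3) assms by blast
  then show ?thesis
    using assms by (simp add: assoc)
qed

section \<open>The ideal category is a normal category\<close>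

lemma tri_iff: "tri e u f \<longleftrightarrow> e \<in> E \<and> f \<in> E \<and> u \<in> A \<and> e \<otimes> u = u \<and> u \<otimes> f = u"
  by (simp add: translation_triples_def)

lemma enc_eq [simp]: "enc x = enc y \<longleftrightarrow> x = y"
  using inj_enc by (simp add: inj_eq)

lemma inv_enc [simp]: "inv enc (enc x) = x"
  using inj_enc by simp

lemma enc_mem [simp]: "enc x \<in> enc ` X \<longleftrightarrow> x \<in> X"
  by auto

lemma Obj_C [simp]: "Obj C = E"
  by (simp add: ideal_category_def)

lemma Arr_C: "Arr C = enc ` translation_triples S"
  by (simp add: ideal_category_def)

lemma Incl_C: "Incl C = {enc (e, e, f) |e f. tri e e f}"
  by (simp add: ideal_category_def)

lemma Dom_C [simp]: "tri e u f \<Longrightarrow> Dom C (enc (e, u, f)) = e"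
  by (simp add: ideal_category_def)

lemma Cod_C [simp]: "tri e u f \<Longrightarrow> Cod C (enc (e, u, f)) = f"
  by (simp add: ideal_category_def)

lemma Ide_C [simp]: "e \<in> E \<Longrightarrow> Ide C e = enc (e, e, e)"
  by (simp add: ideal_category_def)

lemma Comp_C [simp]: "\<lbrakk>tri e u f; tri f v g\<rbrakk>
    \<Longrightarrow> Comp C (enc (e, u, f)) (enc (f, v, g)) = enc (e, u \<otimes> v, g)"
  by (simp add: ideal_category_def)

lemma ArrE:
  assumes "m \<in> Arr C"
  obtains e u f where "m = enc (e, u, f)" "tri e u f"
  using assms by (auto simp: Arr_C)

lemma Hom_C: "m \<in> Hom C e f \<longleftrightarrow> (\<exists>u. m = enc (e, u, f) \<and> tri e u f)"
  by (auto simp: Hom_def Arr_C)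

lemma enc_Hom [simp]: "enc (e, u, f) \<in> Hom C e' f' \<longleftrightarrow> e = e' \<and> f = f' \<and> tri e u f"
  by (auto simp: Hom_C)

lemma tri_Comp: "\<lbrakk>tri e u f; tri f v g\<rbrakk> \<Longrightarrow> tri e (u \<otimes> v) g"
  using extend[of u e u v] by (auto simp: tri_iff assoc)

lemma category_C: "category C"
proof
  fix m assume "m \<in> Arr C"
  then obtain e u f where m: "m = enc (e, u, f)" "tri e u f"
    by (rule ArrE)
  then show "Dom C m \<in> Obj C" "Cod C m \<in> Obj C" "Comp C (Ide C (Dom C m)) m = m"
      "Comp C m (Ide C (Cod C m)) = m"
    by (auto simp: tri_iff)
next
  fix e assume "e \<in> Obj C"
  then show "Ide C e \<in> Arr C" "Dom C (Ide C e) = e" "Cod C (Ide C e) = e"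
    by (auto simp: Arr_C tri_iff)
next
  fix m n assume "m \<in> Arr C" "n \<in> Arr C" and eq: "Cod C m = Dom C n"
  then obtain e u f g v h where m: "m = enc (e, u, f)" "tri e u f" and n: "n = enc (g, v, h)" "tri g v h"
    by (metis ArrE)
  then have "g = f" using eq by simp
  then show "Comp C m n \<in> Arr C" "Dom C (Comp C m n) = Dom C m" "Cod C (Comp C m n) = Cod C n"
    using m n tri_Comp[of e u f v h] by (simp_all add: Arr_C)
  fix p assume "p \<in> Arr C" and eq: "Cod C n = Dom C p"
  then obtain k w l where p: "p = enc (k, w, l)" "tri k w l"
    by (metis ArrE)
  then have "k = h" using eq n by simp
  then show "Comp C (Comp C m n) p = Comp C m (Comp C n p)"
    using m n p \<open>g = f\<close> tri_Comp[of e u f v h] tri_Comp[of f v h w l] by (simp add: tri_iff assoc)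
qed

lemma extensional_C: "extensional_category C"
  by (auto simp: extensional_category_def ideal_category_def extensional_def)

text \<open>Strictness is where unipotency enters: mutually included objects are
  \<open>L\<close>-related idempotents and hence equal. Inclusions are monomorphisms because
  composing with one leaves the middle entry unchanged.\<close>

lemma with_subobjects_C: "category_with_subobjects C"
proof -
  interpret category C by (fact category_C)
  let ?P = "inclusion_category C"
  have P: "Obj ?P = E" "Arr ?P = Incl C" "Dom ?P = Dom C" "Cod ?P = Cod C" "Ide ?P = Ide C"
      "Comp ?P = Comp C"
    by (simp_all add: inclusion_category_def)
  have Incl_Arr: "Incl C \<subseteq> Arr C"
    by (auto simp: Incl_C Arr_C)
  have cat_P: "category ?P"
  proof (unfold_locales, unfold P)
    fix f g assume fg: "f \<in> Incl C" "g \<in> Incl C" "Cod C f = Dom C g"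
    then obtain a b c where f: "f = enc (a, a, b)" "tri a a b" and g: "g = enc (b, b, c)" "tri b b c"
      by (auto simp: Incl_C)
    then have "a \<otimes> b = a" "Comp C f g = enc (a, a, c)" "tri a a c"
      using tri_Comp[of a a b b c] by (simp_all add: tri_iff)
    then show "Comp C f g \<in> Incl C"
      by (auto simp: Incl_C)
  qed (use Incl_Arr Dom_closed Cod_closed Dom_Comp Cod_Comp Comp_assoc Ide_Comp Comp_Ide in
    \<open>auto simp: subset_iff Incl_C tri_iff\<close>)
  have strict: "strict_preorder ?P"
    unfolding strict_preorder_def
  proof (intro conjI ballI allI impI cat_P)
    fix a b f g assume "f \<in> Hom ?P a b" "g \<in> Hom ?P a b"
    then show "f = g"
      by (auto simp: Hom_def P Incl_C)
  next
    fix f assume "isomorphism ?P f"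
    then obtain g where "f \<in> Incl C" "g \<in> Incl C" "Dom C g = Cod C f" "Cod C g = Dom C f"
      by (auto simp: isomorphism_def Hom_def P)
    then obtain a b where "f = enc (a, a, b)" "tri a a b" "tri b b a"
      by (auto simp: Incl_C)
    moreover from this have "a = b"
      using E_unique[of a b] by (simp add: tri_iff)
    ultimately show "\<exists>a\<in>Obj ?P. f = Ide ?P a"
      by (auto simp: P tri_iff)
  qed
  have mono: "monomorphism C j" if "j \<in> Incl C" for j
  proof -
    obtain a b where j: "j = enc (a, a, b)" "tri a a b"
      using \<open>j \<in> Incl C\<close> by (auto simp: Incl_C)
    have "m = n" if "m \<in> Hom C c a" "n \<in> Hom C d a" "Comp C m j = Comp C n j" for m n c d
      using that j by (auto simp: Hom_C tri_iff)
    then show ?thesis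
      using \<open>j \<in> Incl C\<close> Incl_Arr j by (auto simp: monomorphism_def Hom_def)
  qed
  have "h \<in> Incl C" if prems: "f \<in> Incl C" "g \<in> Incl C" "h \<in> Arr C" "Cod C h = Dom C g" "f = Comp C h g"
    for f g h
  proof -
    obtain e u f' where h: "h = enc (e, u, f')" "tri e u f'"
      using \<open>h \<in> Arr C\<close> by (rule ArrE)
    moreover obtain c where "g = enc (f', f', c)" "tri f' f' c"
      using prems h by (auto simp: Incl_C)
    ultimately have "f = enc (e, u, c)"
      using prems by (simp add: tri_iff)
    then have "e = u"
      using prems by (auto simp: Incl_C)
    then show ?thesis
      using h by (auto simp: Incl_C)
  qed
  then show ?thesis
    unfolding category_with_subobjects_def using category_C Incl_Arr strict mono by blast
qed

section \<open>The regular representation by principal cones\<close>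

definition rho :: "'u \<Rightarrow> 'u \<Rightarrow> 'u" where
  "rho a = (\<lambda>c\<in>E. enc (c, c \<otimes> a, lam a))"

lemma tri_rho: "\<lbrakk>a \<in> A; c \<in> E\<rbrakk> \<Longrightarrow> tri c (c \<otimes> a) (lam a)"
  using lam[of a] extend[of c c c a] by (simp add: tri_iff assoc)

lemma iso_C:
  assumes "tri e u f" "tri f v e" "u \<otimes> v = e" "v \<otimes> u = f"
  shows "isomorphism C (enc (e, u, f))"
  using category.isomorphismI[OF category_C, of "enc (e, u, f)" e f "enc (f, v, e)"] assms
  by (simp add: tri_iff)

text \<open>For an inverse \<open>x\<close> of \<open>a\<close>, the component at
  \<open>a \<otimes> x\<close> is translation by \<open>a\<close> onto the ideal of
  \<open>x \<otimes> a = lam a\<close>; translation by \<open>x\<close> inverts it.\<close>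

lemma rho_cone:
  assumes a: "a \<in> A"
  shows "is_cone C (lam a) (rho a)"
proof -
  obtain x where x: "x \<in> A" "a \<otimes> x \<in> E" "x \<otimes> a \<in> E" "a \<otimes> x \<otimes> a = a" "x \<otimes> a \<otimes> x = x"
    using inverseE[OF a] .
  have lam_a: "lam a = x \<otimes> a"
    using lam_eq[OF a x(3)] x a by (simp add: assoc)
  have "isomorphism C (enc (a \<otimes> x, a, lam a))"
    using x a lam_a by (intro iso_C[where v = x]) (simp_all add: tri_iff assoc)
  then have iso: "isomorphism C (rho a (a \<otimes> x))"
    using x by (simp add: rho_def)
  have nat: "Comp C (the_inclusion C c d) (rho a d) = rho a c"
    if "c \<in> E" "d \<in> E" "subobject C c d" for c d
  proof -
    have c: "tri c c d" and j: "inclusions C c d = {enc (c, c, d)}"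
      using that by (auto simp: subobject_def inclusions_def Incl_C Hom_C)
    have "Comp C (enc (c, c, d)) (enc (d, d \<otimes> a, lam a)) = enc (c, c \<otimes> (d \<otimes> a), lam a)"
      using c tri_rho[OF a \<open>d \<in> E\<close>] by simp
    also have "c \<otimes> (d \<otimes> a) = c \<otimes> a"
      using c a extend[of d c c a] by (simp add: tri_iff)
    finally show ?thesis
      using that by (simp add: the_inclusion_def j rho_def)
  qed
  moreover have "rho a \<in> (\<Pi>\<^sub>E c\<in>E. Hom C c (lam a))"
    using tri_rho[OF a] by (auto simp: rho_def)
  ultimately show ?thesis
    using iso x(2) lam(1)[OF a] by (auto simp: is_cone_def)
qed

lemma normal_C: "normal_category C"
  unfolding normal_category_def
proof (intro conjI ballI with_subobjects_C)
  fix j assume "j \<in> Incl C"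
  then obtain e f where j: "j = enc (e, e, f)" "tri e e f"
    by (auto simp: Incl_C)
  \<comment> \<open>As \<open>e \<otimes> f = e\<close>, translation by \<open>f \<otimes> e\<close>
    fixes \<open>e\<close> and retracts the larger ideal onto the smaller.\<close>
  then have "tri f (f \<otimes> e) e" "e \<otimes> (f \<otimes> e) = e"
    using extend[of f f f e] extend[of f e e e] by (auto simp: tri_iff assoc)
  then have "splits_by C j (enc (f, f \<otimes> e, e))"
    using j by (auto simp: splits_by_def Incl_C tri_iff)
  then show "\<exists>q. splits_by C j q" ..
next
  fix m assume "m \<in> Arr C"
  then obtain e u f where m: "m = enc (e, u, f)" "tri e u f"
    by (rule ArrE)
  then have u: "u \<in> A" and e: "e \<in> E" and f: "f \<in> E" and eu: "e \<otimes> u = u" and uf: "u \<otimes> f = u"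
    by (simp_all add: tri_iff)
  obtain x where x: "x \<in> A" "u \<otimes> x \<in> E" "x \<otimes> u \<in> E" "u \<otimes> x \<otimes> u = u" "x \<otimes> u \<otimes> x = x"
    using inverseE[OF u] .
  have uxu: "u \<otimes> (x \<otimes> u) = u" and xux: "x \<otimes> (u \<otimes> x) = x"
    using x u by (simp_all add: assoc)
  have uxuz: "u \<otimes> (x \<otimes> (u \<otimes> z)) = u \<otimes> z" and xuxz: "x \<otimes> (u \<otimes> (x \<otimes> z)) = x \<otimes> z"
    if "z \<in> A" for z
    using that u x(1) extend[OF uxu] extend[OF xux] by (simp_all add: assoc)
  note rules = eu uf uxu xux extend[OF eu] extend[OF uf] uxuz xuxz
    extend[OF E_idem[OF e]] assoc
  \<comment> \<open>Here \<open>k\<close> generates the image of translation by \<open>u\<close>.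
    The factor \<open>e\<close> in \<open>g\<close> pushes the idempotent
    \<open>u \<otimes> x\<close> below \<open>e\<close>, so that \<open>g\<close> is a retract of
    \<open>e\<close>; \<open>v\<close> is the inverse of \<open>u\<close> adapted to
    \<open>g\<close> and \<open>k\<close>.\<close>
  define g k v where "g = u \<otimes> (x \<otimes> e)" and "k = x \<otimes> u" and "v = x \<otimes> e"
  have A: "g \<in> A" "k \<in> A" "v \<in> A" "e \<in> A" "f \<in> A"
    using u x e f by (simp_all add: g_def k_def v_def)
  note A' = A[unfolded g_def k_def v_def] u x(1) e f
  have k: "k \<in> E"
    using x by (simp add: k_def)
  have g: "g \<in> E"
    using A' by (intro E_I) (simp_all add: g_def rules)
  have tris: "tri g g e" "tri e g g" "tri g u k" "tri k v g" "tri k k f"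
    using g k e f A' by (simp_all add: tri_iff, simp_all add: g_def k_def v_def rules)
  have uv: "u \<otimes> v = g" "v \<otimes> u = k"
    using A' by (simp_all add: g_def k_def v_def rules)
  have "splits_by C (enc (g, g, e)) (enc (e, g, g))"
    using tris g by (auto simp: splits_by_def Incl_C)
  then have "retraction C (enc (e, g, g))"
    by (auto simp: retraction_def)
  moreover have "isomorphism C (enc (g, u, k))"
    using iso_C[OF tris(3,4) uv] .
  moreover have "m = Comp C (Comp C (enc (e, g, g)) (enc (g, u, k))) (enc (k, k, f))"
    using tris tri_Comp[OF tris(2,3)] m by (simp add: tri_iff assoc)
  ultimately have "normal_factorisation C m (enc (e, g, g)) (enc (g, u, k)) (enc (k, k, f))"
    using tris by (auto simp: normal_factorisation_def Incl_C)
  then show "\<exists>q u j. normal_factorisation C m q u j"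
    by blast
next
  fix c assume "c \<in> Obj C"
  then show "\<exists>\<mu>. is_cone C c \<mu> \<and> \<mu> c = Ide C c"
    using rho_cone[of c] lam_E[of c] by (auto simp: rho_def intro!: exI[of _ "rho c"])
qed

sublocale C: normal_cat C
  by (unfold_locales) (fact normal_C)

abbreviation "Cones \<equiv> cone_semigroup C"
abbreviation "rcls a \<equiv> green_R Cones `` {rho a}"

text \<open>The image of translation by \<open>u\<close> is the ideal generated by
  \<open>lam u\<close>, so taking the epimorphic component changes only the codomain. If
  \<open>lam u = x \<otimes> u\<close>, a section has middle entry
  \<open>lam u \<otimes> (x \<otimes> e)\<close>.\<close>

lemma epi_component_enc:
  assumes "tri e u f"
  shows "epi_component C (enc (e, u, f)) = enc (e, u, lam u)" "tri e u (lam u)"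
proof -
  have u: "u \<in> A" and e: "e \<in> E" and f: "f \<in> E" and eu: "e \<otimes> u = u" and uf: "u \<otimes> f = u"
    using assms by (simp_all add: tri_iff)
  note lu = lam[OF u]
  obtain x where x: "x \<in> A" "lam u = x \<otimes> u"
    using lu(3) by blast
  have j: "tri (lam u) (lam u) f"
    using lu f lam_right[OF u _ uf] by (simp add: tri_iff)
  show t: "tri e u (lam u)"
    using u e eu lu by (simp add: tri_iff)
  have s: "tri (lam u) (lam u \<otimes> (x \<otimes> e)) e"
    using lu(1) x(1) e extend[OF E_idem[OF lu(1)]] by (simp add: tri_iff assoc)
  have "lam u \<otimes> (x \<otimes> e) \<otimes> u = lam u"
    using lu(1) x(1) e u eu by (simp add: assoc x(2)[symmetric])
  then have "C.split_epi (enc (e, u, lam u))"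
    using C.split_epiI[of "enc (e, u, lam u)" e "lam u" "enc (lam u, lam u \<otimes> (x \<otimes> e), e)"] t s lu(1)
    by simp
  then show "epi_component C (enc (e, u, f)) = enc (e, u, lam u)"
    using C.epi_component_eq[of "enc (e, u, lam u)" e "lam u" "enc (lam u, lam u, f)" f] t j u lu
    by (auto simp: Incl_C)
qed

text \<open>Only the component of \<open>\<delta>\<close> at the vertex \<open>lam a\<close> enters
  the product, and that component is a translation by some element. So principal cones absorb
  arbitrary cones on the right, which later yields the down-set.\<close>

lemma rho_mult_cone:
  assumes a: "a \<in> A" and \<delta>: "is_cone C z \<delta>" and u: "\<delta> (lam a) = enc (lam a, u, z)"
  shows "Mult Cones (rho a) \<delta> = rho (a \<otimes> u)" "u \<in> A"
proof -
  have t: "tri (lam a) u z"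
    using C.cone_Hom[OF \<delta>, of "lam a"] lam(1)[OF a] u by simp
  then show uA: "u \<in> A"
    by (simp add: tri_iff)
  have "lam (a \<otimes> u) = lam u"
    using lam_mult[OF a uA] t by (simp add: tri_iff)
  then have "cone_star C (rho a) (enc (lam a, u, lam u)) = rho (a \<otimes> u)"
    using tri_rho[OF a] epi_component_enc(2)[OF t] a uA
    by (auto simp: cone_star_def rho_def fun_eq_iff assoc)
  then show "Mult Cones (rho a) \<delta> = rho (a \<otimes> u)"
    using C.mult_eq[OF rho_cone[OF a]] epi_component_enc(1)[OF t] u by simp
qed

lemma rho_mult:
  assumes a: "a \<in> A" and b: "b \<in> A"
  shows "Mult Cones (rho a) (rho b) = rho (a \<otimes> b)"
proof -
  have "a \<otimes> (lam a \<otimes> b) = a \<otimes> b"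
    using a b extend[OF lam(2)[OF a]] lam(1)[OF a] by simp
  then show ?thesis
    using rho_mult_cone(1)[OF a rho_cone[OF b], of "lam a \<otimes> b"] lam(1)[OF a] by (simp add: rho_def)
qed

text \<open>The use of unipotency behind faithfulness. From \<open>x \<otimes> b = lam b\<close> it
  follows that \<open>b \<otimes> x\<close> is idempotent; it is \<open>L\<close>-related to
  \<open>a \<otimes> x\<close>, so the two are equal. Any \<open>f\<close> fixing \<open>b\<close>
  on the left then fixes \<open>a \<otimes> x\<close>.\<close>

lemma rho_eq_imp_below:
  assumes a: "a \<in> A" and b: "b \<in> A" and eq: "\<And>c. c \<in> E \<Longrightarrow> c \<otimes> a = c \<otimes> b" and lam_eq': "lam a = lam b"
    and x: "x \<in> A" "a \<otimes> x \<in> E" "x \<otimes> a \<in> E" "a \<otimes> x \<otimes> a = a" "x \<otimes> a \<otimes> x = x"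
    and f: "f \<in> E" "f \<otimes> b = b"
  shows "f \<otimes> (a \<otimes> x) = a \<otimes> x"
proof -
  define e where "e = a \<otimes> x"
  have e: "e \<in> E" "e \<otimes> b = a" "x \<otimes> e = x"
    using x a b eq[OF x(2)] by (simp_all add: e_def assoc)
  have "x \<otimes> b = lam b"
  proof -
    have "x \<otimes> b = x \<otimes> a"
      using e x(1) b extend[OF e(3), of b] by simp
    also have "\<dots> = lam a"
      using lam_eq[OF a x(3)] x a by (simp add: assoc)
    finally show ?thesis using lam_eq' by simp
  qed
  then have bxb: "b \<otimes> (x \<otimes> b) = b"
    using lam(2)[OF b] by simp
  have h: "b \<otimes> x \<in> E"
    using b x extend[OF bxb, of x] by (intro E_I) (simp_all add: assoc)
  have "(b \<otimes> x) \<otimes> e = b \<otimes> x"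
    using e(1,3) b x(1) by (simp add: assoc)
  moreover have "e \<otimes> (b \<otimes> x) = e"
    using extend[OF e(2) E_A[OF e(1)] b x(1)] by (simp add: e_def)
  ultimately have "b \<otimes> x = a \<otimes> x"
    using E_unique[OF h e(1)] by (simp add: e_def)
  then show ?thesis
    using extend[OF f(2) E_A[OF f(1)] b x(1)] by simp
qed

text \<open>The previous lemma with the roles of \<open>a\<close> and \<open>b\<close> exchanged
  shows that \<open>a \<otimes> x\<close>, which fixes \<open>a\<close>, also fixes
  \<open>b \<otimes> y\<close> and therefore \<open>b\<close>. But equal cones force
  \<open>a \<otimes> x\<close> to send \<open>b\<close> to the same element as
  \<open>a\<close>.\<close>

lemma rho_inj:
  assumes a: "a \<in> A" and b: "b \<in> A" and eq: "rho a = rho b"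
  shows "a = b"
proof -
  have ca: "c \<otimes> a = c \<otimes> b" and lam_eq': "lam a = lam b" if "c \<in> E" for c
    using fun_cong[OF eq, of c] that by (simp_all add: rho_def)
  have l: "lam a = lam b"
    using lam_eq' lam(1)[OF a] by blast
  obtain x where x: "x \<in> A" "a \<otimes> x \<in> E" "x \<otimes> a \<in> E" "a \<otimes> x \<otimes> a = a" "x \<otimes> a \<otimes> x = x"
    using inverseE[OF a] .
  obtain y where y: "y \<in> A" "b \<otimes> y \<in> E" "y \<otimes> b \<in> E" "b \<otimes> y \<otimes> b = b" "y \<otimes> b \<otimes> y = y"
    using inverseE[OF b] .
  have "(a \<otimes> x) \<otimes> (b \<otimes> y) = b \<otimes> y"
    using rho_eq_imp_below[OF b a ca[symmetric] l[symmetric] y x(2,4)] .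
  then have "b = (a \<otimes> x) \<otimes> (b \<otimes> y) \<otimes> b"
    using y(4) by simp
  also have "\<dots> = (a \<otimes> x) \<otimes> (b \<otimes> y \<otimes> b)"
    using assoc[of "a \<otimes> x" "b \<otimes> y" b] a b x(1) y(1) by simp
  also have "\<dots> = (a \<otimes> x) \<otimes> a"
    using y(4) ca[OF x(2)] by simp
  finally show ?thesis
    using x(4) by simp
qed

lemma rho_eq_iff: "\<lbrakk>a \<in> A; b \<in> A\<rbrakk> \<Longrightarrow> rho a = rho b \<longleftrightarrow> a = b"
  using rho_inj by blast

text \<open>Since right multiples of a principal cone are principal, the \<open>R\<close>-order
  among principal cones is exactly the \<open>R\<close>-order of the reversed semigroup.\<close>

lemma rho_ideal:
  assumes a: "a \<in> A"
  shows "principal_right_ideal Cones (rho a) = rho ` insert a {a \<otimes> s |s. s \<in> A}"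
proof (intro equalityI subsetI)
  fix \<gamma> assume "\<gamma> \<in> principal_right_ideal Cones (rho a)"
  then consider "\<gamma> = rho a" | \<delta> where "\<delta> \<in> Carrier Cones" "\<gamma> = Mult Cones (rho a) \<delta>"
    by (auto simp: principal_right_ideal_def)
  then show "\<gamma> \<in> rho ` insert a {a \<otimes> s |s. s \<in> A}"
  proof cases
    case 2
    then obtain z where \<delta>: "is_cone C z \<delta>"
      by (auto simp: C.cones_iff)
    then obtain u where u: "\<delta> (lam a) = enc (lam a, u, z)"
      using C.cone_Hom[OF \<delta>, of "lam a"] lam(1)[OF a] by (auto simp: Hom_C)
    then show ?thesis
      using rho_mult_cone[OF a \<delta> u] 2 by auto
  qed simp
next
  fix \<gamma> assume "\<gamma> \<in> rho ` insert a {a \<otimes> s |s. s \<in> A}"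
  then consider "\<gamma> = rho a" | s where "s \<in> A" "\<gamma> = Mult Cones (rho a) (rho s)"
    using rho_mult[OF a] by auto
  then show "\<gamma> \<in> principal_right_ideal Cones (rho a)"
    using C.cone_in_cones[OF rho_cone] by cases (auto simp: principal_right_ideal_def)
qed

lemma rho_mem_ideal_iff:
  assumes "a \<in> A" "b \<in> A"
  shows "rho b \<in> principal_right_ideal Cones (rho a) \<longleftrightarrow> b = a \<or> (\<exists>s\<in>A. b = a \<otimes> s)"
  using assms rho_eq_iff by (auto simp: rho_ideal)

lemma rho_in_Cones: "a \<in> A \<Longrightarrow> rho a \<in> Carrier Cones"
  using C.cone_in_cones[OF rho_cone] .

lemma rho_idempotent_iff: "a \<in> A \<Longrightarrow> rho a \<in> idempotents Cones \<longleftrightarrow> a \<in> E"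
  using rho_in_Cones rho_mult rho_eq_iff by (auto simp: idempotents_def[of Cones] intro: E_I)

lemma rclsE:
  assumes "a \<in> A" "\<gamma> \<in> rcls a"
  obtains b where "b \<in> A" "\<gamma> = rho b" "rcls b = rcls a"
proof -
  have R: "(rho a, \<gamma>) \<in> green_R Cones"
    using assms by simp
  then have "\<gamma> \<in> principal_right_ideal Cones (rho a)"
    by (auto simp: green_R_def principal_right_ideal_def)
  then obtain b where "b \<in> insert a {a \<otimes> s |s. s \<in> A}" "\<gamma> = rho b"
    using rho_ideal[OF assms(1)] by blast
  moreover from this have "b \<in> A"
    using assms(1) by auto
  ultimately show ?thesis
    using that equiv_class_eq[OF equiv_green_R R] by simp
qed

lemma rho_in_rcls: "a \<in> A \<Longrightarrow> rho a \<in> rcls a"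
  using rho_in_Cones by (simp add: green_R_def)

lemma rcls_eq_iff:
  assumes "a \<in> A" "b \<in> A"
  shows "rcls a = rcls b \<longleftrightarrow> (rho a, rho b) \<in> green_R Cones"
  using eq_equiv_class_iff[OF equiv_green_R rho_in_Cones[OF assms(1)] rho_in_Cones[OF assms(2)]] .

lemma rcls_below_iff:
  assumes "a \<in> A" "b \<in> A"
  shows "class_below C (rcls a) (rcls b) \<longleftrightarrow> a = b \<or> (\<exists>s\<in>A. a = b \<otimes> s)"
  using R_below_classes_iff[OF C.cone_semigroup rho_in_Cones[OF assms(1)] rho_in_Cones[OF assms(2)]]
    rho_mem_ideal_iff[OF assms(2,1)] by simp

lemma rcls_eqE:
  assumes a: "a \<in> A"
  obtains e where "e \<in> E" "rcls e = rcls a" "e \<otimes> a = a" "\<exists>x\<in>A. e = a \<otimes> x"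
proof -
  obtain x where x: "x \<in> A" "a \<otimes> x \<in> E" "a \<otimes> x \<otimes> a = a"
    using inverseE[OF a] by metis
  have "rho (a \<otimes> x) \<in> principal_right_ideal Cones (rho a)"
    using rho_mem_ideal_iff[OF a E_A[OF x(2)]] x(1) by blast
  moreover have "rho a \<in> principal_right_ideal Cones (rho (a \<otimes> x))"
    using rho_mem_ideal_iff[OF E_A[OF x(2)] a] x(3)[symmetric] a by blast
  ultimately have "(rho (a \<otimes> x), rho a) \<in> green_R Cones"
    using green_R_iff[OF C.cone_semigroup rho_in_Cones[OF E_A[OF x(2)]] rho_in_Cones[OF a]] by simp
  then show ?thesis
    using that[OF x(2)] rcls_eq_iff[OF E_A[OF x(2)] a] x by auto
qed

section \<open>The classes of principal cones and the supported category they define\<close>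

definition classes :: "('u \<Rightarrow> 'u) set set" where
  "classes = rcls ` A"

lemma classes_eq: "classes = rcls ` E"
proof -
  have "rcls a \<in> rcls ` E" if a: "a \<in> A" for a
  proof -
    obtain e where "e \<in> E" "rcls e = rcls a"
      by (rule rcls_eqE[OF a])
    then show ?thesis
      using imageI[of e E rcls] by simp
  qed
  moreover have "rcls ` E \<subseteq> rcls ` A"
    by (intro image_mono subsetI) simp
  ultimately show ?thesis
    unfolding classes_def by blast
qed

text \<open>Every idempotent cone in such a class is \<open>rho b\<close> for an idempotent
  \<open>b\<close>, and its vertex is \<open>b\<close> itself. So the object determines the cone and
  thereby the class: this is the support condition.\<close>

lemma connected_by_rcls:
  assumes a: "a \<in> A" and c: "c \<in> E"
  shows "connected_by C c (rcls a) \<longleftrightarrow> rcls a = rcls c"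
proof
  assume "connected_by C c (rcls a)"
  then obtain \<gamma> where \<gamma>: "\<gamma> \<in> rcls a" "\<gamma> \<in> idempotents Cones" "is_cone C c \<gamma>"
    by (auto simp: connected_by_def)
  obtain b where b: "b \<in> A" "\<gamma> = rho b" "rcls b = rcls a"
    using rclsE[OF a \<gamma>(1)] .
  have "b \<in> E"
    using rho_idempotent_iff \<gamma> b by simp
  then have "b = c"
    using C.cone_vertex_unique[OF rho_cone[OF b(1)]] \<gamma> b lam_E by simp
  then show "rcls a = rcls c"
    using b by simp
next
  assume "rcls a = rcls c"
  then show "connected_by C c (rcls a)"
    using rho_cone[OF E_A[OF c]] lam_E[OF c] rho_in_rcls[OF E_A[OF c]]
      rho_idempotent_iff[OF E_A[OF c]] c unfolding connected_by_def by auto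
qed

lemma idem_cone_rcls:
  assumes c: "c \<in> E"
  shows "idem_cone C c (rcls c) = rho c"
  unfolding idem_cone_def
proof (rule the_equality)
  show "rho c \<in> rcls c \<and> rho c \<in> idempotents Cones \<and> is_cone C c (rho c)"
    using c rho_in_rcls rho_idempotent_iff rho_cone[of c] lam_E by simp
  fix \<gamma> assume \<gamma>: "\<gamma> \<in> rcls c \<and> \<gamma> \<in> idempotents Cones \<and> is_cone C c \<gamma>"
  then obtain b where b: "b \<in> A" "\<gamma> = rho b" "rcls b = rcls c"
    using rclsE[of c \<gamma>] c by (metis E_A)
  then have "b \<in> E" "lam b = c"
    using rho_idempotent_iff \<gamma> C.cone_vertex_unique[OF rho_cone[OF b(1)]] by auto
  then show "\<gamma> = rho c"
    using b lam_E by simp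
qed

definition ccat :: "('u, 'u) ccat" where
  "ccat = \<lparr>Cat = C, Classes = classes\<rparr>"

lemma ccat_simps [simp]: "Cat ccat = C" "Classes ccat = classes"
  by (simp_all add: ccat_def)

lemma supported_ccat: "supported_category ccat"
proof -
  have "class_down_set C classes"
    unfolding class_down_set_def
  proof (intro conjI subsetI ballI impI)
    fix d assume "d \<in> classes"
    then show "d \<in> cone_classes C"
      using rho_in_Cones by (auto simp: classes_def cone_classes_def intro: quotientI)
  next
    fix d e assume "d \<in> classes" "e \<in> cone_classes C" and below: "class_below C e d"
    then obtain a \<gamma> where a: "a \<in> A" "d = rcls a" and \<gamma>: "\<gamma> \<in> Carrier Cones" "e = green_R Cones `` {\<gamma>}"
      by (auto simp: classes_def cone_classes_def elim!: quotientE)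
    have "\<gamma> \<in> principal_right_ideal Cones (rho a)"
      using below R_below_classes_iff[OF C.cone_semigroup \<gamma>(1) rho_in_Cones[OF a(1)]] a \<gamma> by simp
    then show "e \<in> classes"
      using rho_ideal[OF a(1)] a(1) \<gamma>(2) by (auto simp: classes_def)
  qed
  moreover have "\<exists>!d. d \<in> classes \<and> connected_by C c d" if c: "c \<in> E" for c
  proof (rule ex1I[of _ "rcls c"])
    show "rcls c \<in> classes \<and> connected_by C c (rcls c)"
      using c connected_by_rcls by (auto simp: classes_def)
  qed (use c connected_by_rcls in \<open>auto simp: classes_def\<close>)
  ultimately show ?thesis
    using normal_C unfolding supported_category_def connected_category_def ccat_simps Obj_C
    by blast
qed

end


section \<open>Supported categories\<close>

definition support_class :: "('o, 'm) ccat \<Rightarrow> 'o \<Rightarrow> ('o \<Rightarrow> 'm) set" where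
  "support_class X c = (THE d. d \<in> Classes X \<and> connected_by (Cat X) c d)"

definition support_cone :: "('o, 'm) ccat \<Rightarrow> 'o \<Rightarrow> 'o \<Rightarrow> 'm" where
  "support_cone X c = idem_cone (Cat X) c (support_class X c)"

locale supported =
  fixes X :: "('o, 'm) ccat"
  assumes supported: "supported_category X"
begin

abbreviation "C \<equiv> Cat X"
abbreviation "cls \<equiv> support_class X"
abbreviation "eps \<equiv> support_cone X"

lemma connected: "connected_category X"
  using supported by (simp add: supported_category_def)

sublocale normal_cat "Cat X"
  using connected by unfold_locales (simp add: connected_category_def)

notation comp (infixl "\<cdot>" 70) and epi ("_\<degree>" [1000] 1000)
  and star (infixl "\<star>" 70) and mult (infixl "\<odot>" 70)

lemma Classes_down: "\<lbrakk>d \<in> Classes X; e \<in> cone_classes C; class_below C e d\<rbrakk> \<Longrightarrow> e \<in> Classes X"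
  using connected by (simp add: connected_category_def class_down_set_def)

lemma Classes_classes: "Classes X \<subseteq> cone_classes C"
  using connected by (simp add: connected_category_def class_down_set_def)

lemma ex1_class: "c \<in> Obj C \<Longrightarrow> \<exists>!d. d \<in> Classes X \<and> connected_by C c d"
  using supported unfolding supported_category_def by blast

lemma cls: "c \<in> Obj C \<Longrightarrow> cls c \<in> Classes X \<and> connected_by C c (cls c)"
  unfolding support_class_def by (rule theI', rule ex1_class)

lemma cls_eq: "\<lbrakk>c \<in> Obj C; d \<in> Classes X; connected_by C c d\<rbrakk> \<Longrightarrow> cls c = d"
  using ex1_class cls by blast

lemma idem_cone_eq:
  assumes "d \<in> Classes X" "\<gamma> \<in> d" "\<gamma> \<in> idempotents (cone_semigroup C)" and \<gamma>: "is_cone C c \<gamma>"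
  shows "idem_cone C c d = \<gamma>"
  unfolding idem_cone_def
proof (rule the_equality)
  fix \<delta> assume \<delta>: "\<delta> \<in> d \<and> \<delta> \<in> idempotents (cone_semigroup C) \<and> is_cone C c \<delta>"
  have d: "d \<in> cones // green_R (cone_semigroup C)"
    using Classes_classes assms by (auto simp: cone_classes_def)
  have "(\<delta>, \<gamma>) \<in> green_R (cone_semigroup C)"
    using quotient_eq_iff[OF equiv_green_R d d] \<delta> assms(2) by simp
  then show "\<delta> = \<gamma>"
    using idempotent_cone_unique[of c \<delta> \<gamma>] idempotent_cone_iff[OF \<gamma>] idempotent_cone_iff[of c \<delta>]
      assms \<delta> by simp
qed (use assms in simp)

lemma eps:
  assumes c: "c \<in> Obj C"
  shows "is_cone C c (eps c)" "eps c c = Ide C c" "eps c \<in> cls c"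
    "cls c = green_R (cone_semigroup C) `` {eps c}"
proof -
  obtain \<gamma> where \<gamma>: "\<gamma> \<in> cls c" "\<gamma> \<in> idempotents (cone_semigroup C)" "is_cone C c \<gamma>"
    using cls[OF c] by (auto simp: connected_by_def)
  then have "eps c = \<gamma>"
    using idem_cone_eq[OF _ \<gamma>] cls[OF c] by (simp add: support_cone_def)
  then show eps: "is_cone C c (eps c)" "eps c c = Ide C c" "eps c \<in> cls c"
    using \<gamma> idempotent_cone_iff[OF \<gamma>(3)] by simp_all
  have d: "cls c \<in> cones // green_R (cone_semigroup C)"
    using Classes_classes cls[OF c] by (auto simp: cone_classes_def)
  then obtain \<delta> where \<delta>: "cls c = green_R (cone_semigroup C) `` {\<delta>}"
    by (auto elim: quotientE)
  then have "(\<delta>, eps c) \<in> green_R (cone_semigroup C)"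
    using eps(3) by simp
  then show "cls c = green_R (cone_semigroup C) `` {eps c}"
    using \<delta> equiv_class_eq[OF equiv_green_R] by metis
qed

lemma eps_Hom: "\<lbrakk>c \<in> Obj C; x \<in> Obj C\<rbrakk> \<Longrightarrow> eps c x \<in> Hom C x c"
  using cone_Hom[OF eps(1)] .

lemma idempotent_in_class:
  assumes "d \<in> Classes X" "\<gamma> \<in> d" "is_cone C c \<gamma>" "\<gamma> c = Ide C c"
  shows "d = cls c" "\<gamma> = eps c"
proof -
  have c: "c \<in> Obj C"
    using assms by (simp add: is_cone_def)
  have \<gamma>: "\<gamma> \<in> idempotents (cone_semigroup C)"
    using idempotent_cone_iff[OF assms(3)] assms(4) by simp
  then show d: "d = cls c"
    using cls_eq[OF c assms(1)] assms unfolding connected_by_def by blast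
  show "\<gamma> = eps c"
    using idem_cone_eq[OF assms(1,2) \<gamma> assms(3)] d by (simp add: support_cone_def)
qed

lemma class_representative:
  assumes d: "d \<in> Classes X" and \<gamma>: "\<gamma> \<in> d"
  obtains c where "c \<in> Obj C" "d = cls c" "(eps c, \<gamma>) \<in> green_R (cone_semigroup C)"
proof -
  have dq: "d \<in> cones // green_R (cone_semigroup C)"
    using Classes_classes d by (auto simp: cone_classes_def)
  then have "\<gamma> \<in> cones"
    using \<gamma> in_quotient_imp_subset[OF equiv_green_R] by blast
  then obtain z where z: "is_cone C z \<gamma>"
    by (auto simp: cones_iff)
  obtain c \<epsilon> where c: "c \<in> Obj C" "is_cone C c \<epsilon>" "\<epsilon> c = Ide C c"
      and R: "(\<epsilon>, \<gamma>) \<in> green_R (cone_semigroup C)"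
    using R_related_idempotent_cone[OF z] .
  have "\<epsilon> \<in> d"
    using in_quotient_imp_closed[OF equiv_green_R dq \<gamma>] R equiv_green_R[of "cone_semigroup C"]
    by (meson equivE symE)
  then show ?thesis
    using that[OF c(1)] idempotent_in_class[OF d _ c(2,3)] R by simp
qed

text \<open>Each class contains an idempotent cone and is then the support class of its vertex.
  Consequently the class component of a CC-morphism is determined by its object component.\<close>

lemma Classes_eq: "Classes X = cls ` Obj C"
proof (intro equalityI subsetI)
  fix d assume d: "d \<in> Classes X"
  then have "d \<noteq> {}"
    using Classes_classes in_quotient_imp_non_empty[OF equiv_green_R]
    unfolding cone_classes_def by blast
  then obtain \<gamma> where "\<gamma> \<in> d"
    by blast
  then show "d \<in> cls ` Obj C"
    using class_representative[OF d] by (metis imageI)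
qed (use cls in auto)

lemma cls_below_iff:
  assumes "a \<in> Obj C" "b \<in> Obj C"
  shows "class_below C (cls a) (cls b) \<longleftrightarrow> eps a = eps b \<star> (eps a b)\<degree>"
  using R_below_classes_iff[OF cone_semigroup cone_in_cones[OF eps(1)] cone_in_cones[OF eps(1)]]
    idempotent_cone_mem_ideal_iff[OF eps(1,2) eps(1)] assms
  by (simp add: eps(4)[symmetric])

end

text \<open>Every class is the support class of an object, and an object is connected to no other
  class, so all conditions over classes become conditions over objects. The work with CC-morphisms
  uses mainly this form.\<close>

lemma cc_morphism_iff:
  assumes "supported_category X" "supported_category Y"
  shows "cc_morphism X Y \<phi> \<longleftrightarrow>
     cat_functor (Cat X) (Cat Y) (ObjMap \<phi>) (ArrMap \<phi>) \<and>
     (\<forall>j\<in>Incl (Cat X). ArrMap \<phi> j \<in> Incl (Cat Y)) \<and>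
     (\<forall>c\<in>Obj (Cat X). ClassMap \<phi> (support_class X c) = support_class Y (ObjMap \<phi> c)) \<and>
     (\<forall>a\<in>Obj (Cat X). \<forall>b\<in>Obj (Cat X).
        class_below (Cat X) (support_class X a) (support_class X b) \<longrightarrow>
        class_below (Cat Y) (support_class Y (ObjMap \<phi> a)) (support_class Y (ObjMap \<phi> b))) \<and>
     (\<forall>c\<in>Obj (Cat X). \<forall>x\<in>Obj (Cat X).
        ArrMap \<phi> (support_cone X c x) = support_cone Y (ObjMap \<phi> c) (ObjMap \<phi> x))"
    (is "_ \<longleftrightarrow> ?F \<and> ?I \<and> ?cls \<and> ?ord \<and> ?eps")
proof -
  interpret X: supported X by unfold_locales fact
  interpret Y: supported Y by unfold_locales fact
  show ?thesis
  proof
    assume L: "cc_morphism X Y \<phi>"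
    then have F: ?F and I: ?I and sub: "ClassMap \<phi> ` Classes X \<subseteq> Classes Y"
      and ord: "\<And>d e. \<lbrakk>d \<in> Classes X; e \<in> Classes X; class_below (Cat X) d e\<rbrakk>
        \<Longrightarrow> class_below (Cat Y) (ClassMap \<phi> d) (ClassMap \<phi> e)"
      and conn: "\<And>c d. \<lbrakk>c \<in> Obj (Cat X); d \<in> Classes X; connected_by (Cat X) c d\<rbrakk>
        \<Longrightarrow> connected_by (Cat Y) (ObjMap \<phi> c) (ClassMap \<phi> d) \<and>
        (\<forall>c'\<in>Obj (Cat X). ArrMap \<phi> (idem_cone (Cat X) c d c') =
           idem_cone (Cat Y) (ObjMap \<phi> c) (ClassMap \<phi> d) (ObjMap \<phi> c'))"
      unfolding cc_morphism_def by blast+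
    interpret F: cat_functor "Cat X" "Cat Y" "ObjMap \<phi>" "ArrMap \<phi>" by fact
    have cls: ?cls
    proof
      fix c assume c: "c \<in> Obj (Cat X)"
      then show "ClassMap \<phi> (support_class X c) = support_class Y (ObjMap \<phi> c)"
        using Y.cls_eq[OF F.maps_Obj[OF c], symmetric] conn[OF c] X.cls[OF c] sub by blast
    qed
    have ?eps
    proof (intro ballI)
      fix c x assume cx: "c \<in> Obj (Cat X)" "x \<in> Obj (Cat X)"
      then show "ArrMap \<phi> (support_cone X c x) = support_cone Y (ObjMap \<phi> c) (ObjMap \<phi> x)"
        using conn[OF cx(1)] X.cls[OF cx(1)] cls by (simp add: support_cone_def)
    qed
    moreover have ?ord
      using ord X.cls cls by metis
    ultimately show "?F \<and> ?I \<and> ?cls \<and> ?ord \<and> ?eps"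
      using F I cls by blast
  next
    assume R: "?F \<and> ?I \<and> ?cls \<and> ?ord \<and> ?eps"
    then interpret F: cat_functor "Cat X" "Cat Y" "ObjMap \<phi>" "ArrMap \<phi>" by blast
    have "connected_by (Cat Y) (ObjMap \<phi> c) (ClassMap \<phi> d) \<and>
        (\<forall>c'\<in>Obj (Cat X). ArrMap \<phi> (idem_cone (Cat X) c d c') =
           idem_cone (Cat Y) (ObjMap \<phi> c) (ClassMap \<phi> d) (ObjMap \<phi> c'))"
      if cd: "c \<in> Obj (Cat X)" "d \<in> Classes X" "connected_by (Cat X) c d" for c d
    proof -
      have "d = support_class X c"
        using X.cls_eq[OF cd] by simp
      then show ?thesis
        using R Y.cls[OF F.maps_Obj[OF cd(1)]] cd(1) by (simp add: support_cone_def)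
    qed
    moreover have "ClassMap \<phi> ` Classes X \<subseteq> Classes Y"
      using R F.maps_Obj unfolding X.Classes_eq Y.Classes_eq by auto
    moreover have "\<forall>d\<in>Classes X. \<forall>e\<in>Classes X. class_below (Cat X) d e \<longrightarrow>
        class_below (Cat Y) (ClassMap \<phi> d) (ClassMap \<phi> e)"
      using R unfolding X.Classes_eq by simp
    ultimately show "cc_morphism X Y \<phi>"
      using R unfolding cc_morphism_def by blast
  qed
qed

section \<open>The categories \<open>SC\<close> and \<open>RUS\<close>\<close>

lemma cat_functor_cong:
  assumes "cat_functor C D Fo Fa" and Fo: "\<And>a. a \<in> Obj C \<Longrightarrow> Go a = Fo a"
    and Fa: "\<And>f. f \<in> Arr C \<Longrightarrow> Ga f = Fa f"
  shows "cat_functor C D Go Ga"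
proof -
  interpret F: cat_functor C D Fo Fa by fact
  show ?thesis
    by unfold_locales
      (simp_all add: assms F.maps_Obj F.maps_Arr F.maps_Ide F.maps_Comp F.source.Dom_closed
        F.source.Cod_closed F.source.Ide_closed F.source.Comp_closed)
qed

lemma supported_imp_connected: "supported_category X \<Longrightarrow> connected_category X"
  by (simp add: supported_category_def)

lemma Obj_SC: "Obj SC = {X. supported_category X \<and> extensional_category (Cat X)}"
  by (auto simp: SC_def full_subcategory_def CC_def supported_imp_connected)

lemma Arr_SC: "m \<in> Arr SC \<longleftrightarrow> (\<exists>X \<phi> Y. m = Arrow X \<phi> Y \<and> X \<in> Obj SC \<and> Y \<in> Obj SC \<and>
    cc_morphism X Y \<phi> \<and> extensional_cc_map X \<phi>)"
  unfolding Obj_SC by (auto simp: SC_def full_subcategory_def CC_def supported_imp_connected)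

definition cc_identity :: "('o, 'm) ccat \<Rightarrow> ('o, 'm, 'o, 'm) cc_map" where
  "cc_identity X = \<lparr>ObjMap = (\<lambda>c\<in>Obj (Cat X). c), ArrMap = (\<lambda>f\<in>Arr (Cat X). f),
     ClassMap = (\<lambda>d\<in>Classes X. d)\<rparr>"

definition cc_compose :: "('o, 'm) ccat \<Rightarrow> ('o, 'm, 'o, 'm) cc_map \<Rightarrow>
    ('o, 'm, 'o, 'm) cc_map \<Rightarrow> ('o, 'm, 'o, 'm) cc_map" where
  "cc_compose X \<phi> \<psi> = \<lparr>ObjMap = compose (Obj (Cat X)) (ObjMap \<psi>) (ObjMap \<phi>),
     ArrMap = compose (Arr (Cat X)) (ArrMap \<psi>) (ArrMap \<phi>),
     ClassMap = compose (Classes X) (ClassMap \<psi>) (ClassMap \<phi>)\<rparr>"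

lemma SC_simps [simp]: "Dom SC = Source" "Cod SC = Target"
    "Ide SC X = Arrow X (cc_identity X) X"
    "Comp SC (Arrow X \<phi> Y) (Arrow Y' \<psi> Z) = Arrow X (cc_compose X \<phi> \<psi>) Z"
  by (simp_all add: SC_def full_subcategory_def CC_def cc_identity_def cc_compose_def)

lemma cc_morphism_identity:
  assumes "supported_category X"
  shows "cc_morphism X X (cc_identity X)"
proof -
  interpret X: supported X by unfold_locales fact
  have "cat_functor (Cat X) (Cat X) (ObjMap (cc_identity X)) (ArrMap (cc_identity X))"
    by (rule cat_functor_cong[OF X.cat_functor_identity]) (simp_all add: cc_identity_def)
  then show ?thesis
    unfolding cc_morphism_iff[OF assms assms]
    using X.Incl_Arr X.cls HomD(1)[OF X.eps_Hom] by (simp add: cc_identity_def)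
qed

lemma cc_morphism_compose:
  assumes sup: "supported_category X" "supported_category Y" "supported_category Z"
    and \<phi>: "cc_morphism X Y \<phi>" and \<psi>: "cc_morphism Y Z \<psi>"
  shows "cc_morphism X Z (cc_compose X \<phi> \<psi>)"
proof -
  interpret X: supported X by unfold_locales fact
  note P = \<phi>[unfolded cc_morphism_iff[OF sup(1,2)]] and Q = \<psi>[unfolded cc_morphism_iff[OF sup(2,3)]]
  interpret F: cat_functor "Cat X" "Cat Y" "ObjMap \<phi>" "ArrMap \<phi>" using P by blast
  interpret G: cat_functor "Cat Y" "Cat Z" "ObjMap \<psi>" "ArrMap \<psi>" using Q by blast
  have "cat_functor (Cat X) (Cat Z) (ObjMap (cc_compose X \<phi> \<psi>)) (ArrMap (cc_compose X \<phi> \<psi>))"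
    by (rule cat_functor_cong[OF cat_functor_compose[OF F.cat_functor_axioms G.cat_functor_axioms]])
      (simp_all add: cc_compose_def compose_def)
  then show ?thesis
    unfolding cc_morphism_iff[OF sup(1,3)]
    using P Q X.Incl_Arr X.cls HomD(1)[OF X.eps_Hom] F.maps_Obj
    by (simp add: cc_compose_def compose_def)
qed

lemma extensional_cc_map_compose: "extensional_cc_map X (cc_compose X \<phi> \<psi>)"
  by (simp add: extensional_cc_map_def cc_compose_def)

lemma cc_map_eqI:
  assumes "extensional_cc_map X \<phi>" "extensional_cc_map X \<psi>"
    and "\<And>c. c \<in> Obj (Cat X) \<Longrightarrow> ObjMap \<phi> c = ObjMap \<psi> c"
    and "\<And>f. f \<in> Arr (Cat X) \<Longrightarrow> ArrMap \<phi> f = ArrMap \<psi> f"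
    and "\<And>d. d \<in> Classes X \<Longrightarrow> ClassMap \<phi> d = ClassMap \<psi> d"
  shows "\<phi> = \<psi>"
proof -
  have "ObjMap \<phi> = ObjMap \<psi>" "ArrMap \<phi> = ArrMap \<psi>" "ClassMap \<phi> = ClassMap \<psi>"
    using assms extensionalityI unfolding extensional_cc_map_def by metis+
  then show ?thesis
    by (simp add: cc_map.equality)
qed

lemma category_SC: "category SC"
proof
  fix m assume "m \<in> Arr (SC :: (('o, 'm) ccat, _) precategory)"
  then obtain X \<phi> Y where m: "m = Arrow X \<phi> Y" and XY: "X \<in> Obj SC" "Y \<in> Obj SC"
      and \<phi>: "cc_morphism X Y \<phi>" "extensional_cc_map X \<phi>"
    unfolding Arr_SC by blast
  show "Dom SC m \<in> Obj SC" "Cod SC m \<in> Obj SC"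
    using m XY by simp_all
  have sup: "supported_category X" "supported_category Y"
    using XY by (simp_all add: Obj_SC)
  interpret X: supported X by unfold_locales fact
  interpret F: cat_functor "Cat X" "Cat Y" "ObjMap \<phi>" "ArrMap \<phi>"
    using \<phi> by (simp add: cc_morphism_def)
  have cl: "ClassMap \<phi> d \<in> Classes Y" if "d \<in> Classes X" for d
    using \<phi> that by (auto simp: cc_morphism_def)
  have "cc_compose X (cc_identity X) \<phi> = \<phi>"
    by (rule cc_map_eqI[OF extensional_cc_map_compose \<phi>(2)])
      (simp_all add: cc_compose_def cc_identity_def compose_def)
  moreover have "cc_compose X \<phi> (cc_identity Y) = \<phi>"
    using cl HomD(1)[OF F.maps_Arr] F.maps_Obj
    by (intro cc_map_eqI[OF extensional_cc_map_compose \<phi>(2)])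
      (simp_all add: cc_compose_def cc_identity_def compose_def)
  ultimately show "Comp SC (Ide SC (Dom SC m)) m = m" "Comp SC m (Ide SC (Cod SC m)) = m"
    using m by simp_all
next
  fix X assume X: "X \<in> Obj (SC :: (('o, 'm) ccat, _) precategory)"
  then show "Ide SC X \<in> Arr SC"
    using cc_morphism_identity[of X]
    by (simp add: Arr_SC) (simp add: Obj_SC extensional_cc_map_def cc_identity_def)
  show "Dom SC (Ide SC X) = X" "Cod SC (Ide SC X) = X"
    by simp_all
next
  fix m n assume mn: "m \<in> Arr (SC :: (('o, 'm) ccat, _) precategory)" "n \<in> Arr SC" "Cod SC m = Dom SC n"
  then obtain X \<phi> Y \<psi> Z where m: "m = Arrow X \<phi> Y" and n: "n = Arrow Y \<psi> Z"
      and XYZ: "X \<in> Obj SC" "Y \<in> Obj SC" "Z \<in> Obj SC"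
      and \<phi>: "cc_morphism X Y \<phi>" and \<psi>: "cc_morphism Y Z \<psi>"
    unfolding Arr_SC by auto
  then show "Comp SC m n \<in> Arr SC"
    using cc_morphism_compose[OF _ _ _ \<phi> \<psi>] extensional_cc_map_compose
    by (auto simp: Arr_SC Obj_SC)
  show "Dom SC (Comp SC m n) = Dom SC m" "Cod SC (Comp SC m n) = Cod SC n"
    using m n by simp_all
  fix p assume "p \<in> Arr (SC :: (('o, 'm) ccat, _) precategory)" "Cod SC n = Dom SC p"
  then obtain \<chi> W where p: "p = Arrow Z \<chi> W"
    using n unfolding Arr_SC by auto
  interpret F: cat_functor "Cat X" "Cat Y" "ObjMap \<phi>" "ArrMap \<phi>"
    using \<phi> by (simp add: cc_morphism_def)
  have "ClassMap \<phi> d \<in> Classes Y" if "d \<in> Classes X" for d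
    using \<phi> that by (auto simp: cc_morphism_def)
  then have "cc_compose X (cc_compose X \<phi> \<psi>) \<chi> = cc_compose X \<phi> (cc_compose Y \<psi> \<chi>)"
    using HomD(1)[OF F.maps_Arr] F.maps_Obj
    by (intro cc_map_eqI[OF extensional_cc_map_compose extensional_cc_map_compose])
      (simp_all add: cc_compose_def compose_def)
  then show "Comp SC (Comp SC m n) p = Comp SC m (Comp SC n p)"
    using m n p by simp
qed

lemma Obj_RUS: "Obj RUS = {S. R_unipotent S \<and> extensional_sgrp S}"
  by (simp add: RUS_def)

lemma Arr_RUS: "m \<in> Arr RUS \<longleftrightarrow> (\<exists>S h T. m = Arrow S h T \<and> S \<in> Obj RUS \<and> T \<in> Obj RUS \<and>
    h \<in> semigroup_homs S T)"
  by (auto simp: RUS_def)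

lemma RUS_simps [simp]: "Dom RUS = Source" "Cod RUS = Target"
    "Ide RUS S = Arrow S (\<lambda>x\<in>Carrier S. x) S"
    "Comp RUS (Arrow S h T) (Arrow T' k U) = Arrow S (compose (Carrier S) k h) U"
  by (simp_all add: RUS_def)

lemma semigroup_homsD:
  assumes "h \<in> semigroup_homs S T"
  shows "a \<in> Carrier S \<Longrightarrow> h a \<in> Carrier T" "h \<in> extensional (Carrier S)"
    "\<lbrakk>a \<in> Carrier S; b \<in> Carrier S\<rbrakk> \<Longrightarrow> h (Mult S a b) = Mult T (h a) (h b)"
  using assms by (auto simp: semigroup_homs_def PiE_iff)

lemma semigroup_hom_compose:
  assumes "is_semigroup S" "h \<in> semigroup_homs S T" "k \<in> semigroup_homs T U"
  shows "compose (Carrier S) k h \<in> semigroup_homs S U"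
  using assms(1) semigroup_homsD[OF assms(2)] semigroup_homsD[OF assms(3)]
  by (simp add: semigroup_homs_def compose_def is_semigroup_def)

lemma category_RUS: "category RUS"
proof
  fix m assume "m \<in> Arr (RUS :: ('u sgrp, _) precategory)"
  then obtain S h T where m: "m = Arrow S h T" and "S \<in> Obj RUS" "T \<in> Obj RUS"
      and h: "h \<in> semigroup_homs S T"
    unfolding Arr_RUS by blast
  then show "Dom RUS m \<in> Obj RUS" "Cod RUS m \<in> Obj RUS"
    by simp_all
  have "compose (Carrier S) h (\<lambda>x\<in>Carrier S. x) = h" "compose (Carrier S) (\<lambda>x\<in>Carrier T. x) h = h"
    using semigroup_homsD[OF h] by (auto simp: compose_def extensional_def fun_eq_iff)
  then show "Comp RUS (Ide RUS (Dom RUS m)) m = m" "Comp RUS m (Ide RUS (Cod RUS m)) = m"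
    using m by simp_all
next
  fix S assume S: "S \<in> Obj (RUS :: ('u sgrp, _) precategory)"
  then have "is_semigroup S"
    by (simp add: Obj_RUS R_unipotent_def regular_semigroup_def)
  then show "Ide RUS S \<in> Arr RUS"
    using S by (auto simp: Arr_RUS semigroup_homs_def is_semigroup_def)
  show "Dom RUS (Ide RUS S) = S" "Cod RUS (Ide RUS S) = S"
    by simp_all
next
  fix m n assume "m \<in> Arr (RUS :: ('u sgrp, _) precategory)" "n \<in> Arr RUS" "Cod RUS m = Dom RUS n"
  then obtain S h T k U where m: "m = Arrow S h T" and n: "n = Arrow T k U"
      and STU: "S \<in> Obj RUS" "T \<in> Obj RUS" "U \<in> Obj RUS"
      and h: "h \<in> semigroup_homs S T" and k: "k \<in> semigroup_homs T U"
    unfolding Arr_RUS by auto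
  then have "is_semigroup S"
    by (simp add: Obj_RUS R_unipotent_def regular_semigroup_def)
  then show "Comp RUS m n \<in> Arr RUS"
    using semigroup_hom_compose[OF _ h k] STU m n by (auto simp: Arr_RUS)
  show "Dom RUS (Comp RUS m n) = Dom RUS m" "Cod RUS (Comp RUS m n) = Cod RUS n"
    using m n by simp_all
  fix p assume "p \<in> Arr (RUS :: ('u sgrp, _) precategory)" "Cod RUS n = Dom RUS p"
  then obtain l V where "p = Arrow U l V"
    using n unfolding Arr_RUS by auto
  then show "Comp RUS (Comp RUS m n) p = Comp RUS m (Comp RUS n p)"
    using m n semigroup_homsD(1)[OF h] by (simp add: compose_def fun_eq_iff)
qed


section \<open>Homomorphisms and CC-morphisms\<close>

context r_unipotent
begin

lemma support_class_ccat [simp]: "e \<in> E \<Longrightarrow> support_class ccat e = rcls e"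
  using supported.cls_eq[OF supported.intro[OF supported_ccat], of e "rcls e"]
    connected_by_rcls[of e e] by (simp add: classes_eq)

lemma support_cone_ccat [simp]: "e \<in> E \<Longrightarrow> support_cone ccat e = rho e"
  by (simp add: support_cone_def idem_cone_rcls)

end

text \<open>A class is sent to the support class of the image of an arbitrary idempotent
  representing it; homomorphisms preserve the \<open>R\<close>-order, so the choice does not matter.
  Restriction to the carriers gives extensional maps.\<close>

definition induced_cc_map ::
  "('u \<times> 'u \<times> 'u \<Rightarrow> 'u) \<Rightarrow> 'u sgrp \<Rightarrow> 'u sgrp \<Rightarrow> ('u \<Rightarrow> 'u) \<Rightarrow> ('u, 'u, 'u, 'u) cc_map" where
  "induced_cc_map enc S T h =
     \<lparr>ObjMap = (\<lambda>e\<in>idempotents S. h e),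
      ArrMap = (\<lambda>m\<in>Arr (ideal_category enc S).
        case inv enc m of (e, u, f) \<Rightarrow> enc (h e, h u, h f)),
      ClassMap = (\<lambda>d\<in>Classes (r_unipotent.ccat enc S). support_class (r_unipotent.ccat enc T)
        (h (SOME e. e \<in> idempotents S \<and> support_class (r_unipotent.ccat enc S) e = d)))\<rparr>"

locale r_unipotent_pair = S: r_unipotent enc S + T: r_unipotent enc T
  for enc :: "'u \<times> 'u \<times> 'u \<Rightarrow> 'u" and S T :: "'u sgrp"
begin

notation S.mul (infixl "\<otimes>" 70) and T.mul (infixl "\<odot>" 70)

lemma extensional_induced: "extensional_cc_map S.ccat (induced_cc_map enc S T h)"
  by (simp add: extensional_cc_map_def induced_cc_map_def)

context
  fixes h assumes h: "h \<in> semigroup_homs S T"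
begin

lemma hom_closed [simp]: "a \<in> Carrier S \<Longrightarrow> h a \<in> Carrier T"
  using semigroup_homsD(1)[OF h] .

lemma hom_mult: "\<lbrakk>a \<in> Carrier S; b \<in> Carrier S\<rbrakk> \<Longrightarrow> h (a \<otimes> b) = h a \<odot> h b"
  using semigroup_homsD(3)[OF h] by simp

lemma hom_idempotent [simp]: "e \<in> S.E \<Longrightarrow> h e \<in> T.E"
  using hom_mult[of e e] by (auto intro: T.E_I)

lemma hom_tri: "S.tri e u f \<Longrightarrow> T.tri (h e) (h u) (h f)"
  using hom_mult[of e u] hom_mult[of u f] by (simp add: S.tri_iff T.tri_iff)

lemma hom_below:
  assumes "a \<in> Carrier S" "b \<in> Carrier S" "class_below S.C (S.rcls a) (S.rcls b)"
  shows "class_below T.C (T.rcls (h a)) (T.rcls (h b))"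
proof -
  consider "a = b" | s where "s \<in> Carrier S" "a = b \<otimes> s"
    using assms S.rcls_below_iff by blast
  then show ?thesis
    using T.rcls_below_iff[of "h a" "h b"] hom_mult[OF assms(2)] assms by cases auto
qed

text \<open>Equality of classes is comparability both ways, and each comparison is preserved. This
  makes the \<open>SOME\<close> in \<open>induced_cc_map\<close> harmless.\<close>

lemma hom_rcls:
  assumes "a \<in> Carrier S" "b \<in> Carrier S" "S.rcls a = S.rcls b"
  shows "T.rcls (h a) = T.rcls (h b)"
proof -
  have "class_below S.C (S.rcls a) (S.rcls b)" "class_below S.C (S.rcls b) (S.rcls a)"
    using assms S.rcls_below_iff[of a a] by simp_all
  then have "class_below T.C (T.rcls (h a)) (T.rcls (h b))" "class_below T.C (T.rcls (h b)) (T.rcls (h a))"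
    using hom_below assms by blast+
  then have "(T.rho (h a), T.rho (h b)) \<in> green_R T.Cones"
    using assms green_R_iff[OF T.C.cone_semigroup] T.rho_in_Cones R_below_classes_iff[OF T.C.cone_semigroup]
    by simp
  then show ?thesis
    using T.rcls_eq_iff assms by simp
qed

lemma induced_Obj [simp]: "e \<in> S.E \<Longrightarrow> ObjMap (induced_cc_map enc S T h) e = h e"
  by (simp add: induced_cc_map_def)

lemma induced_Arr [simp]: "S.tri e u f
    \<Longrightarrow> ArrMap (induced_cc_map enc S T h) (enc (e, u, f)) = enc (h e, h u, h f)"
  by (simp add: induced_cc_map_def S.Arr_C)

lemma induced_class [simp]:
  assumes e: "e \<in> S.E"
  shows "ClassMap (induced_cc_map enc S T h) (S.rcls e) = T.rcls (h e)"
proof -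
  define f where "f = (SOME f. f \<in> S.E \<and> support_class S.ccat f = S.rcls e)"
  have "f \<in> S.E \<and> support_class S.ccat f = S.rcls e"
    unfolding f_def by (rule someI[of _ e]) (use e in simp)
  then have f: "f \<in> S.E" "S.rcls f = S.rcls e"
    using S.support_class_ccat[of f] by auto
  then have "T.rcls (h f) = T.rcls (h e)"
    using hom_rcls[of f e] e by simp
  moreover have "ClassMap (induced_cc_map enc S T h) (S.rcls e) = T.rcls (h f)"
    using e f by (simp add: induced_cc_map_def f_def[symmetric] S.classes_eq)
  ultimately show ?thesis
    by simp
qed

lemma cc_morphism_induced: "cc_morphism S.ccat T.ccat (induced_cc_map enc S T h)"
proof -
  let ?\<phi> = "induced_cc_map enc S T h"
  have "cat_functor S.C T.C (ObjMap ?\<phi>) (ArrMap ?\<phi>)"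
  proof (intro cat_functor.intro cat_functor_axioms.intro S.category_C T.category_C)
    fix m assume "m \<in> Arr S.C"
    then obtain e u f where m: "m = enc (e, u, f)" "S.tri e u f"
      by (rule S.ArrE)
    then have "e \<in> S.E" "f \<in> S.E"
      by (simp_all add: S.tri_iff)
    then show "ArrMap ?\<phi> m \<in> Hom T.C (ObjMap ?\<phi> (Dom S.C m)) (ObjMap ?\<phi> (Cod S.C m))"
      using m hom_tri by simp
  next
    fix e assume "e \<in> Obj S.C"
    then have "e \<in> S.E" "S.tri e e e"
      by (simp_all add: S.tri_iff)
    then show "ObjMap ?\<phi> e \<in> Obj T.C" "ArrMap ?\<phi> (Ide S.C e) = Ide T.C (ObjMap ?\<phi> e)"
      by simp_all
  next
    fix m n assume "m \<in> Arr S.C" "n \<in> Arr S.C" "Cod S.C m = Dom S.C n"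
    then obtain e u f v g where m: "m = enc (e, u, f)" "S.tri e u f" and n: "n = enc (f, v, g)" "S.tri f v g"
      by (auto elim!: S.ArrE)
    then have "h (u \<otimes> v) = h u \<odot> h v"
      using hom_mult by (simp add: S.tri_iff)
    then show "ArrMap ?\<phi> (Comp S.C m n) = Comp T.C (ArrMap ?\<phi> m) (ArrMap ?\<phi> n)"
      using m n S.tri_Comp[OF m(2) n(2)] hom_tri by simp
  qed
  moreover have "\<forall>j\<in>Incl S.C. ArrMap ?\<phi> j \<in> Incl T.C"
    using hom_tri by (auto simp: S.Incl_C T.Incl_C)
  moreover have "\<forall>c\<in>S.E. \<forall>x\<in>S.E. ArrMap ?\<phi> (S.rho c x) = T.rho (h c) (h x)"
  proof (intro ballI)
    fix c x assume "c \<in> S.E" "x \<in> S.E"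
    then show "ArrMap ?\<phi> (S.rho c x) = T.rho (h c) (h x)"
      using S.tri_rho[of c x] hom_mult[of x c] S.lam_E T.lam_E by (simp add: S.rho_def T.rho_def)
  qed
  ultimately show ?thesis
    using hom_below by (simp add: cc_morphism_iff[OF S.supported_ccat T.supported_ccat])
qed

end

section \<open>Faithfulness and fullness on homomorphisms\<close>

text \<open>Every element \<open>a\<close> occurs as the middle entry of an arrow, from
  \<open>a \<otimes> x\<close> to \<open>x \<otimes> a\<close> for an inverse \<open>x\<close>, so
  the arrow map determines \<open>h a\<close>.\<close>

lemma induced_inj:
  assumes h: "h \<in> semigroup_homs S T" and k: "k \<in> semigroup_homs S T"
    and eq: "induced_cc_map enc S T h = induced_cc_map enc S T k"
  shows "h = k"
proof (rule extensionalityI[OF semigroup_homsD(2)[OF h] semigroup_homsD(2)[OF k]])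
  fix a assume a: "a \<in> Carrier S"
  then obtain x where "x \<in> Carrier S" "a \<otimes> x \<in> S.E" "x \<otimes> a \<in> S.E" "a \<otimes> x \<otimes> a = a" "x \<otimes> a \<otimes> x = x"
    by (rule S.inverseE)
  then have "S.tri (a \<otimes> x) a (x \<otimes> a)"
    using a by (simp add: S.tri_iff S.assoc)
  then show "h a = k a"
    using induced_Arr[OF h] induced_Arr[OF k] eq by (metis T.enc_eq prod.inject)
qed

lemma induced_surj:
  assumes \<phi>: "cc_morphism S.ccat T.ccat \<phi>" and ext: "extensional_cc_map S.ccat \<phi>"
  obtains h where "h \<in> semigroup_homs S T" "induced_cc_map enc S T h = \<phi>"
proof -
  note P = \<phi>[unfolded cc_morphism_iff[OF S.supported_ccat T.supported_ccat] S.ccat_simps T.ccat_simps S.Obj_C]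
  interpret F: cat_functor S.C T.C "ObjMap \<phi>" "ArrMap \<phi>" using P by blast
  define F where "F = ObjMap \<phi>"
  have F: "F e \<in> T.E" if "e \<in> S.E" for e
    using F.maps_Obj[of e] that by (simp add: F_def)
  \<comment> \<open>The middle entry of the image, at first allowed to depend on domain and
    codomain.\<close>
  define mid where "mid e u f = fst (snd (inv enc (ArrMap \<phi> (enc (e, u, f)))))" for e u f
  have mid: "ArrMap \<phi> (enc (e, u, f)) = enc (F e, mid e u f, F f)"
      and mid_tri: "T.tri (F e) (mid e u f) (F f)" if t: "S.tri e u f" for e u f
  proof -
    have "ArrMap \<phi> (enc (e, u, f)) \<in> Hom T.C (F e) (F f)"
      using F.maps_Hom[of "enc (e, u, f)" e f] t by (simp add: F_def)
    then obtain v where "ArrMap \<phi> (enc (e, u, f)) = enc (F e, v, F f)" "T.tri (F e) v (F f)"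
      by (auto simp: T.Hom_C)
    then show "ArrMap \<phi> (enc (e, u, f)) = enc (F e, mid e u f, F f)" "T.tri (F e) (mid e u f) (F f)"
      by (simp_all add: mid_def)
  qed
  have mid_comp: "mid e (u \<otimes> v) g = mid e u f \<odot> mid f v g" if "S.tri e u f" "S.tri f v g" for e u f v g
  proof -
    have "ArrMap \<phi> (Comp S.C (enc (e, u, f)) (enc (f, v, g)))
        = Comp T.C (ArrMap \<phi> (enc (e, u, f))) (ArrMap \<phi> (enc (f, v, g)))"
      using F.maps_Comp[of "enc (e, u, f)" "enc (f, v, g)"] that by (simp add: S.Arr_C)
    then show ?thesis
      using that mid mid_tri S.tri_Comp[OF that] by simp
  qed
  have mid_incl: "mid e e f = F e" if t: "S.tri e e f" for e f
  proof -
    have "enc (e, e, f) \<in> Incl S.C"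
      using t by (auto simp: S.Incl_C)
    then have "ArrMap \<phi> (enc (e, e, f)) \<in> Incl T.C"
      using P by blast
    then show ?thesis
      using mid[OF t] by (auto simp: T.Incl_C)
  qed
  \<comment> \<open>Independence of the codomain: the arrow factors through the inclusion of
    \<open>lam u\<close> in \<open>f\<close>, and inclusions go to inclusions.\<close>
  have mid_cod: "mid e u f = mid e u (S.lam u)" if t: "S.tri e u f" for e u f
  proof -
    have u: "u \<in> Carrier S" "f \<in> S.E" "u \<otimes> f = u"
      using t by (simp_all add: S.tri_iff)
    have j: "S.tri (S.lam u) (S.lam u) f"
      using u S.lam(1)[OF u(1)] S.lam_right[OF u(1) _ u(3)] by (simp add: S.tri_iff)
    note t' = S.epi_component_enc(2)[OF t]
    have "mid e u f = mid e (u \<otimes> S.lam u) f"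
      using S.lam(2)[OF u(1)] by simp
    also have "\<dots> = mid e u (S.lam u)"
      using mid_comp[OF t' j] mid_incl[OF j] mid_tri[OF t'] by (simp add: T.tri_iff)
    finally show ?thesis .
  qed
  \<comment> \<open>The arrow \<open>(c, c \<otimes> e, e)\<close> is the component at
    \<open>c\<close> of the idempotent cone with vertex \<open>e\<close>, so its image is
    prescribed.\<close>
  have mid_eps: "mid c (c \<otimes> e) e = F c \<odot> F e" if "c \<in> S.E" "e \<in> S.E" for c e
  proof -
    have "ArrMap \<phi> (S.rho e c) = T.rho (F e) (F c)"
      using P that F by (auto simp: F_def)
    moreover have "S.rho e c = enc (c, c \<otimes> e, e)" "T.rho (F e) (F c) = enc (F c, F c \<odot> F e, F e)"
      using that F S.lam_E T.lam_E by (simp_all add: S.rho_def T.rho_def)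
    ultimately show ?thesis
      using mid[of c "c \<otimes> e" e] S.tri_rho[of e c] S.lam_E[of e] that by simp
  qed
  \<comment> \<open>Preservation of the order of classes enters here. It transfers the relation
    \<open>e \<otimes> e' = e'\<close>, which is about left factors and is not expressed by
    inclusions.\<close>
  have F_below: "F e \<odot> F e' = F e'" if e: "e \<in> S.E" "e' \<in> S.E" "e \<otimes> e' = e'" for e e'
  proof -
    have "class_below S.C (S.rcls e') (S.rcls e)"
      using e S.rcls_below_iff[of e' e] by (metis S.E_A)
    then have "class_below T.C (T.rcls (F e')) (T.rcls (F e))"
      using P e F by (simp add: F_def)
    then consider "F e' = F e" | s where "s \<in> Carrier T" "F e' = F e \<odot> s"
      using T.rcls_below_iff F e by auto
    then show ?thesis
      using F[OF e(1)] T.extend[OF T.E_idem] by cases simp_all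
  qed
  \<comment> \<open>The idempotent \<open>r a = a \<otimes> x\<close> is \<open>R\<close>-related to
    \<open>a\<close>; the value of \<open>h\<close> at \<open>a\<close> is read off from the arrow
    with domain \<open>r a\<close>.\<close>
  have "\<forall>a\<in>Carrier S. \<exists>e\<in>S.E. e \<otimes> a = a \<and> (\<exists>x\<in>Carrier S. e = a \<otimes> x)"
    using S.inverseE by metis
  then obtain r where r: "\<And>a. a \<in> Carrier S \<Longrightarrow> r a \<in> S.E \<and> r a \<otimes> a = a \<and> (\<exists>x\<in>Carrier S. r a = a \<otimes> x)"
    by metis
  have r_tri: "S.tri (r a) a (S.lam a)" if "a \<in> Carrier S" for a
    using r[OF that] S.lam[OF that] that by (simp add: S.tri_iff)
  define h where "h = (\<lambda>a\<in>Carrier S. mid (r a) a (S.lam a))"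
  have mid_eq: "mid e u f = h u" if t: "S.tri e u f" for e u f
  proof -
    have u: "u \<in> Carrier S" "e \<in> S.E" "e \<otimes> u = u"
      using t by (simp_all add: S.tri_iff)
    note ru = r[OF u(1)] and t' = r_tri[OF u(1)]
    obtain x where x: "x \<in> Carrier S" "r u = u \<otimes> x"
      using ru by blast
    have er: "e \<otimes> r u = r u"
      using x u S.extend[OF u(3)] by simp
    have t1: "S.tri e (e \<otimes> r u) (r u)"
      using S.tri_rho[of "r u" e] ru u S.lam_E by simp
    \<comment> \<open>Independence of the domain: \<open>(e, u, _)\<close> is the cone component
      \<open>(e, e \<otimes> r u, r u)\<close> followed by the standard arrow of \<open>u\<close>.
      Its contribution \<open>F e \<odot> F (r u)\<close> collapses to \<open>F (r u)\<close>, which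
      fixes the middle entry.\<close>
    have "mid e u f = mid e ((e \<otimes> r u) \<otimes> u) (S.lam u)"
      using mid_cod[OF t] er ru by simp
    also have "\<dots> = (F e \<odot> F (r u)) \<odot> mid (r u) u (S.lam u)"
      using mid_comp[OF t1 t'] mid_eps u ru by simp
    also have "\<dots> = mid (r u) u (S.lam u)"
      using F_below[OF u(2) _ er] ru mid_tri[OF t'] by (simp add: T.tri_iff)
    finally show ?thesis
      using u by (simp add: h_def)
  qed
  have h_F: "h e = F e" if "e \<in> S.E" for e
    using mid_eq[of e e e] mid_incl[of e e] that by (simp add: S.tri_iff)
  have hom: "h \<in> semigroup_homs S T"
    unfolding semigroup_homs_def
  proof (intro CollectI conjI ballI PiE_I)
    fix a assume a: "a \<in> Carrier S"
    show h_a: "h a \<in> Carrier T"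
      using mid_tri[OF r_tri[OF a]] a by (simp add: h_def T.tri_iff)
    fix b assume b: "b \<in> Carrier S"
    have lb: "S.lam b \<in> S.E" and rb: "r b \<in> S.E"
      using S.lam[OF b] r[OF b] by simp_all
    have g: "S.tri (S.lam b) (S.lam b \<otimes> r a) (r a)"
      using S.tri_rho[of "r a" "S.lam b"] r[OF a] lb S.lam_E by simp
    \<comment> \<open>The standard arrows of \<open>b\<close> and \<open>a\<close> are not
      composable in general. The cone component from \<open>lam b\<close> to \<open>r a\<close>
      bridges them, and its factors are absorbed by \<open>b\<close> and \<open>a\<close>.\<close>
    have "b \<otimes> ((S.lam b \<otimes> r a) \<otimes> a) = b \<otimes> a"
      using a b lb r[OF a] S.lam(2)[OF b] S.extend[OF S.lam(2)[OF b]] by (simp add: S.assoc)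
    then have "h (b \<otimes> a) = mid (r b) (b \<otimes> ((S.lam b \<otimes> r a) \<otimes> a)) (S.lam a)"
      using mid_eq[OF S.tri_Comp[OF r_tri[OF b] S.tri_Comp[OF g r_tri[OF a]]]] by simp
    also have "\<dots> = h b \<odot> ((F (S.lam b) \<odot> F (r a)) \<odot> h a)"
      using mid_comp[OF r_tri[OF b] S.tri_Comp[OF g r_tri[OF a]]] mid_comp[OF g r_tri[OF a]]
        mid_eps[OF lb] r[OF a] a b by (simp add: h_def)
    also have "\<dots> = h b \<odot> h a"
    proof -
      have "h b \<odot> F (S.lam b) = h b" "F (r a) \<odot> h a = h a" "h b \<in> Carrier T"
        using mid_tri[OF r_tri[OF b]] mid_tri[OF r_tri[OF a]] a b by (simp_all add: h_def T.tri_iff)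
      then show ?thesis
        using F[OF lb] F r[OF a] h_a T.extend[of "F (S.lam b)" "h b" "h b" "h a"]
        by (simp add: T.assoc)
    qed
    finally show "h (Mult S a b) = Mult T (h a) (h b)" .
  qed (simp add: h_def)
  have "induced_cc_map enc S T h = \<phi>"
  proof (rule cc_map_eqI[OF extensional_induced ext])
    fix c assume "c \<in> Obj (Cat S.ccat)"
    then show "ObjMap (induced_cc_map enc S T h) c = ObjMap \<phi> c"
      using induced_Obj[OF hom] h_F by (simp add: F_def)
  next
    fix m assume "m \<in> Arr (Cat S.ccat)"
    then obtain e u f where m: "m = enc (e, u, f)" "S.tri e u f"
      by (auto elim: S.ArrE)
    then have "e \<in> S.E" "f \<in> S.E"
      by (simp_all add: S.tri_iff)
    then show "ArrMap (induced_cc_map enc S T h) m = ArrMap \<phi> m"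
      using induced_Arr[OF hom m(2)] mid[OF m(2)] mid_eq[OF m(2)] h_F m by simp
  next
    fix d assume "d \<in> Classes S.ccat"
    then obtain e where "e \<in> S.E" "d = S.rcls e"
      by (auto simp: S.classes_eq)
    then show "ClassMap (induced_cc_map enc S T h) d = ClassMap \<phi> d"
      using induced_class[OF hom] h_F P F by (simp add: F_def)
  qed
  then show ?thesis
    using that hom by blast
qed

end

section \<open>The functor from semigroups to supported categories\<close>

definition ideal_arrow ::
  "('u \<times> 'u \<times> 'u \<Rightarrow> 'u) \<Rightarrow> ('u sgrp, 'u \<Rightarrow> 'u) arrow \<Rightarrow>
    (('u, 'u) ccat, ('u, 'u, 'u, 'u) cc_map) arrow" where
  "ideal_arrow enc m = Arrow (r_unipotent.ccat enc (Source m))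
     (induced_cc_map enc (Source m) (Target m) (Map m)) (r_unipotent.ccat enc (Target m))"

lemma ideal_functor:
  fixes enc :: "'u \<times> 'u \<times> 'u \<Rightarrow> 'u"
  assumes enc: "inj enc"
  shows "cat_functor RUS SC (r_unipotent.ccat enc) (ideal_arrow enc)"
proof (intro cat_functor.intro cat_functor_axioms.intro category_RUS category_SC)
  fix S assume "S \<in> Obj (RUS :: ('u sgrp, _) precategory)"
  then interpret S: r_unipotent enc S
    using enc by unfold_locales (simp_all add: Obj_RUS)
  interpret SS: r_unipotent_pair enc S S ..
  show "S.ccat \<in> Obj SC"
    using S.supported_ccat S.extensional_C by (simp add: Obj_SC)
  let ?id = "\<lambda>x\<in>Carrier S. x"
  have id: "?id \<in> semigroup_homs S S"
    by (simp add: semigroup_homs_def)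
  have "induced_cc_map enc S S ?id = cc_identity S.ccat"
  proof (rule cc_map_eqI[OF SS.extensional_induced])
    show "extensional_cc_map S.ccat (cc_identity S.ccat)"
      by (simp add: extensional_cc_map_def cc_identity_def)
    fix m assume "m \<in> Arr (Cat S.ccat)"
    then obtain e u f where m: "m = enc (e, u, f)" "S.tri e u f"
      by (auto elim: S.ArrE)
    then show "ArrMap (induced_cc_map enc S S ?id) m = ArrMap (cc_identity S.ccat) m"
      using SS.induced_Arr[OF id m(2)] by (simp add: cc_identity_def S.Arr_C S.tri_iff)
  qed (use SS.induced_Obj[OF id] SS.induced_class[OF id] in
    \<open>auto simp: cc_identity_def S.classes_eq\<close>)
  then show "ideal_arrow enc (Ide RUS S) = Ide SC S.ccat"
    by (simp add: ideal_arrow_def)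
next
  fix m assume "m \<in> Arr (RUS :: ('u sgrp, _) precategory)"
  then obtain S h T where m: "m = Arrow S h T" and ST: "S \<in> Obj RUS" "T \<in> Obj RUS"
      and h: "h \<in> semigroup_homs S T"
    unfolding Arr_RUS by blast
  interpret r_unipotent_pair enc S T
    using enc ST by unfold_locales (simp_all add: Obj_RUS)
  show "ideal_arrow enc m \<in> Hom SC (r_unipotent.ccat enc (Dom RUS m)) (r_unipotent.ccat enc (Cod RUS m))"
    using cc_morphism_induced[OF h] extensional_induced m S.supported_ccat S.extensional_C
      T.supported_ccat T.extensional_C by (simp add: ideal_arrow_def Hom_def Arr_SC Obj_SC)
next
  fix m n assume "m \<in> Arr (RUS :: ('u sgrp, _) precategory)" "n \<in> Arr RUS" "Cod RUS m = Dom RUS n"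
  then obtain S h T k U where m: "m = Arrow S h T" and n: "n = Arrow T k U"
      and STU: "S \<in> Obj RUS" "T \<in> Obj RUS" "U \<in> Obj RUS"
      and h: "h \<in> semigroup_homs S T" and k: "k \<in> semigroup_homs T U"
    unfolding Arr_RUS by auto
  interpret ST: r_unipotent_pair enc S T
    using enc STU by unfold_locales (simp_all add: Obj_RUS)
  interpret TU: r_unipotent_pair enc T U
    using enc STU by unfold_locales (simp_all add: Obj_RUS)
  interpret SU: r_unipotent_pair enc S U ..
  have hk: "compose (Carrier S) k h \<in> semigroup_homs S U"
    using semigroup_hom_compose[OF ST.S.S_semigroup h k] .
  have "induced_cc_map enc S U (compose (Carrier S) k h)
      = cc_compose ST.S.ccat (induced_cc_map enc S T h) (induced_cc_map enc T U k)"
  proof (rule cc_map_eqI[OF SU.extensional_induced extensional_cc_map_compose])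
    fix c assume "c \<in> Obj (Cat ST.S.ccat)"
    then show "ObjMap (induced_cc_map enc S U (compose (Carrier S) k h)) c = ObjMap
        (cc_compose ST.S.ccat (induced_cc_map enc S T h) (induced_cc_map enc T U k)) c"
      using SU.induced_Obj[OF hk] ST.induced_Obj[OF h] TU.induced_Obj[OF k] ST.hom_idempotent[OF h]
      by (simp add: cc_compose_def compose_def)
  next
    fix p assume "p \<in> Arr (Cat ST.S.ccat)"
    then obtain e u f where p: "p = enc (e, u, f)" "ST.S.tri e u f"
      by (auto elim: ST.S.ArrE)
    then show "ArrMap (induced_cc_map enc S U (compose (Carrier S) k h)) p = ArrMap
        (cc_compose ST.S.ccat (induced_cc_map enc S T h) (induced_cc_map enc T U k)) p"
      using SU.induced_Arr[OF hk p(2)] ST.induced_Arr[OF h p(2)]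
        TU.induced_Arr[OF k ST.hom_tri[OF h p(2)]]
      by (simp add: cc_compose_def compose_def ST.S.Arr_C, simp add: ST.S.tri_iff)
  next
    fix d assume "d \<in> Classes ST.S.ccat"
    then obtain e where "e \<in> ST.S.E" "d = ST.S.rcls e" "ST.S.rcls e \<in> ST.S.classes"
      by (auto simp: ST.S.classes_eq)
    then show "ClassMap (induced_cc_map enc S U (compose (Carrier S) k h)) d = ClassMap
        (cc_compose ST.S.ccat (induced_cc_map enc S T h) (induced_cc_map enc T U k)) d"
      using SU.induced_class[OF hk] ST.induced_class[OF h] TU.induced_class[OF k] ST.hom_idempotent[OF h]
      by (simp add: cc_compose_def compose_def)
  qed
  then show "ideal_arrow enc (Comp RUS m n) = Comp SC (ideal_arrow enc m) (ideal_arrow enc n)"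
    using m n by (simp add: ideal_arrow_def)
qed


section \<open>Isomorphisms of supported categories\<close>

text \<open>Functors preserve sections, and inclusions are preserved by assumption; so the
  factorisation defining the epimorphic component is carried to one of the same kind.\<close>

lemma epi_component_functor:
  assumes "normal_category C" "normal_category D" "cat_functor C D Fo Fa"
    and Incl: "\<And>j. j \<in> Incl C \<Longrightarrow> Fa j \<in> Incl D" and f: "f \<in> Hom C a b"
  shows "epi_component D (Fa f) = Fa (epi_component C f)"
proof -
  interpret C: normal_cat C by unfold_locales fact
  interpret D: normal_cat D by unfold_locales fact
  interpret F: cat_functor C D Fo Fa by fact
  obtain c j where e: "epi_component C f \<in> Hom C a c" "C.split_epi (epi_component C f)"
    and j: "j \<in> Incl C" "j \<in> Hom C c b" and fj: "f = Comp C (epi_component C f) j"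
    using C.epi_componentE[OF f] .
  obtain s where s: "s \<in> Hom C c a" "Comp C s (epi_component C f) = Ide C c"
    using C.split_epiE[OF e(2,1)] .
  have "D.split_epi (Fa (epi_component C f))"
    using D.split_epiI[OF F.maps_Hom[OF e(1)] F.maps_Hom[OF s(1)]] F.maps_Comp_Hom[OF s(1) e(1)]
      s(2) F.maps_Ide C.Hom_Obj[OF e(1)] by simp
  then show ?thesis
    using D.epi_component_eq[OF _ F.maps_Hom[OF e(1)] Incl[OF j(1)] F.maps_Hom[OF j(2)]]
      F.maps_Comp_Hom[OF e(1) j(2)] fj by simp
qed

text \<open>
  A functor that is surjective on objects determines the action on classes: since \<open>R\<close>-comparison of
  idempotent cones is an identity between components, it is inherited by the image cones.
\<close>

lemma cc_morphism_of_functor: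
  assumes sup: "supported_category X" "supported_category Y"
    and F: "cat_functor (Cat X) (Cat Y) Fo Fa" and Incl: "\<And>j. j \<in> Incl (Cat X) \<Longrightarrow> Fa j \<in> Incl (Cat Y)"
    and surj: "Fo ` Obj (Cat X) = Obj (Cat Y)"
    and eps: "\<And>c x. \<lbrakk>c \<in> Obj (Cat X); x \<in> Obj (Cat X)\<rbrakk>
      \<Longrightarrow> Fa (support_cone X c x) = support_cone Y (Fo c) (Fo x)"
  obtains \<phi> where "cc_morphism X Y \<phi>" "extensional_cc_map X \<phi>"
    "\<And>c. c \<in> Obj (Cat X) \<Longrightarrow> ObjMap \<phi> c = Fo c" "\<And>f. f \<in> Arr (Cat X) \<Longrightarrow> ArrMap \<phi> f = Fa f"
    "\<And>c. c \<in> Obj (Cat X) \<Longrightarrow> ClassMap \<phi> (support_class X c) = support_class Y (Fo c)"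
proof -
  interpret X: supported X by unfold_locales fact
  interpret Y: supported Y by unfold_locales fact
  interpret F: cat_functor "Cat X" "Cat Y" Fo Fa by fact
  have below: "class_below (Cat Y) (support_class Y (Fo a)) (support_class Y (Fo b))"
    if ab: "a \<in> Obj (Cat X)" "b \<in> Obj (Cat X)"
      and le: "class_below (Cat X) (support_class X a) (support_class X b)" for a b
  proof -
    let ?e = "epi_component (Cat X) (support_cone X a b)"
    let ?e' = "epi_component (Cat Y) (support_cone Y (Fo a) (Fo b))"
    have e: "?e \<in> Hom (Cat X) b (Cod (Cat X) ?e)"
      using X.epi_component_in_Hom(1)[OF X.eps_Hom[OF ab]] .
    have Fe: "Fa ?e = ?e'"
      using epi_component_functor[OF X.normal Y.normal F Incl X.eps_Hom[OF ab]] eps[OF ab] by simp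
    have le': "support_cone X a = cone_star (Cat X) (support_cone X b) ?e"
      using le X.cls_below_iff[OF ab] by simp
    have "support_cone Y (Fo a) y = Comp (Cat Y) (support_cone Y (Fo b) y) ?e'"
      if y: "y \<in> Obj (Cat Y)" for y
    proof -
      obtain x where x: "x \<in> Obj (Cat X)" "y = Fo x"
        using y surj by (metis imageE)
      have "support_cone X a x = Comp (Cat X) (support_cone X b x) ?e"
        using fun_cong[OF le', of x] X.star_apply[OF x(1)] by simp
      then show ?thesis
        using F.maps_Comp_Hom[OF X.eps_Hom[OF ab(2) x(1)] e] eps[OF ab(1) x(1)] eps[OF ab(2) x(1)]
          x(2) Fe by simp
    qed
    moreover have "support_cone Y (Fo a) \<in> extensional (Obj (Cat Y))"
      using Y.cone_extensional[OF Y.eps(1)[OF F.maps_Obj[OF ab(1)]]] .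
    ultimately have "support_cone Y (Fo a) = cone_star (Cat Y) (support_cone Y (Fo b)) ?e'"
      by (auto simp: cone_star_def extensional_def fun_eq_iff)
    then show ?thesis
      using Y.cls_below_iff F.maps_Obj ab by simp
  qed
  have cong: "support_class Y (Fo a) = support_class Y (Fo b)"
    if ab: "a \<in> Obj (Cat X)" "b \<in> Obj (Cat X)" and eq: "support_class X a = support_class X b" for a b
  proof -
    have refl: "class_below (Cat X) (support_class X a) (support_class X a)"
      using X.eps(3)[OF ab(1)] by (auto simp: R_below_def)
    have Fab: "Fo a \<in> Obj (Cat Y)" "Fo b \<in> Obj (Cat Y)"
      using F.maps_Obj ab by simp_all
    have "class_below (Cat Y) (support_class Y (Fo a)) (support_class Y (Fo b))"
        "class_below (Cat Y) (support_class Y (Fo b)) (support_class Y (Fo a))"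
      using below[OF ab] below[OF ab(2,1)] refl eq by simp_all
    note this[unfolded Y.eps(4)[OF Fab(1)] Y.eps(4)[OF Fab(2)]]
    moreover note cones = Y.cone_in_cones[OF Y.eps(1)[OF Fab(1)]] Y.cone_in_cones[OF Y.eps(1)[OF Fab(2)]]
    ultimately have "(support_cone Y (Fo a), support_cone Y (Fo b)) \<in> green_R (cone_semigroup (Cat Y))"
      using green_R_iff[OF Y.cone_semigroup cones] R_below_classes_iff[OF Y.cone_semigroup cones]
        R_below_classes_iff[OF Y.cone_semigroup cones(2,1)] by simp
    then show ?thesis
      using Y.eps(4)[OF Fab(1)] Y.eps(4)[OF Fab(2)] equiv_class_eq[OF equiv_green_R] by metis
  qed
  define \<phi> :: "('a, 'b, 'c, 'd) cc_map" where
    "\<phi> = \<lparr>ObjMap = restrict Fo (Obj (Cat X)), ArrMap = restrict Fa (Arr (Cat X)),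
      ClassMap = (\<lambda>d\<in>Classes X. support_class Y (Fo (SOME c. c \<in> Obj (Cat X) \<and> support_class X c = d)))\<rparr>"
  have Obj: "ObjMap \<phi> c = Fo c" if "c \<in> Obj (Cat X)" for c
    using that by (simp add: \<phi>_def)
  have Arr: "ArrMap \<phi> f = Fa f" if "f \<in> Arr (Cat X)" for f
    using that by (simp add: \<phi>_def)
  have Class: "ClassMap \<phi> (support_class X c) = support_class Y (Fo c)" if c: "c \<in> Obj (Cat X)" for c
  proof -
    define b where "b = (SOME b. b \<in> Obj (Cat X) \<and> support_class X b = support_class X c)"
    have "b \<in> Obj (Cat X) \<and> support_class X b = support_class X c"
      unfolding b_def by (rule someI[of _ c]) (use c in simp)
    then show ?thesis
      using cong[of b c] c X.cls[OF c] by (simp add: \<phi>_def b_def[symmetric])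
  qed
  have ext: "extensional_cc_map X \<phi>"
    by (simp add: extensional_cc_map_def \<phi>_def)
  have "cat_functor (Cat X) (Cat Y) (ObjMap \<phi>) (ArrMap \<phi>)"
    by (rule cat_functor_cong[OF F]) (simp_all add: Obj Arr)
  then have "cc_morphism X Y \<phi>"
    unfolding cc_morphism_iff[OF sup]
    using Incl X.Incl_Arr below eps HomD(1)[OF X.eps_Hom] by (simp add: Obj Arr Class)
  then show ?thesis
    using that ext Obj Arr Class by blast
qed

lemma inverse_functor:
  assumes F: "cat_functor C D Fo Fa" and Fo: "bij_betw Fo (Obj C) (Obj D)"
    and Fa: "bij_betw Fa (Arr C) (Arr D)"
  shows "cat_functor D C (inv_into (Obj C) Fo) (inv_into (Arr C) Fa)"
proof -
  interpret F: cat_functor C D Fo Fa by fact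
  let ?Go = "inv_into (Obj C) Fo" and ?Ga = "inv_into (Arr C) Fa"
  have Go: "?Go b \<in> Obj C" "Fo (?Go b) = b" if "b \<in> Obj D" for b
    using that Fo by (auto simp: bij_betw_def inv_into_into f_inv_into_f)
  have Ga: "?Ga g \<in> Arr C" "Fa (?Ga g) = g" if "g \<in> Arr D" for g
    using that Fa by (auto simp: bij_betw_def inv_into_into f_inv_into_f)
  have GF: "?Go (Fo a) = a" if "a \<in> Obj C" for a
    using that Fo by (simp add: bij_betw_def)
  have GaFa: "?Ga (Fa f) = f" if "f \<in> Arr C" for f
    using that Fa by (simp add: bij_betw_def)
  have DC: "Dom C (?Ga g) = ?Go (Dom D g)" "Cod C (?Ga g) = ?Go (Cod D g)" if g: "g \<in> Arr D" for g
  proof -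
    have "g \<in> Hom D (Fo (Dom C (?Ga g))) (Fo (Cod C (?Ga g)))"
      using F.maps_Arr[OF Ga(1)[OF g]] Ga(2)[OF g] by simp
    then show "Dom C (?Ga g) = ?Go (Dom D g)" "Cod C (?Ga g) = ?Go (Cod D g)"
      using GF[OF F.source.Dom_closed[OF Ga(1)[OF g]]] GF[OF F.source.Cod_closed[OF Ga(1)[OF g]]]
      by (simp_all add: Hom_def)
  qed
  show ?thesis
  proof unfold_locales
    fix b assume b: "b \<in> Obj D"
    show "?Go b \<in> Obj C"
      using Go b by simp
    show "?Ga (Ide D b) = Ide C (?Go b)"
      using GaFa[OF F.source.Ide_closed[OF Go(1)[OF b]]] F.maps_Ide[OF Go(1)[OF b]] Go(2)[OF b] by simp
  next
    fix g assume g: "g \<in> Arr D"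
    show "?Ga g \<in> Hom C (?Go (Dom D g)) (?Go (Cod D g))"
      using Ga(1)[OF g] DC[OF g] by (simp add: Hom_def)
  next
    fix f g assume fg: "f \<in> Arr D" "g \<in> Arr D" "Cod D f = Dom D g"
    then have "Comp C (?Ga f) (?Ga g) \<in> Arr C"
        "Fa (Comp C (?Ga f) (?Ga g)) = Comp D f g"
      using F.source.Comp_closed F.maps_Comp Ga DC by simp_all
    then show "?Ga (Comp D f g) = Comp C (?Ga f) (?Ga g)"
      using GaFa by metis
  qed
qed

text \<open>Inclusions must be reflected as well as preserved, so that the inverse functor preserves
  them. Both CC-morphisms then come from \<open>cc_morphism_of_functor\<close>. The arrow is taken
  from \<open>Y\<close> to \<open>X\<close> to suit essential surjectivity.\<close>

lemma isomorphism_of_bijective_functor: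
  assumes X: "X \<in> Obj SC" and Y: "Y \<in> Obj SC"
    and F: "cat_functor (Cat X) (Cat Y) Fo Fa"
    and Fo: "bij_betw Fo (Obj (Cat X)) (Obj (Cat Y))" and Fa: "bij_betw Fa (Arr (Cat X)) (Arr (Cat Y))"
    and Incl: "\<And>j. j \<in> Arr (Cat X) \<Longrightarrow> Fa j \<in> Incl (Cat Y) \<longleftrightarrow> j \<in> Incl (Cat X)"
    and eps: "\<And>c x. \<lbrakk>c \<in> Obj (Cat X); x \<in> Obj (Cat X)\<rbrakk>
      \<Longrightarrow> Fa (support_cone X c x) = support_cone Y (Fo c) (Fo x)"
  shows "\<exists>t\<in>Hom SC Y X. isomorphism SC t"
proof -
  have sup: "supported_category X" "supported_category Y"
    using X Y by (simp_all add: Obj_SC)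
  interpret X: supported X by unfold_locales fact
  interpret Y: supported Y by unfold_locales fact
  interpret F: cat_functor "Cat X" "Cat Y" Fo Fa by fact
  let ?Go = "inv_into (Obj (Cat X)) Fo" and ?Ga = "inv_into (Arr (Cat X)) Fa"
  have G: "cat_functor (Cat Y) (Cat X) ?Go ?Ga"
    using inverse_functor[OF F Fo Fa] .
  have Go: "?Go b \<in> Obj (Cat X)" "Fo (?Go b) = b" if "b \<in> Obj (Cat Y)" for b
    using that Fo by (auto simp: bij_betw_def inv_into_into f_inv_into_f)
  have Ga: "?Ga g \<in> Arr (Cat X)" "Fa (?Ga g) = g" if "g \<in> Arr (Cat Y)" for g
    using that Fa by (auto simp: bij_betw_def inv_into_into f_inv_into_f)
  have GoFo: "?Go (Fo c) = c" if "c \<in> Obj (Cat X)" for c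
    using that Fo by (simp add: bij_betw_def)
  have GaFa: "?Ga (Fa f) = f" if "f \<in> Arr (Cat X)" for f
    using that Fa by (simp add: bij_betw_def)
  obtain \<phi> where \<phi>: "cc_morphism X Y \<phi>" "extensional_cc_map X \<phi>"
    "\<And>c. c \<in> Obj (Cat X) \<Longrightarrow> ObjMap \<phi> c = Fo c" "\<And>f. f \<in> Arr (Cat X) \<Longrightarrow> ArrMap \<phi> f = Fa f"
    "\<And>c. c \<in> Obj (Cat X) \<Longrightarrow> ClassMap \<phi> (support_class X c) = support_class Y (Fo c)"
  proof (rule cc_morphism_of_functor[OF sup F])
    show "Fo ` Obj (Cat X) = Obj (Cat Y)"
      using Fo by (simp add: bij_betw_def)
  qed (use Incl X.Incl_Arr eps in auto)
  obtain \<psi> where \<psi>: "cc_morphism Y X \<psi>" "extensional_cc_map Y \<psi>"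
    "\<And>c. c \<in> Obj (Cat Y) \<Longrightarrow> ObjMap \<psi> c = ?Go c" "\<And>f. f \<in> Arr (Cat Y) \<Longrightarrow> ArrMap \<psi> f = ?Ga f"
    "\<And>c. c \<in> Obj (Cat Y) \<Longrightarrow> ClassMap \<psi> (support_class Y c) = support_class X (?Go c)"
  proof (rule cc_morphism_of_functor[OF sup(2,1) G])
    show "?Ga j \<in> Incl (Cat X)" if j: "j \<in> Incl (Cat Y)" for j
      using Incl[of "?Ga j"] Ga[OF Y.Incl_Arr[OF j]] j by simp
    show "?Go ` Obj (Cat Y) = Obj (Cat X)"
      using bij_betw_inv_into[OF Fo] by (simp add: bij_betw_def)
    fix c x assume cx: "c \<in> Obj (Cat Y)" "x \<in> Obj (Cat Y)"
    have "Fa (support_cone X (?Go c) (?Go x)) = support_cone Y c x"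
      using eps[of "?Go c" "?Go x"] Go cx by simp
    then show "?Ga (support_cone Y c x) = support_cone X (?Go c) (?Go x)"
      using GaFa[OF HomD(1)[OF X.eps_Hom[OF Go(1)[OF cx(1)] Go(1)[OF cx(2)]]]] by simp
  qed blast
  have maps: "Fa f \<in> Arr (Cat Y)" if "f \<in> Arr (Cat X)" for f
    using HomD(1)[OF F.maps_Arr[OF that]] .
  have "cc_compose X \<phi> \<psi> = cc_identity X"
  proof (rule cc_map_eqI[OF extensional_cc_map_compose])
    show "extensional_cc_map X (cc_identity X)"
      by (simp add: extensional_cc_map_def cc_identity_def)
    fix d assume "d \<in> Classes X"
    then obtain c where "c \<in> Obj (Cat X)" "d = support_class X c" "support_class X c \<in> Classes X"
      by (auto simp: X.Classes_eq)
    then show "ClassMap (cc_compose X \<phi> \<psi>) d = ClassMap (cc_identity X) d"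
      using \<phi> \<psi> F.maps_Obj GoFo by (simp add: cc_compose_def cc_identity_def compose_def)
  qed (use \<phi> \<psi> F.maps_Obj maps GoFo GaFa in
    \<open>simp_all add: cc_compose_def cc_identity_def compose_def\<close>)
  moreover have "cc_compose Y \<psi> \<phi> = cc_identity Y"
  proof (rule cc_map_eqI[OF extensional_cc_map_compose])
    show "extensional_cc_map Y (cc_identity Y)"
      by (simp add: extensional_cc_map_def cc_identity_def)
    fix d assume "d \<in> Classes Y"
    then obtain c where "c \<in> Obj (Cat Y)" "d = support_class Y c" "support_class Y c \<in> Classes Y"
      by (auto simp: Y.Classes_eq)
    then show "ClassMap (cc_compose Y \<psi> \<phi>) d = ClassMap (cc_identity Y) d"
      using \<phi> \<psi> Go by (simp add: cc_compose_def cc_identity_def compose_def)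
  qed (use \<phi> \<psi> Go Ga in \<open>simp_all add: cc_compose_def cc_identity_def compose_def\<close>)
  moreover have "Arrow Y \<psi> X \<in> Hom SC Y X" "Arrow X \<phi> Y \<in> Hom SC X Y"
    using X Y \<phi> \<psi> by (simp_all add: Hom_def Arr_SC)
  ultimately show ?thesis
    using category.isomorphismI[OF category_SC, of "Arrow Y \<psi> X" Y X "Arrow X \<phi> Y"] by auto
qed


section \<open>The connection semigroup\<close>

context supported
begin

definition T :: "('o \<Rightarrow> 'm) set" where
  "T = \<Union> (Classes X)"

lemma T_cone:
  assumes "\<gamma> \<in> T"
  obtains z where "is_cone C z \<gamma>"
proof -
  have "\<gamma> \<in> cones"
    using assms Classes_classes in_quotient_imp_subset[OF equiv_green_R]
    unfolding T_def cone_classes_def by blast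
  then show ?thesis
    using that by (auto simp: cones_iff)
qed

lemma eps_T: "c \<in> Obj C \<Longrightarrow> eps c \<in> T"
  using eps(3) cls by (auto simp: T_def)

text \<open>The class of \<open>\<gamma> \<odot> \<delta>\<close> lies below that of
  \<open>\<gamma>\<close>. Being a down-set is thus exactly what makes the union of the classes a
  right ideal of cones.\<close>

lemma mult_T:
  assumes \<gamma>: "\<gamma> \<in> T" and \<delta>: "\<delta> \<in> cones"
  shows "\<gamma> \<odot> \<delta> \<in> T"
proof -
  obtain d where d: "d \<in> Classes X" "\<gamma> \<in> d"
    using \<gamma> by (auto simp: T_def)
  obtain z w where cones: "is_cone C z \<gamma>" "is_cone C w \<delta>"
    using T_cone[OF \<gamma>] \<delta> cones_iff by metis
  note \<gamma>' = cone_in_cones[OF cones(1)] and \<gamma>\<delta> = cone_in_cones[OF mult_cone[OF cones]]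
  obtain \<beta> where \<beta>: "d = green_R (cone_semigroup C) `` {\<beta>}"
    using d Classes_classes by (auto simp: cone_classes_def elim: quotientE)
  then have "d = green_R (cone_semigroup C) `` {\<gamma>}"
    using d(2) equiv_class_eq[OF equiv_green_R] by (metis Image_singleton_iff)
  moreover have "\<gamma> \<odot> \<delta> \<in> principal_right_ideal (cone_semigroup C) \<gamma>"
    using \<delta> by (auto simp: principal_right_ideal_def)
  ultimately have "class_below C (green_R (cone_semigroup C) `` {\<gamma> \<odot> \<delta>}) d"
    using R_below_classes_iff[OF cone_semigroup \<gamma>\<delta> \<gamma>'] by simp
  moreover have "green_R (cone_semigroup C) `` {\<gamma> \<odot> \<delta>} \<in> cone_classes C"
    unfolding cone_classes_def by (rule quotientI[OF \<gamma>\<delta>])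
  ultimately have "green_R (cone_semigroup C) `` {\<gamma> \<odot> \<delta>} \<in> Classes X"
    using Classes_down[OF d(1)] by blast
  moreover have "\<gamma> \<odot> \<delta> \<in> green_R (cone_semigroup C) `` {\<gamma> \<odot> \<delta>}"
    using equiv_class_self[OF equiv_green_R \<gamma>\<delta>] .
  ultimately show ?thesis
    by (auto simp: T_def)
qed

lemma star_eps:
  assumes e: "split_epi e" "e \<in> Hom C c z"
  shows "is_cone C z (eps c \<star> e)" "(eps c \<star> e) c = e" "eps c \<star> e \<in> T"
proof -
  have c: "c \<in> Obj C"
    using Hom_Obj[OF e(2)] by simp
  show cone: "is_cone C z (eps c \<star> e)"
    using star_cone[OF eps(1)[OF c] e] .
  show at_c: "(eps c \<star> e) c = e"
    using star_apply[OF c] eps(2)[OF c] Hom_Ide_left[OF e(2)] by simp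
  \<comment> \<open>The cone is a right multiple of \<open>eps c\<close>, hence lies in the right
    ideal \<open>T\<close>.\<close>
  have "eps c \<odot> (eps c \<star> e) = eps c \<star> e"
    using mult_eq[OF eps(1)[OF c]] at_c epi_component_split_epi[OF e(1)] by simp
  then show "eps c \<star> e \<in> T"
    using mult_T[OF eps_T[OF c] cone_in_cones[OF cone]] by simp
qed

text \<open>By the equation, the vertex of \<open>\<gamma>\<close> is the image of
  \<open>\<gamma> c\<close>. The inclusion part of \<open>\<gamma> c\<close> is then an inclusion of
  an object in itself and disappears.\<close>

lemma component_split_epi:
  assumes "c \<in> Obj C" "is_cone C z \<gamma>" "\<gamma> = eps c \<star> (\<gamma> c)\<degree>"
  shows "split_epi (\<gamma> c)" "\<gamma> c \<in> Hom C c z" "\<gamma> = eps c \<star> \<gamma> c"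
proof -
  show \<gamma>c: "\<gamma> c \<in> Hom C c z"
    using cone_Hom assms by blast
  obtain y j where e: "(\<gamma> c)\<degree> \<in> Hom C c y" "split_epi (\<gamma> c)\<degree>"
    and j: "j \<in> Incl C" "j \<in> Hom C y z" "\<gamma> c = (\<gamma> c)\<degree> \<cdot> j"
    using epi_componentE[OF \<gamma>c] .
  have "y = z"
    using cone_vertex_unique[OF star_eps(1)[OF e(2,1)]] assms by simp
  then have "j \<in> Hom C y y"
    using j(2) by simp
  then have "j = Ide C y"
    using Incl_unique[OF j(1) Ide_Incl _ Ide_in_Hom] Hom_Obj[OF e(1)] by simp
  then have "\<gamma> c = (\<gamma> c)\<degree>"
    using j(3) Hom_Ide_right[OF e(1)] by simp
  then show "split_epi (\<gamma> c)" "\<gamma> = eps c \<star> \<gamma> c"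
    using e(2) assms(3) by simp_all
qed

text \<open>Take \<open>c\<close> with \<open>eps c\<close> \<open>R\<close>-related to
  \<open>\<gamma>\<close>. That \<open>\<gamma>\<close> is below \<open>eps c\<close> gives the
  equation and a section of \<open>\<gamma> c\<close>; that \<open>eps c\<close> is below
  \<open>\<gamma>\<close> gives an inverse on the other side.\<close>

lemma T_representation:
  assumes \<gamma>: "\<gamma> \<in> T" and cone: "is_cone C z \<gamma>"
  obtains c where "c \<in> Obj C" "\<gamma> c \<in> Hom C c z" "isomorphism C (\<gamma> c)" "\<gamma> = eps c \<star> \<gamma> c"
proof -
  obtain c where c: "c \<in> Obj C" and R: "(eps c, \<gamma>) \<in> green_R (cone_semigroup C)"
    using \<gamma> class_representative unfolding T_def by blast
  note ideals = R[unfolded green_R_iff[OF cone_semigroup cone_in_cones[OF eps(1)[OF c]] cone_in_cones[OF cone]]]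
  then have "\<gamma> = eps c \<star> (\<gamma> c)\<degree>"
    using idempotent_cone_mem_ideal_iff[OF eps(1,2)[OF c] cone] by simp
  then have w: "split_epi (\<gamma> c)" "\<gamma> c \<in> Hom C c z" "\<gamma> = eps c \<star> \<gamma> c"
    using component_split_epi[OF c cone] by simp_all
  obtain s where s: "s \<in> Hom C z c" "s \<cdot> \<gamma> c = Ide C z"
    using split_epiE[OF w(1,2)] .
  consider "eps c = \<gamma>" | \<delta> where "\<delta> \<in> cones" "eps c = \<gamma> \<odot> \<delta>"
    using ideals by (auto simp: principal_right_ideal_def)
  then have "isomorphism C (\<gamma> c)"
  proof cases
    case 1
    then show ?thesis
      using eps(2)[OF c] isomorphism_Ide[OF c] by simp
  next
    case 2
    then obtain v where \<delta>: "is_cone C v \<delta>"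
      by (auto simp: cones_iff)
    let ?t = "(\<delta> z)\<degree>"
    have "?t \<in> Hom C z (Cod C ?t)"
      using epi_component_in_Hom(1)[OF cone_Hom[OF \<delta>]] Hom_Obj[OF w(2)] by blast
    moreover have "Cod C ?t = c"
      using cone_vertex_unique[OF mult_cone[OF cone \<delta>]] eps(1)[OF c] 2 by simp
    ultimately have t: "?t \<in> Hom C z c"
      by simp
    have "\<gamma> c \<cdot> ?t = (\<gamma> \<odot> \<delta>) c"
      using mult_eq[OF cone] star_apply[OF c] by simp
    also have "\<dots> = Ide C c"
      using 2 eps(2)[OF c] by simp
    finally show ?thesis
      using isomorphism_if_left_right_inverse[OF w(2) s(1) t s(2)] by simp
  qed
  then show ?thesis
    using that c w by blast
qed

lemma T_regular:
  assumes "\<gamma> \<in> T"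
  obtains \<delta> where "\<delta> \<in> T" "(\<gamma> \<odot> \<delta>) \<odot> \<gamma> = \<gamma>"
proof -
  obtain z where cone: "is_cone C z \<gamma>"
    using T_cone[OF assms] .
  obtain c where c: "c \<in> Obj C" "\<gamma> c \<in> Hom C c z" "isomorphism C (\<gamma> c)" "\<gamma> = eps c \<star> \<gamma> c"
    using T_representation[OF assms cone] .
  obtain v where v: "v \<in> Hom C z c" "\<gamma> c \<cdot> v = Ide C c" "v \<cdot> \<gamma> c = Ide C z"
    using isomorphismE[OF c(3,2)] .
  have split: "split_epi v" "split_epi (\<gamma> c)"
    using split_epiI[OF v(1) c(2) v(2)] split_epiI[OF c(2) v(1,3)] by simp_all
  \<comment> \<open>Multiplying \<open>\<gamma>\<close> by this cone composes it with the inverse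
    \<open>v\<close> of \<open>\<gamma> c\<close> and returns \<open>eps c\<close>, a left identity
    for \<open>\<gamma>\<close>.\<close>
  let ?\<delta> = "eps z \<star> v"
  have "\<gamma> \<odot> ?\<delta> = (eps c \<star> \<gamma> c) \<star> v"
    using mult_eq[OF cone, of ?\<delta>] star_eps(2)[OF split(1) v(1)] epi_component_split_epi[OF split(1)] c(4)
    by metis
  also have "\<dots> = eps c"
    using star_star[OF eps(1)[OF c(1)] c(2) v(1)] v(2) star_Ide[OF eps(1)[OF c(1)]] by simp
  finally have "(\<gamma> \<odot> ?\<delta>) \<odot> \<gamma> = eps c \<star> (\<gamma> c)\<degree>"
    using mult_eq[OF eps(1)[OF c(1)]] by simp
  also have "\<dots> = \<gamma>"
    using epi_component_split_epi[OF split(2)] c(4) by simp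
  finally show ?thesis
    using that star_eps(3)[OF split(1) v(1)] by blast
qed

lemma T_idempotent_iff:
  assumes \<gamma>: "\<gamma> \<in> T"
  shows "\<gamma> \<odot> \<gamma> = \<gamma> \<longleftrightarrow> (\<exists>c\<in>Obj C. \<gamma> = eps c)"
proof -
  obtain z where cone: "is_cone C z \<gamma>"
    using T_cone[OF \<gamma>] .
  obtain d where d: "d \<in> Classes X" "\<gamma> \<in> d"
    using \<gamma> by (auto simp: T_def)
  show ?thesis
  proof
    assume "\<gamma> \<odot> \<gamma> = \<gamma>"
    then have "\<gamma> z = Ide C z"
      using idempotent_cone_iff[OF cone] cone_in_cones[OF cone] by (simp add: idempotents_def)
    then show "\<exists>c\<in>Obj C. \<gamma> = eps c"
      using idempotent_in_class(2)[OF d cone] cone by (auto simp: is_cone_def)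
  next
    assume "\<exists>c\<in>Obj C. \<gamma> = eps c"
    then obtain c where "c \<in> Obj C" "\<gamma> = eps c"
      by blast
    then show "\<gamma> \<odot> \<gamma> = \<gamma>"
      using idempotent_cone_iff[OF eps(1)] eps(2) by (simp add: idempotents_def)
  qed
qed

text \<open>Right multiplication by \<open>eps b\<close> composes with
  \<open>(eps b a)\<degree>\<close>. The section of \<open>w\<close> allows cancellation, so the
  product is unchanged only if that component is an identity, that is, if \<open>eps b a\<close> is
  an inclusion.\<close>

lemma eps_mult_eps_iff:
  assumes a: "is_cone C a \<gamma>" "split_epi w" "w \<in> Hom C c a" "\<gamma> = eps c \<star> w" and b: "b \<in> Obj C"
  shows "\<gamma> \<odot> eps b = \<gamma> \<longleftrightarrow> eps b a \<in> Incl C"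
proof -
  have ac: "a \<in> Obj C" "c \<in> Obj C"
    using Hom_Obj[OF a(3)] by simp_all
  note eba = eps_Hom[OF b ac(1)] and eba' = epi_component_in_Hom(1)[OF eps_Hom[OF b ac(1)]]
  obtain s where s: "s \<in> Hom C a c" "s \<cdot> w = Ide C a"
    using split_epiE[OF a(2,3)] .
  have \<gamma>c: "\<gamma> c = w"
    using star_eps(2)[OF a(2,3)] a(4) by simp
  show ?thesis
  proof
    assume "\<gamma> \<odot> eps b = \<gamma>"
    then have "w \<cdot> (eps b a)\<degree> = w"
      using mult_eq[OF a(1), of "eps b"] star_apply[OF ac(2)] \<gamma>c by metis
    then have "(eps b a)\<degree> = Ide C a"
      using Hom_assoc[OF s(1) a(3) eba'] s(2) Hom_Ide_left[OF eba'] by simp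
    then show "eps b a \<in> Incl C"
      using Incl_if_epi_component_Ide[OF eba] by simp
  next
    assume "eps b a \<in> Incl C"
    then have "(eps b a)\<degree> = Ide C a"
      using epi_component_Incl HomD(2)[OF eba] by simp
    then show "\<gamma> \<odot> eps b = \<gamma>"
      using mult_eq[OF a(1)] star_Ide[OF a(1)] by simp
  qed
qed

text \<open>The unipotency of the connection semigroup: \<open>L\<close>-related idempotent cones
  have vertices included in each other.\<close>

lemma eps_antisym:
  assumes "a \<in> Obj C" "b \<in> Obj C" "eps a \<odot> eps b = eps a" "eps b \<odot> eps a = eps b"
  shows "a = b"
proof -
  have Incl: "eps b a \<in> Incl C" if "a \<in> Obj C" "b \<in> Obj C" "eps a \<odot> eps b = eps a" for a b
    using eps_mult_eps_iff[OF eps(1) split_epi_isomorphism[OF isomorphism_Ide] Ide_in_Hom] that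
      star_Ide[OF eps(1)] by simp
  show ?thesis
    using Incl_antisym(1)[OF Incl[OF assms(1-3)] Incl[OF assms(2,1,4)]
        eps_Hom[OF assms(2,1)] eps_Hom[OF assms(1,2)]] .
qed

lemma eps_star_Incl:
  assumes "j \<in> Incl C" "j \<in> Hom C a b"
  shows "eps b a = j"
  using cone_natural[OF eps(1)[OF Hom_Obj(2)[OF assms(2)]] assms] eps(2)[OF Hom_Obj(2)[OF assms(2)]]
    Hom_Ide_right[OF assms(2)] by simp

text \<open>The source of functoriality. The first factor ends at the image of \<open>u\<close>,
  where the component of \<open>eps b\<close> is the inclusion \<open>j\<close> in \<open>b\<close>.
  So the product composes \<open>u\<degree>\<close> with \<open>(j \<cdot> v)\<degree>\<close> and
  restores the lost inclusion.\<close>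

lemma eps_star_mult:
  assumes u: "u \<in> Hom C a b" and v: "v \<in> Hom C b c"
  shows "(eps a \<star> u\<degree>) \<odot> (eps b \<star> v\<degree>) = eps a \<star> (u \<cdot> v)\<degree>"
proof -
  have abc: "a \<in> Obj C" "b \<in> Obj C" "c \<in> Obj C"
    using Hom_Obj[OF u] Hom_Obj[OF v] by simp_all
  obtain z j where e: "u\<degree> \<in> Hom C a z" "split_epi u\<degree>" and j: "j \<in> Incl C" "j \<in> Hom C z b"
    and uj: "u = u\<degree> \<cdot> j"
    using epi_componentE[OF u] .
  have z: "z \<in> Obj C"
    using Hom_Obj[OF j(2)] by simp
  note vo = epi_component_in_Hom[OF v]
  note jv = Comp_in_Hom[OF j(2) v]
  have "(eps b \<star> v\<degree>) z = j \<cdot> v\<degree>"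
    using star_apply[OF z] eps_star_Incl[OF j] by simp
  then have "(eps a \<star> u\<degree>) \<odot> (eps b \<star> v\<degree>) = (eps a \<star> u\<degree>) \<star> (j \<cdot> v)\<degree>"
    using mult_eq[OF star_eps(1)[OF e(2,1)]] epi_component_Comp_epi_component[OF j(2) v] by simp
  also have "\<dots> = eps a \<star> (u\<degree> \<cdot> (j \<cdot> v)\<degree>)"
    using star_star[OF eps(1)[OF abc(1)] e(1) epi_component_in_Hom(1)[OF jv]] .
  also have "u\<degree> \<cdot> (j \<cdot> v)\<degree> = (u\<degree> \<cdot> (j \<cdot> v))\<degree>"
    using epi_component_split_epi_Comp[OF e(2,1) jv] by simp
  also have "u\<degree> \<cdot> (j \<cdot> v) = u \<cdot> v"
    using Hom_assoc[OF e(1) j(2) v] uj by simp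
  finally show ?thesis .
qed

text \<open>The component of \<open>\<gamma>\<close> at an object whose idempotent cone is \<open>R\<close>-related to \<open>\<gamma>\<close> determines \<open>\<gamma>\<close>.\<close>

lemma T_embedding: "\<exists>\<iota> :: ('o \<Rightarrow> 'm) \<Rightarrow> 'm. inj_on \<iota> T"
proof -
  have "\<forall>\<gamma>\<in>T. \<exists>c\<in>Obj C. \<exists>z. \<gamma> c \<in> Hom C c z \<and> \<gamma> = eps c \<star> \<gamma> c"
  proof
    fix \<gamma> assume \<gamma>: "\<gamma> \<in> T"
    then obtain z where cone: "is_cone C z \<gamma>"
      using T_cone by blast
    show "\<exists>c\<in>Obj C. \<exists>z. \<gamma> c \<in> Hom C c z \<and> \<gamma> = eps c \<star> \<gamma> c"
      using T_representation[OF \<gamma> cone] by blast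
  qed
  then obtain r where r: "\<And>\<gamma>. \<gamma> \<in> T \<Longrightarrow> (\<exists>z. \<gamma> (r \<gamma>) \<in> Hom C (r \<gamma>) z) \<and> \<gamma> = eps (r \<gamma>) \<star> \<gamma> (r \<gamma>)"
    by metis
  have "inj_on (\<lambda>\<gamma>. \<gamma> (r \<gamma>)) T"
  proof (rule inj_onI)
    fix \<gamma> \<delta> assume \<gamma>: "\<gamma> \<in> T" and \<delta>: "\<delta> \<in> T" and eq: "\<gamma> (r \<gamma>) = \<delta> (r \<delta>)"
    then have "r \<gamma> = r \<delta>"
      using r[OF \<gamma>] r[OF \<delta>] by (auto simp: Hom_def)
    then show "\<gamma> = \<delta>"
      using r[OF \<gamma>] r[OF \<delta>] eq by metis
  qed
  then show ?thesis by blast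
qed

end

locale connection = supported X
  for X :: "('u, 'u) ccat" +
  fixes enc :: "'u \<times> 'u \<times> 'u \<Rightarrow> 'u" and \<iota> :: "('u \<Rightarrow> 'u) \<Rightarrow> 'u"
  assumes inj_enc: "inj enc" and inj_\<iota>: "inj_on \<iota> T"
begin

notation comp (infixl "\<cdot>" 70) and epi ("_\<degree>" [1000] 1000)
  and star (infixl "\<star>" 70) and mult (infixl "\<odot>" 70)

text \<open>The multiplication is reversed, as supported categories yield semigroups with a unique
  idempotent in each \<open>L\<close>-class.\<close>

definition S :: "'u sgrp" where
  "S = \<lparr>Carrier = \<iota> ` T,
     Mult = (\<lambda>a b. if a \<in> \<iota> ` T \<and> b \<in> \<iota> ` T then \<iota> (inv_into T \<iota> b \<odot> inv_into T \<iota> a) else undefined)\<rparr>"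

lemma \<iota>_eq [simp]: "\<lbrakk>\<gamma> \<in> T; \<delta> \<in> T\<rbrakk> \<Longrightarrow> \<iota> \<gamma> = \<iota> \<delta> \<longleftrightarrow> \<gamma> = \<delta>"
  using inj_\<iota> by (auto dest: inj_onD)

lemma Carrier_S: "Carrier S = \<iota> ` T"
  by (simp add: S_def)

lemma T_cones: "\<gamma> \<in> T \<Longrightarrow> \<gamma> \<in> cones"
  using T_cone cones_iff by metis

lemma T_mult [simp]: "\<lbrakk>\<gamma> \<in> T; \<delta> \<in> T\<rbrakk> \<Longrightarrow> \<gamma> \<odot> \<delta> \<in> T"
  using mult_T T_cones by blast

lemma Mult_S [simp]: "\<lbrakk>\<gamma> \<in> T; \<delta> \<in> T\<rbrakk> \<Longrightarrow> Mult S (\<iota> \<delta>) (\<iota> \<gamma>) = \<iota> (\<gamma> \<odot> \<delta>)"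
  using inj_\<iota> by (simp add: S_def)

lemma T_assoc: "\<lbrakk>\<gamma> \<in> T; \<delta> \<in> T; \<eta> \<in> T\<rbrakk> \<Longrightarrow> (\<gamma> \<odot> \<delta>) \<odot> \<eta> = \<gamma> \<odot> (\<delta> \<odot> \<eta>)"
  using cone_semigroup T_cones by (simp add: is_semigroup_def)

lemma extensional_S: "extensional_sgrp S"
  by (auto simp: extensional_sgrp_def S_def extensional_def)

lemma idempotents_S: "idempotents S = (\<lambda>c. \<iota> (eps c)) ` Obj C"
proof (intro equalityI subsetI)
  fix e assume "e \<in> idempotents S"
  then obtain \<gamma> where "\<gamma> \<in> T" "e = \<iota> \<gamma>" "\<gamma> \<odot> \<gamma> = \<gamma>"
    by (auto simp: idempotents_def Carrier_S)
  then show "e \<in> (\<lambda>c. \<iota> (eps c)) ` Obj C"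
    using T_idempotent_iff by auto
next
  fix e assume "e \<in> (\<lambda>c. \<iota> (eps c)) ` Obj C"
  then obtain c where c: "c \<in> Obj C" "e = \<iota> (eps c)"
    by blast
  then have "eps c \<odot> eps c = eps c"
    using T_idempotent_iff[OF eps_T] by blast
  then show "e \<in> idempotents S"
    using c eps_T by (simp add: idempotents_def Carrier_S)
qed

lemma R_unipotent_S: "R_unipotent S"
  unfolding R_unipotent_iff
proof (intro conjI ballI impI)
  have "is_semigroup S"
    by (auto simp: is_semigroup_def Carrier_S T_assoc)
  moreover have "\<exists>x\<in>Carrier S. Mult S (Mult S a x) a = a" if a: "a \<in> Carrier S" for a
  proof -
    obtain \<gamma> where \<gamma>: "\<gamma> \<in> T" "a = \<iota> \<gamma>"
      using a by (auto simp: Carrier_S)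
    obtain \<delta> where "\<delta> \<in> T" "(\<gamma> \<odot> \<delta>) \<odot> \<gamma> = \<gamma>"
      using T_regular[OF \<gamma>(1)] .
    then show ?thesis
      using \<gamma> T_assoc by (auto simp: Carrier_S intro!: bexI[of _ "\<iota> \<delta>"])
  qed
  ultimately show "regular_semigroup S"
    by (simp add: regular_semigroup_def)
next
  fix e f assume "e \<in> idempotents S" "f \<in> idempotents S" "Mult S e f = f" "Mult S f e = e"
  then obtain a b where ab: "a \<in> Obj C" "b \<in> Obj C" "e = \<iota> (eps a)" "f = \<iota> (eps b)"
      and "\<iota> (eps b \<odot> eps a) = \<iota> (eps b)" "\<iota> (eps a \<odot> eps b) = \<iota> (eps a)"
    using eps_T by (auto simp: idempotents_S)
  then have "a = b"
    using eps_antisym[of a b] eps_T by simp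
  then show "e = f"
    using ab by simp
qed

sublocale R: r_unipotent enc S
  using inj_enc R_unipotent_S by unfold_locales

section \<open>Comparison of a supported category with the category of its connection
  semigroup\<close>

definition Fo :: "'u \<Rightarrow> 'u" where
  "Fo c = \<iota> (eps c)"

text \<open>The cone in the middle keeps only \<open>u\<degree>\<close>, its component at the domain
  of \<open>u\<close>; the recorded codomain determines the remaining inclusion.\<close>

definition Fa :: "'u \<Rightarrow> 'u" where
  "Fa u = enc (Fo (Dom C u), \<iota> (eps (Dom C u) \<star> u\<degree>), Fo (Cod C u))"

lemma Fa_eq: "u \<in> Hom C a b \<Longrightarrow> Fa u = enc (Fo a, \<iota> (eps a \<star> u\<degree>), Fo b)"
  by (simp add: Fa_def Hom_def)

lemma star_T:
  assumes "u \<in> Hom C a b"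
  shows "eps a \<star> u\<degree> \<in> T"
  using star_eps(3) epi_component_in_Hom[OF assms] by blast

lemma bij_Fo: "bij_betw Fo (Obj C) (idempotents S)"
proof (intro bij_betw_imageI inj_onI)
  fix a b assume "a \<in> Obj C" "b \<in> Obj C" "Fo a = Fo b"
  then show "a = b"
    using cone_vertex_unique eps(1) eps_T by (simp add: Fo_def) metis
qed (simp add: idempotents_S Fo_def image_def)

lemma Fo_E: "c \<in> Obj C \<Longrightarrow> Fo c \<in> idempotents S"
  using bij_Fo by (auto simp: bij_betw_def)

lemma Fo_inj: "\<lbrakk>a \<in> Obj C; b \<in> Obj C; Fo a = Fo b\<rbrakk> \<Longrightarrow> a = b"
  using bij_Fo by (auto simp: bij_betw_def inj_on_def)

lemma Fa_tri:
  assumes u: "u \<in> Hom C a b"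
  shows "R.tri (Fo a) (\<iota> (eps a \<star> u\<degree>)) (Fo b)"
proof -
  have ab: "a \<in> Obj C" "b \<in> Obj C"
    using Hom_Obj[OF u] by simp_all
  obtain z j where e: "u\<degree> \<in> Hom C a z" "split_epi u\<degree>" and j: "j \<in> Incl C" "j \<in> Hom C z b"
    and "u = u\<degree> \<cdot> j"
    using epi_componentE[OF u] .
  note \<tau> = star_eps[OF e(2,1)]
  have "eps a \<odot> (eps a \<star> u\<degree>) = eps a \<star> u\<degree>"
    using mult_eq[OF eps(1)[OF ab(1)]] \<tau>(2) epi_component_split_epi[OF e(2)] by simp
  moreover have "(eps a \<star> u\<degree>) \<odot> eps b = eps a \<star> u\<degree>"
    using eps_mult_eps_iff[OF \<tau>(1) e(2,1) refl ab(2)] eps_star_Incl[OF j] j(1) by simp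
  ultimately show ?thesis
    using \<tau>(3) ab Fo_E eps_T by (simp add: R.tri_iff Carrier_S) (simp add: Fo_def)
qed

lemma Fa_Hom: "u \<in> Hom C a b \<Longrightarrow> Fa u \<in> Hom R.C (Fo a) (Fo b)"
  using Fa_eq Fa_tri by simp

lemma functor_F: "cat_functor C R.C Fo Fa"
proof (intro cat_functor.intro cat_functor_axioms.intro category_axioms R.category_C)
  fix c assume c: "c \<in> Obj C"
  show "Fo c \<in> Obj R.C"
    using Fo_E[OF c] by simp
  have "(Ide C c)\<degree> = Ide C c"
    using epi_component_Incl[OF Ide_Incl[OF c]] Dom_Ide[OF c] by simp
  then show "Fa (Ide C c) = Ide R.C (Fo c)"
    using Fa_eq[OF Ide_in_Hom[OF c]] star_Ide[OF eps(1)[OF c]] Fo_E[OF c] by (simp add: Fo_def)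
next
  fix u assume "u \<in> Arr C"
  then show "Fa u \<in> Hom R.C (Fo (Dom C u)) (Fo (Cod C u))"
    using Fa_Hom by (simp add: Hom_def)
next
  fix u v assume "u \<in> Arr C" "v \<in> Arr C" "Cod C u = Dom C v"
  then obtain a b c where u: "u \<in> Hom C a b" and v: "v \<in> Hom C b c"
    by (simp add: Hom_def)
  have "Mult S (\<iota> (eps b \<star> v\<degree>)) (\<iota> (eps a \<star> u\<degree>)) = \<iota> (eps a \<star> (u \<cdot> v)\<degree>)"
    using eps_star_mult[OF u v] star_T[OF u] star_T[OF v] by simp
  then show "Fa (u \<cdot> v) = Comp R.C (Fa u) (Fa v)"
    using Fa_eq[OF u] Fa_eq[OF v] Fa_eq[OF Comp_in_Hom[OF u v]] Fa_tri[OF u] Fa_tri[OF v] by simp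
qed

text \<open>The component of the middle cone at \<open>a\<close> returns \<open>u\<degree>\<close>,
  and there is only one inclusion from its codomain to \<open>b\<close>.\<close>

lemma Fa_inj: "inj_on Fa (Arr C)"
proof (rule inj_onI)
  fix u v assume "u \<in> Arr C" "v \<in> Arr C" and eq: "Fa u = Fa v"
  then obtain a b a' b' where u: "u \<in> Hom C a b" and v: "v \<in> Hom C a' b'"
    by (simp add: Hom_def)
  have "Fo a = Fo a'" "Fo b = Fo b'" and \<tau>: "\<iota> (eps a \<star> u\<degree>) = \<iota> (eps a' \<star> v\<degree>)"
    using eq Fa_eq[OF u] Fa_eq[OF v] by simp_all
  then have ab: "a' = a" "b' = b"
    using Fo_inj Hom_Obj[OF u] Hom_Obj[OF v] by simp_all
  then have v: "v \<in> Hom C a b"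
    using v by simp
  have "eps a \<star> u\<degree> = eps a \<star> v\<degree>"
    using \<tau> ab star_T[OF u] star_T[OF v] by simp
  then have uv: "u\<degree> = v\<degree>"
    using star_eps(2) epi_component_in_Hom[OF u] epi_component_in_Hom[OF v] by metis
  obtain z j where e: "u\<degree> \<in> Hom C a z" and j: "j \<in> Incl C" "j \<in> Hom C z b" "u = u\<degree> \<cdot> j"
    using epi_componentE[OF u] by metis
  obtain z' j' where e': "v\<degree> \<in> Hom C a z'" and j': "j' \<in> Incl C" "j' \<in> Hom C z' b" "v = v\<degree> \<cdot> j'"
    using epi_componentE[OF v] by metis
  have "z' = z"
    using e e' uv by (simp add: Hom_def)
  then have "j' = j"
    using Incl_unique[OF j'(1) j(1)] j(2) j'(2) by simp
  then show "u = v"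
    using j(3) j'(3) uv by simp
qed

lemma Fa_surj:
  assumes "m \<in> Arr R.C"
  obtains u where "u \<in> Arr C" "m = Fa u"
proof -
  obtain e x f where m: "m = enc (e, x, f)" "R.tri e x f"
    using assms by (rule R.ArrE)
  then obtain a b \<tau> where ab: "a \<in> Obj C" "b \<in> Obj C" "e = Fo a" "f = Fo b" and \<tau>: "\<tau> \<in> T" "x = \<iota> \<tau>"
      and "\<iota> (eps a \<odot> \<tau>) = \<iota> \<tau>" "\<iota> (\<tau> \<odot> eps b) = \<iota> \<tau>"
    using eps_T by (auto simp: R.tri_iff idempotents_S Carrier_S Fo_def)
  then have a\<tau>: "eps a \<odot> \<tau> = \<tau>" and \<tau>b: "\<tau> \<odot> eps b = \<tau>"
    using eps_T by simp_all
  obtain z where z: "is_cone C z \<tau>"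
    using T_cone[OF \<tau>(1)] .
  have w: "split_epi (\<tau> a)" "\<tau> a \<in> Hom C a z" "\<tau> = eps a \<star> \<tau> a"
    using component_split_epi[OF ab(1) z] a\<tau> mult_eq[OF eps(1)[OF ab(1)]] by simp_all
  \<comment> \<open>Since \<open>\<tau>\<close> absorbs \<open>eps b\<close> on the right, its
    vertex \<open>z\<close> is included in \<open>b\<close>. The preimage is the epimorphism
    \<open>\<tau> a\<close> followed by this inclusion.\<close>
  have j: "eps b z \<in> Incl C" "eps b z \<in> Hom C z b"
    using eps_mult_eps_iff[OF z w ab(2)] \<tau>b eps_Hom[OF ab(2)] Hom_Obj[OF w(2)] by simp_all
  have u: "\<tau> a \<cdot> eps b z \<in> Hom C a b"
    using Comp_in_Hom[OF w(2) j(2)] .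
  have "Fa (\<tau> a \<cdot> eps b z) = m"
    using Fa_eq[OF u] epi_component_eq[OF w(1,2) j] w(3) m ab \<tau> by simp
  then show ?thesis
    using that HomD(1)[OF u] by blast
qed

lemma Fa_Incl_iff:
  assumes "j \<in> Arr C"
  shows "Fa j \<in> Incl R.C \<longleftrightarrow> j \<in> Incl C"
proof -
  obtain a b where j: "j \<in> Hom C a b"
    using assms by (simp add: Hom_def)
  note ab = Hom_Obj[OF j] and jo = epi_component_in_Hom[OF j]
  have "Fa j \<in> Incl R.C \<longleftrightarrow> \<iota> (eps a \<star> j\<degree>) = \<iota> (eps a)"
    using Fa_eq[OF j] Fa_tri[OF j] by (auto simp: R.Incl_C Fo_def)
  also have "\<dots> \<longleftrightarrow> eps a \<star> j\<degree> = eps a"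
    using star_T[OF j] eps_T[OF ab(1)] by simp
  also have "\<dots> \<longleftrightarrow> j\<degree> = Ide C a"
    using star_eps(2)[OF jo(2,1)] eps(2)[OF ab(1)] star_Ide[OF eps(1)[OF ab(1)]] by metis
  also have "\<dots> \<longleftrightarrow> j \<in> Incl C"
    using Incl_if_epi_component_Ide[OF j] epi_component_Incl[of j] HomD(2)[OF j] by auto
  finally show ?thesis .
qed

text \<open>On both sides the middle entry is the product \<open>eps x \<odot> eps c\<close>, which
  is \<open>eps x \<star> (eps c x)\<degree>\<close> by definition of the product.\<close>

lemma Fa_eps:
  assumes "c \<in> Obj C" "x \<in> Obj C"
  shows "Fa (eps c x) = support_cone R.ccat (Fo c) (Fo x)"
proof -
  have "Mult S (Fo c) (Fo x) = \<iota> (eps x \<star> (eps c x)\<degree>)"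
    using mult_eq[OF eps(1)[OF assms(2)]] eps_T assms by (simp add: Fo_def)
  then show ?thesis
    using Fa_eq[OF eps_Hom[OF assms]] Fo_E assms R.lam_E by (simp add: R.rho_def)
qed

lemma ccat_S_isomorphic:
  assumes "extensional_category C"
  shows "\<exists>t\<in>Hom SC R.ccat X. isomorphism SC t"
proof (rule isomorphism_of_bijective_functor[where Fo = Fo and Fa = Fa])
  show "X \<in> Obj SC" "R.ccat \<in> Obj SC"
    using assms supported R.supported_ccat R.extensional_C by (simp_all add: Obj_SC)
  have "Fa ` Arr C = Arr R.C"
    using Fa_surj HomD(1)[OF cat_functor.maps_Arr[OF functor_F]] by blast
  then show "bij_betw Fa (Arr C) (Arr (Cat R.ccat))"
    using Fa_inj by (simp add: bij_betw_def)
qed (use functor_F bij_Fo Fa_Incl_iff Fa_eps in simp_all)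

end

section \<open>The equivalence\<close>

lemma infinite_triple_encoding:
  assumes "infinite (UNIV :: 'u set)"
  shows "\<exists>enc :: 'u \<times> 'u \<times> 'u \<Rightarrow> 'u. inj enc"
proof -
  have "\<exists>f. bij_betw f (UNIV \<times> UNIV :: ('u \<times> 'u) set) (UNIV :: 'u set)"
    unfolding card_of_ordIso by (rule card_of_Times_same_infinite[OF assms])
  then obtain f :: "'u \<times> 'u \<Rightarrow> 'u" where f: "inj f"
    by (auto simp: bij_betw_def)
  then have "inj (\<lambda>(x, p). f (x, f p))"
    by (auto intro!: injI dest!: injD[OF f])
  then show ?thesis by blast
qed

theorem corollary4p14:
  assumes "infinite (UNIV :: 'u set)"
  shows "equivalent_categories
    (RUS :: ('u sgrp, ('u sgrp, 'u \<Rightarrow> 'u) arrow) precategory)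
    (SC :: (('u, 'u) ccat, (('u, 'u) ccat, ('u, 'u, 'u, 'u) cc_map) arrow) precategory)"
proof -
  obtain enc :: "'u \<times> 'u \<times> 'u \<Rightarrow> 'u" where enc: "inj enc"
    using infinite_triple_encoding[OF assms] by blast
  show ?thesis
  proof (rule equivalent_if_fully_faithful_essentially_surjective[OF ideal_functor[OF enc]])
    fix S T :: "'u sgrp" and g
    assume ST: "S \<in> Obj RUS" "T \<in> Obj RUS"
      and g: "g \<in> Hom SC (r_unipotent.ccat enc S) (r_unipotent.ccat enc T)"
    interpret r_unipotent_pair enc S T
      using enc ST by unfold_locales (simp_all add: Obj_RUS)
    obtain \<phi> where \<phi>: "g = Arrow S.ccat \<phi> T.ccat" "cc_morphism S.ccat T.ccat \<phi>"
        "extensional_cc_map S.ccat \<phi>"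
      using g by (auto simp: Hom_def Arr_SC)
    obtain h where "h \<in> semigroup_homs S T" "induced_cc_map enc S T h = \<phi>"
      using induced_surj[OF \<phi>(2,3)] .
    then show "\<exists>f\<in>Hom RUS S T. ideal_arrow enc f = g"
      using ST \<phi> by (intro bexI[of _ "Arrow S h T"]) (auto simp: Hom_def Arr_RUS ideal_arrow_def)
  next
    fix S T :: "'u sgrp" and f g
    assume fg: "f \<in> Hom RUS S T" "g \<in> Hom RUS S T" "ideal_arrow enc f = ideal_arrow enc g"
    then obtain h k where f: "f = Arrow S h T" "h \<in> semigroup_homs S T"
        and g: "g = Arrow S k T" "k \<in> semigroup_homs S T" and ST: "S \<in> Obj RUS" "T \<in> Obj RUS"
      by (auto simp: Hom_def Arr_RUS)
    interpret r_unipotent_pair enc S T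
      using enc ST by unfold_locales (simp_all add: Obj_RUS)
    show "f = g"
      using induced_inj[OF f(2) g(2)] fg(3) f g by (simp add: ideal_arrow_def)
  next
    fix X :: "('u, 'u) ccat"
    assume X: "X \<in> Obj SC"
    interpret supported X
      using X by unfold_locales (simp add: Obj_SC)
    obtain \<iota> :: "('u \<Rightarrow> 'u) \<Rightarrow> 'u" where \<iota>: "inj_on \<iota> T"
      using T_embedding by blast
    interpret connection X enc \<iota>
      using enc \<iota> by unfold_locales
    show "\<exists>S\<in>Obj RUS. \<exists>t\<in>Hom SC (r_unipotent.ccat enc S) X. isomorphism SC t"
      using ccat_S_isomorphic R_unipotent_S extensional_S X by (intro bexI[of _ S]) (simp_all add: Obj_SC Obj_RUS)
  qed
qed

end
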